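(* Let $r\ge 1$ be a fixed integer and let $\boldsymbol{\mu}=\{\mu_1,\ldots,\mu_r\}$ be a fixed probability distribution with $\mu_i>0$ for $i=1,\ldots,r$. Consider a scaling $\boldsymbol{\Theta}=(K_1,\ldots,K_r,P,\alpha):\mathbb{N}_0\to\mathbb{N}_0^{r+1}\times(0,1)$ such that $$\Lambda_1(n)=\alpha_n\lambda_1(n)\sim c\,\frac{\log n}{n}$$ for some $c>0$. Then $$\lim_{n\to\infty}\mathbb{P}\left[\mathbb{G}(n;\boldsymbol{\mu},\boldsymbol{\Theta}_n)\text{ is connected}\right]=\begin{cases}0 & \text{if } c<1,\\ 1 & \text{if } c>1,\end{cases}$$ under the additional conditions that $$P_n\ge\sigma n,\quad n=1,2,\ldots$$ for some $\sigma>0$, and $$p_{11}(n)=\omega\left(\frac{1}{n\alpha_n}\right).$$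
   Context: Random graph model. Given $n$, a probability distribution $\boldsymbol{\mu}=\{\mu_1,\ldots,\mu_r\}$, integers $K_1,\ldots,K_r,P$ and $\alpha\in(0,1)$: each of the nodes $v_1,\ldots,v_n$ is independently assigned a class $t_x\in\{1,\ldots,r\}$ with $\mathbb{P}[t_x=i]=\mu_i$. Given its class $t_x=i$, node $v_x$ receives a key ring $\Sigma_x$ drawn uniformly at random among all $K_i$-element subsets of $\{1,\ldots,P\}$, independently across nodes. The inhomogeneous random key graph $\mathbb{K}(n;\boldsymbol{\mu},\boldsymbol{K},P)$ has vertex set $\{v_1,\ldots,v_n\}$, and distinct $v_x,v_y$ are adjacent iff $\Sigma_x\cap\Sigma_y\neq\emptyset$. Independently, $\mathbb{H}(n;\alpha)$ is the Erdős–Rényi graph on the same vertices, in which each pair is adjacent with probability $\alpha$ independently of all other pairs. The graph $\mathbb{G}(n;\boldsymbol{\mu},\boldsymbol{\Theta})$, with $\boldsymbol{\Theta}=(K_1,\ldots,K_r,P,\alpha)$, is the intersection: two nodes are adjacent iff they are adjacent in both $\mathbb{K}(n;\boldsymbol{\mu},\boldsymbol{K},P)$ and $\mathbb{H}(n;\alpha)$. Edge probabilities: $p_{ij}=1-\binom{P-K_i}{K_j}/\binom{P}{K_j}$ (the probability that a class-$i$ and a class-$j$ node share a key, when $K_i+K_j\le P$), $\lambda_i=\sum_{j=1}^r\mu_jp_{ij}$, and $\Lambda_i=\alpha\lambda_i$. Scaling: a map $\boldsymbol{\Theta}=(K_1,\ldots,K_r,P,\alpha):\mathbb{N}_0\to\mathbb{N}_0^{r+1}\times(0,1)$,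 $n\mapsto\boldsymbol{\Theta}_n=(K_{1,n},\ldots,K_{r,n},P_n,\alpha_n)$, is called a scaling if $1\le K_{1,n}\le K_{2,n}\le\cdots\le K_{r,n}\le P_n/2$ for all $n=2,3,\ldots$. The quantities $p_{ij}(n),\lambda_i(n),\Lambda_i(n)$ are those obtained from the parameters $\boldsymbol{\Theta}_n$. The number of classes $r$ and the distribution $\boldsymbol{\mu}$ do not depend on $n$. The notation $a_n\sim b_n$ means $\lim_{n\to\infty}a_n/b_n=1$, and $a_n=\omega(b_n)$ means $a_n/b_n\to\infty$ as $n\to\infty$. *)

theory Defs
  imports
    "HOL-Probability.Probability"
    "HOL-Library.Landau_Symbols"
    "Graph_Theory.Digraph_Component"
begin

text \<open>
  An undirected simple graph is a loop-free symmetric \<^typ>\<open>'a pair_pre_digraph\<close>, as in the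
  locale \<^locale>\<open>pair_graph\<close>. The nodes are \<open>1, \<dots>, n\<close>, the classes \<open>1, \<dots>, r\<close> and the
  keys \<open>1, \<dots>, P\<close>. The class distribution is a \<^typ>\<open>nat pmf\<close> with support \<open>{1..r}\<close>, and
  \<open>K i\<close> is the size of the key rings of the nodes of class \<open>i\<close>.
\<close>

definition key_graph :: "nat \<Rightarrow> (nat \<Rightarrow> nat set) \<Rightarrow> nat pair_pre_digraph" where
  "key_graph n \<Sigma> =
     \<lparr>pverts = {1..n},
      parcs = {(x, y). x \<in> {1..n} \<and> y \<in> {1..n} \<and> x \<noteq> y \<and> \<Sigma> x \<inter> \<Sigma> y \<noteq> {}}\<rparr>"

text \<open>
  For \<open>K i > P\<close> there is no key ring of size \<open>K i\<close>, and \<^const>\<open>pmf_of_set\<close> is unspecified.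
  The values of the functions outside \<open>{1..n}\<close> are set by \<^const>\<open>Pi_pmf\<close> to a dummy.
\<close>

definition inhom_random_key_graph ::
    "nat \<Rightarrow> nat pmf \<Rightarrow> (nat \<Rightarrow> nat) \<Rightarrow> nat \<Rightarrow> nat pair_pre_digraph pmf" where
  "inhom_random_key_graph n \<mu> K P =
     bind_pmf (Pi_pmf {1..n} undefined (\<lambda>_. \<mu>)) (\<lambda>t.
     bind_pmf (Pi_pmf {1..n} {} (\<lambda>x. pmf_of_set {S. S \<subseteq> {1..P} \<and> card S = K (t x)})) (\<lambda>\<Sigma>.
     return_pmf (key_graph n \<Sigma>)))"

definition erdos_renyi_graph :: "nat \<Rightarrow> real \<Rightarrow> nat pair_pre_digraph pmf" where
  "erdos_renyi_graph n \<alpha> =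
     map_pmf (\<lambda>B. \<lparr>pverts = {1..n},
                    parcs = {(x, y). x \<in> {1..n} \<and> y \<in> {1..n} \<and> x \<noteq> y \<and> B {x, y}}\<rparr>)
       (Pi_pmf {e. e \<subseteq> {1..n} \<and> card e = 2} False (\<lambda>_. bernoulli_pmf \<alpha>))"

definition graph_inter :: "'a pair_pre_digraph \<Rightarrow> 'a pair_pre_digraph \<Rightarrow> 'a pair_pre_digraph" where
  "graph_inter G H = \<lparr>pverts = pverts G \<inter> pverts H, parcs = parcs G \<inter> parcs H\<rparr>"

definition random_graph ::
    "nat \<Rightarrow> nat pmf \<Rightarrow> (nat \<Rightarrow> nat) \<Rightarrow> nat \<Rightarrow> real \<Rightarrow> nat pair_pre_digraph pmf" where
  "random_graph n \<mu> K P \<alpha> =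
     map_pmf (\<lambda>(G, H). graph_inter G H)
       (pair_pmf (inhom_random_key_graph n \<mu> K P) (erdos_renyi_graph n \<alpha>))"

definition key_prob :: "(nat \<Rightarrow> nat) \<Rightarrow> nat \<Rightarrow> nat \<Rightarrow> nat \<Rightarrow> real" where
  "key_prob K P i j = 1 - real ((P - K i) choose K j) / real (P choose K j)"

definition mean_key_prob :: "nat \<Rightarrow> nat pmf \<Rightarrow> (nat \<Rightarrow> nat) \<Rightarrow> nat \<Rightarrow> nat \<Rightarrow> real" where
  "mean_key_prob r \<mu> K P i = (\<Sum>j=1..r. pmf \<mu> j * key_prob K P i j)"

definition mean_edge_prob ::
    "nat \<Rightarrow> nat pmf \<Rightarrow> (nat \<Rightarrow> nat) \<Rightarrow> nat \<Rightarrow> real \<Rightarrow> nat \<Rightarrow> real" where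
  "mean_edge_prob r \<mu> K P \<alpha> i = \<alpha> * mean_key_prob r \<mu> K P i"

definition scaling ::
    "nat \<Rightarrow> (nat \<Rightarrow> nat \<Rightarrow> nat) \<Rightarrow> (nat \<Rightarrow> nat) \<Rightarrow> (nat \<Rightarrow> real) \<Rightarrow> bool" where
  "scaling r K P \<alpha> \<longleftrightarrow>
     (\<forall>n. \<alpha> n \<in> {0<..<1}) \<and>
     (\<forall>n\<ge>2. 1 \<le> K n 1 \<and> mono_on {1..r} (K n) \<and> real (K n r) \<le> real (P n) / 2)"

end

theory Submission
  imports Defs "HOL-Real_Asymp.Real_Asymp"
begin

text \<open>
  Below the threshold, the number of isolated nodes with a smallest possible key ring has mean
  tending to infinity. The only correlation between two such nodes that matters arises when their
  rings meet, an event of probability \<open>p\<^sub>1\<^sub>1\<close>; it multiplies the joint probability of isolation by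
  at most \<open>n powr (\<alpha> c')\<close> with \<open>c < c' < 1\<close>, and \<open>p\<^sub>1\<^sub>1 (n powr (\<alpha> c') - 1) \<le> C (ln n)\<^sup>2 n powr (c' - 1)\<close>
  tends to zero. So the second moment method applies.

  Above the threshold, a disconnected graph has a set \<open>S\<close> of at most half of the nodes with no edge
  leaving it, and a plain union bound over \<open>S\<close> suffices. Expose the key rings of \<open>S\<close> first. With
  high probability every set of \<open>i\<close> nodes, \<open>i \<le> \<kappa> P / K\<^sub>1\<close>, has rings with a union of at least
  \<open>(1 - \<epsilon>) i K\<^sub>1\<close> keys: this uses \<open>K\<^sub>1 \<longlongrightarrow> \<infinity>\<close>, which follows from \<open>P \<ge> \<sigma> n\<close> and
  \<open>n \<alpha> p\<^sub>1\<^sub>1 \<longlongrightarrow> \<infinity>\<close>. A node \<open>z\<close> outside \<open>S\<close> is adjacent in the Erdos-Renyi graph to a random subset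
  \<open>R\<close> of \<open>S\<close>, and it misses \<open>S\<close> iff its ring misses the union of the rings of \<open>R\<close>. On the expansion
  event this has probability at most \<open>1 - (1 - \<epsilon>)\<^sup>2 |S| \<Lambda>\<^sub>1\<close> for \<open>|S| \<Lambda>\<^sub>1\<close> small, it is
  bounded away from one for larger \<open>S\<close>, and it tends to zero for \<open>|S|\<close> linear in \<open>n\<close>.
\<close>

section \<open>Cuts in the intersection graph\<close>

text \<open>The cut bound suffers two losses. Rings of different nodes overlap, which costs an
  exponent 1 - \<epsilon>; and expansion is only guaranteed while the rings fill a small fraction of
  the key pool, so no gain is counted beyond \<open>cover_max\<close> rings. The truncation is
  harmless because \<open>p\<^sub>1\<^sub>1\<close> times the truncation level is bounded below.
  Connectedness inside S need not be exploited: at most \<open>n ^ l\<close> sets of size l compete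
  with a cut probability of at most \<open>n powr (- (1 + \<delta>) * l)\<close>, where
  \<open>1 + \<delta> = (1 - \<epsilon>) ^ 4 * c\<close>. This regime ends when |S| \<Lambda>
  reaches a small constant t. Past that point a subset of S of size about t / \<Lambda> already
  gives a cut probability exponentially small in n, which beats the number of sets up to size
  \<open>\<epsilon>2 * n\<close>. For still larger sets the growth of
  \<open>n * \<alpha> * p\<^sub>1\<^sub>1\<close> pushes the avoidance probability below exp (-4),
  which beats the number of all sets. The constants are chosen in the order \<epsilon>, \<kappa>, t,
  \<epsilon>2.\<close>

definition pairs_in :: "'a set \<Rightarrow> 'a set set" where
  "pairs_in V = {e. e \<subseteq> V \<and> card e = 2}"

definition no_edges :: "('a \<Rightarrow> 'k set) \<Rightarrow> ('a set \<Rightarrow> bool) \<Rightarrow> 'a set \<Rightarrow> 'a set \<Rightarrow> bool" where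
  "no_edges \<sigma> B S T \<longleftrightarrow> (\<forall>x\<in>S. \<forall>z\<in>T. \<sigma> x \<inter> \<sigma> z \<noteq> {} \<longrightarrow> \<not> B {x, z})"

definition joint_pmf ::
    "'a set \<Rightarrow> 'k set pmf \<Rightarrow> real \<Rightarrow> (('a \<Rightarrow> 'k set) \<times> ('a set \<Rightarrow> bool)) pmf" where
  "joint_pmf V \<rho> \<alpha> = pair_pmf (Pi_pmf V {} (\<lambda>_. \<rho>)) (Pi_pmf (pairs_in V) False (\<lambda>_. bernoulli_pmf \<alpha>))"

text \<open>The probability, over the Bernoulli edges alone, that an outside node with ring
  \<open>Z\<close> has no edge into \<open>S\<close>, given the rings \<sigma> of
  \<open>S\<close>.\<close>

definition avoid_fun :: "real \<Rightarrow> 'a set \<Rightarrow> ('a \<Rightarrow> 'k set) \<Rightarrow> 'k set \<Rightarrow> real" where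
  "avoid_fun \<alpha> S \<sigma> Z = (\<Prod>x\<in>S. 1 - \<alpha> * of_bool (\<sigma> x \<inter> Z \<noteq> {}))"

definition avoid_prob :: "'k set pmf \<Rightarrow> real \<Rightarrow> 'a set \<Rightarrow> ('a \<Rightarrow> 'k set) \<Rightarrow> real" where
  "avoid_prob \<rho> \<alpha> S \<sigma> = measure_pmf.expectation \<rho> (avoid_fun \<alpha> S \<sigma>)"

lemma finite_pairs_in: "finite V \<Longrightarrow> finite (pairs_in V)"
  unfolding pairs_in_def by (rule finite_subset[of _ "Pow V"]) auto

text \<open>For fixed rings the event switches off exactly the pairs whose rings meet. As
  \<open>S\<close> and \<open>T\<close> are disjoint, different (z, x) give different unordered
  pairs, so independence applies and the product can be grouped by z.\<close>

lemma prob_no_bernoulli_edges: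
  assumes "finite V" "S \<subseteq> V" "T \<subseteq> V" "S \<inter> T = {}" "\<alpha> \<in> {0..1}"
  shows "measure_pmf.prob (Pi_pmf (pairs_in V) False (\<lambda>_. bernoulli_pmf \<alpha>)) {B. no_edges \<sigma> B S T}
       = (\<Prod>z\<in>T. avoid_fun \<alpha> S \<sigma> (\<sigma> z))"
proof -
  define X where "X = {(z, x). z \<in> T \<and> x \<in> S \<and> \<sigma> x \<inter> \<sigma> z \<noteq> {}}"
  define F where "F = (\<lambda>(z, x). {x, z}) ` X"
  have fin: "finite S" "finite T" using assms finite_subset by auto
  have X: "X \<subseteq> T \<times> S" by (auto simp: X_def)
  have inj: "inj_on (\<lambda>(z, x). {x, z}) X"
    using assms(4) by (auto simp: inj_on_def X_def doubleton_eq_iff)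
  have F: "F \<subseteq> pairs_in V"
    using assms by (auto simp: F_def X_def pairs_in_def card_2_iff) (metis IntI empty_iff)+
  have "{B. no_edges \<sigma> B S T} = Pi (pairs_in V) (\<lambda>e. if e \<in> F then {False} else UNIV)"
  proof (intro set_eqI iffI)
    fix B assume "B \<in> {B. no_edges \<sigma> B S T}"
    then show "B \<in> Pi (pairs_in V) (\<lambda>e. if e \<in> F then {False} else UNIV)"
      by (auto simp: no_edges_def F_def X_def Pi_def)
  next
    fix B assume B: "B \<in> Pi (pairs_in V) (\<lambda>e. if e \<in> F then {False} else UNIV)"
    show "B \<in> {B. no_edges \<sigma> B S T}"
      unfolding no_edges_def mem_Collect_eq
    proof (intro ballI impI)
      fix x z assume "x \<in> S" "z \<in> T" "\<sigma> x \<inter> \<sigma> z \<noteq> {}"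
      then have "{x, z} \<in> F" by (force simp: F_def X_def)
      then show "\<not> B {x, z}" using B F by (auto simp: Pi_def split: if_splits)
    qed
  qed
  then have "measure_pmf.prob (Pi_pmf (pairs_in V) False (\<lambda>_. bernoulli_pmf \<alpha>)) {B. no_edges \<sigma> B S T}
      = (\<Prod>e\<in>pairs_in V. measure_pmf.prob (bernoulli_pmf \<alpha>) (if e \<in> F then {False} else UNIV))"
    by (simp add: measure_Pi_pmf_Pi[OF finite_pairs_in[OF assms(1)]])
  also have "\<dots> = (\<Prod>e\<in>F. 1 - \<alpha>)"
    using assms(5) F finite_pairs_in[OF assms(1)]
    by (intro prod.mono_neutral_cong_right) (auto simp: measure_pmf_single)
  also have "\<dots> = (\<Prod>p\<in>X. 1 - \<alpha>)"
    unfolding F_def using inj by (subst prod.reindex) (auto simp: case_prod_unfold)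
  also have "\<dots> = (\<Prod>(z, x)\<in>T \<times> S. 1 - \<alpha> * of_bool (\<sigma> x \<inter> \<sigma> z \<noteq> {}))"
    using X fin by (intro prod.mono_neutral_cong_left) (auto simp: X_def)
  also have "\<dots> = (\<Prod>z\<in>T. avoid_fun \<alpha> S \<sigma> (\<sigma> z))"
    by (simp add: prod.cartesian_product avoid_fun_def)
  finally show ?thesis .
qed

lemma avoid_fun_bounds:
  assumes "\<alpha> \<in> {0..1}" shows "0 \<le> avoid_fun \<alpha> S \<sigma> Z" "avoid_fun \<alpha> S \<sigma> Z \<le> 1"
  using assms unfolding avoid_fun_def by (auto intro!: prod_nonneg prod_le_1)

lemma integrable_avoid_fun:
  "\<alpha> \<in> {0..1} \<Longrightarrow> integrable (measure_pmf \<rho>) (avoid_fun \<alpha> S \<sigma>)"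
  by (rule measure_pmf.integrable_const_bound[where B=1]) (auto simp: avoid_fun_bounds)

lemma avoid_prob_bounds:
  assumes "\<alpha> \<in> {0..1}" shows "0 \<le> avoid_prob \<rho> \<alpha> S \<sigma>" "avoid_prob \<rho> \<alpha> S \<sigma> \<le> 1"
  unfolding avoid_prob_def using assms
  by (auto intro!: Bochner_Integration.integral_nonneg measure_pmf.integral_le_const
      simp: avoid_fun_bounds integrable_avoid_fun)

text \<open>Once the rings of \<open>S\<close> are exposed, the outside nodes act independently and
  each avoids \<open>S\<close> with probability \<open>avoid_prob\<close>. The predicate
  \<open>Q\<close> sees only the rings of \<open>S\<close>, so it leaves the inner integral as a
  constant factor.\<close>

lemma prob_no_edges:
  fixes \<rho> :: "'k set pmf" and V :: "'a set"
  assumes V: "finite V" "S \<subseteq> V" and \<alpha>: "\<alpha> \<in> {0..1}"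
    and Q: "\<And>\<sigma> \<sigma>'. (\<And>x. x \<in> S \<Longrightarrow> \<sigma> x = \<sigma>' x) \<Longrightarrow> Q \<sigma> = Q \<sigma>'"
  shows "measure_pmf.prob (joint_pmf V \<rho> \<alpha>) {(\<sigma>, B). Q \<sigma> \<and> no_edges \<sigma> B S (V - S)}
    = measure_pmf.expectation (Pi_pmf S {} (\<lambda>_. \<rho>))
        (\<lambda>\<sigma>. of_bool (Q \<sigma>) * avoid_prob \<rho> \<alpha> S \<sigma> ^ card (V - S))"
proof -
  let ?T = "V - S" and ?ps = "Pi_pmf S {} (\<lambda>_. \<rho>)" and ?pt = "Pi_pmf (V - S) {} (\<lambda>_. \<rho>)"
  let ?B = "Pi_pmf (pairs_in V) False (\<lambda>_. bernoulli_pmf \<alpha>)"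
  let ?g = "\<lambda>\<sigma>. of_bool (Q \<sigma>) * (\<Prod>z\<in>?T. avoid_fun \<alpha> S \<sigma> (\<sigma> z))"
  have fin: "finite S" "finite ?T" using V finite_subset by auto
  have bounds: "0 \<le> avoid_prob \<rho> \<alpha> S \<sigma>" "avoid_prob \<rho> \<alpha> S \<sigma> \<le> 1" for \<sigma>
    using avoid_prob_bounds[OF \<alpha>] by auto
  have "emeasure (joint_pmf V \<rho> \<alpha>) {(\<sigma>, B). Q \<sigma> \<and> no_edges \<sigma> B S ?T}
      = (\<integral>\<^sup>+\<sigma>. \<integral>\<^sup>+B. indicator {(\<sigma>, B). Q \<sigma> \<and> no_edges \<sigma> B S ?T} (\<sigma>, B) \<partial>?B \<partial>Pi_pmf V {} (\<lambda>_. \<rho>))"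
    unfolding joint_pmf_def by (simp flip: nn_integral_indicator add: nn_integral_pair_pmf')
  also have "\<dots> = (\<integral>\<^sup>+\<sigma>. ennreal (?g \<sigma>) \<partial>Pi_pmf V {} (\<lambda>_. \<rho>))"
  proof (intro nn_integral_cong)
    fix \<sigma>
    have "(\<integral>\<^sup>+B. indicator {(\<sigma>, B). Q \<sigma> \<and> no_edges \<sigma> B S ?T} (\<sigma>, B) \<partial>?B)
        = (\<integral>\<^sup>+B. of_bool (Q \<sigma>) * indicator {B. no_edges \<sigma> B S ?T} B \<partial>?B)"
      by (intro nn_integral_cong) (auto simp: indicator_def)
    also have "\<dots> = of_bool (Q \<sigma>) * emeasure ?B {B. no_edges \<sigma> B S ?T}"
      by (subst nn_integral_cmult) auto
    also have "emeasure ?B {B. no_edges \<sigma> B S ?T} = ennreal (\<Prod>z\<in>?T. avoid_fun \<alpha> S \<sigma> (\<sigma> z))"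
      using V \<alpha> by (subst measure_pmf.emeasure_eq_measure, subst prob_no_bernoulli_edges) auto
    finally show "(\<integral>\<^sup>+B. indicator {(\<sigma>, B). Q \<sigma> \<and> no_edges \<sigma> B S ?T} (\<sigma>, B) \<partial>?B) = ennreal (?g \<sigma>)"
      by auto
  qed
  also have "\<dots> = (\<integral>\<^sup>+\<sigma>. \<integral>\<^sup>+\<tau>. ennreal (?g (\<lambda>x. if x \<in> S then \<sigma> x else \<tau> x)) \<partial>?pt \<partial>?ps)"
  proof -
    have "V = S \<union> ?T" using V by auto
    then have "Pi_pmf V {} (\<lambda>_. \<rho>) = map_pmf (\<lambda>(f,g) x. if x \<in> S then f x else g x) (pair_pmf ?ps ?pt)"
      using Pi_pmf_union[OF fin, of "{}" "\<lambda>_. \<rho>"] by auto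
    then show ?thesis by (simp add: nn_integral_pair_pmf')
  qed
  also have "\<dots> = (\<integral>\<^sup>+\<sigma>. ennreal (of_bool (Q \<sigma>) * avoid_prob \<rho> \<alpha> S \<sigma> ^ card ?T) \<partial>?ps)"
  proof (intro nn_integral_cong)
    fix \<sigma>
    have eq: "?g (\<lambda>x. if x \<in> S then \<sigma> x else \<tau> x) = of_bool (Q \<sigma>) * (\<Prod>z\<in>?T. avoid_fun \<alpha> S \<sigma> (\<tau> z))" for \<tau>
    proof -
      have "Q (\<lambda>x. if x \<in> S then \<sigma> x else \<tau> x) = Q \<sigma>" by (rule Q) auto
      then show ?thesis by (simp add: avoid_fun_def)
    qed
    have "(\<integral>\<^sup>+\<tau>. ennreal (?g (\<lambda>x. if x \<in> S then \<sigma> x else \<tau> x)) \<partial>?pt)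
        = (\<integral>\<^sup>+\<tau>. of_bool (Q \<sigma>) * (\<Prod>z\<in>?T. ennreal (avoid_fun \<alpha> S \<sigma> (\<tau> z))) \<partial>?pt)"
    proof (intro nn_integral_cong)
      fix \<tau> :: "'a \<Rightarrow> 'k set"
      have "(\<Prod>z\<in>?T. ennreal (avoid_fun \<alpha> S \<sigma> (\<tau> z))) = ennreal (\<Prod>z\<in>?T. avoid_fun \<alpha> S \<sigma> (\<tau> z))"
        by (rule prod_ennreal) (use avoid_fun_bounds[OF \<alpha>, of S \<sigma>] in auto)
      then show "ennreal (?g (\<lambda>x. if x \<in> S then \<sigma> x else \<tau> x))
          = of_bool (Q \<sigma>) * (\<Prod>z\<in>?T. ennreal (avoid_fun \<alpha> S \<sigma> (\<tau> z)))"
        unfolding eq by auto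
    qed
    also have "\<dots> = of_bool (Q \<sigma>) * (\<Prod>z\<in>?T. \<integral>\<^sup>+Z. ennreal (avoid_fun \<alpha> S \<sigma> Z) \<partial>\<rho>)"
      using nn_integral_prod_Pi_pmf[OF fin(2), of "{}" "\<lambda>_. \<rho>" "\<lambda>_ Z. ennreal (avoid_fun \<alpha> S \<sigma> Z)"]
      by (subst nn_integral_cmult) auto
    also have "(\<integral>\<^sup>+Z. ennreal (avoid_fun \<alpha> S \<sigma> Z) \<partial>\<rho>) = ennreal (avoid_prob \<rho> \<alpha> S \<sigma>)"
      unfolding avoid_prob_def
      using integrable_avoid_fun[OF \<alpha>, of \<rho> S \<sigma>] avoid_fun_bounds[OF \<alpha>, of S \<sigma>] by (intro nn_integral_eq_integral AE_pmfI) auto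
    finally show "(\<integral>\<^sup>+\<tau>. ennreal (?g (\<lambda>x. if x \<in> S then \<sigma> x else \<tau> x)) \<partial>?pt)
        = ennreal (of_bool (Q \<sigma>) * avoid_prob \<rho> \<alpha> S \<sigma> ^ card ?T)"
      using avoid_prob_bounds[OF \<alpha>, of \<rho> S \<sigma>] by (auto simp: ennreal_power)
  qed
  also have "\<dots> = ennreal (measure_pmf.expectation ?ps
        (\<lambda>\<sigma>. of_bool (Q \<sigma>) * avoid_prob \<rho> \<alpha> S \<sigma> ^ card (V - S)))"
  proof (rule nn_integral_eq_integral)
    show "integrable (measure_pmf ?ps) (\<lambda>\<sigma>. of_bool (Q \<sigma>) * avoid_prob \<rho> \<alpha> S \<sigma> ^ card ?T)"
      by (rule measure_pmf.integrable_const_bound[where B=1])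
         (use bounds in \<open>auto simp: power_le_one\<close>)
  qed (use bounds in auto)
  finally show ?thesis
    using bounds
    by (subst (asm) measure_pmf.emeasure_eq_measure, subst (asm) ennreal_inj)
       (auto intro!: Bochner_Integration.integral_nonneg)
qed

section \<open>Independent key rings; connectedness in terms of cuts\<close>

definition ring_pmf :: "nat pmf \<Rightarrow> (nat \<Rightarrow> nat) \<Rightarrow> nat \<Rightarrow> nat set pmf" where
  "ring_pmf \<mu> K P = bind_pmf \<mu> (\<lambda>i. pmf_of_set {S. S \<subseteq> {1..P} \<and> card S = K i})"

definition ring_edge_graph ::
    "'a set \<Rightarrow> ('a \<Rightarrow> 'k set) \<Rightarrow> ('a set \<Rightarrow> bool) \<Rightarrow> 'a pair_pre_digraph" where
  "ring_edge_graph V \<sigma> B =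
     \<lparr>pverts = V, parcs = {(x, y). x \<in> V \<and> y \<in> V \<and> x \<noteq> y \<and> \<sigma> x \<inter> \<sigma> y \<noteq> {} \<and> B {x, y}}\<rparr>"

text \<open>A class influences the graph only through the ring it produces. Integrating the classes
  out leaves i.i.d. rings with a mixture law.\<close>

lemma inhom_random_key_graph_eq:
  "inhom_random_key_graph n \<mu> K P = map_pmf (key_graph n) (Pi_pmf {1..n} {} (\<lambda>_. ring_pmf \<mu> K P))"
  unfolding inhom_random_key_graph_def ring_pmf_def
  by (subst Pi_pmf_bind[where d' = undefined]) (auto simp: map_pmf_def bind_assoc_pmf)

lemma random_graph_eq:
  "random_graph n \<mu> K P \<alpha> =
     map_pmf (\<lambda>(\<sigma>, B). ring_edge_graph {1..n} \<sigma> B) (joint_pmf {1..n} (ring_pmf \<mu> K P) \<alpha>)"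
  unfolding random_graph_def inhom_random_key_graph_eq erdos_renyi_graph_def joint_pmf_def pairs_in_def
    map_pair[symmetric] pmf.map_comp
  by (rule map_pmf_cong)
     (auto simp: graph_inter_def key_graph_def ring_edge_graph_def)

text \<open>\<open>Digraph_Component.connected\<close> is strong connectedness of the symmetrised
  graph; here symmetrising changes nothing, so it reduces to plain reachability.\<close>

lemma ring_edge_graph_symmetric: "mk_symmetric (with_proj (ring_edge_graph V \<sigma> B)) = ring_edge_graph V \<sigma> B"
  by (auto simp: mk_symmetric_def ring_edge_graph_def Int_commute insert_commute)

lemma wf_ring_edge_graph: "wf_digraph (with_proj (ring_edge_graph V \<sigma> B))"
  by (unfold_locales) (auto simp: ring_edge_graph_def)

lemma ring_edge_graph_arcs:
  "x \<rightarrow>\<^bsub>with_proj (ring_edge_graph V \<sigma> B)\<^esub> y \<longleftrightarrow>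
     x \<in> V \<and> y \<in> V \<and> x \<noteq> y \<and> \<sigma> x \<inter> \<sigma> y \<noteq> {} \<and> B {x, y}"
  by (simp add: ring_edge_graph_def)

lemma no_edges_commute:
  assumes "no_edges \<sigma> B S T" shows "no_edges \<sigma> B T S"
  unfolding no_edges_def
proof (intro ballI impI)
  fix x z assume "x \<in> T" "z \<in> S" "\<sigma> x \<inter> \<sigma> z \<noteq> {}"
  then have "\<not> B {z, x}" using assms by (auto simp: no_edges_def)
  then show "\<not> B {x, z}" by (simp add: insert_commute)
qed

lemma connected_imp_not_isolated:
  assumes "Digraph_Component.connected (with_proj (ring_edge_graph V \<sigma> B))"
    and "x \<in> V" "y \<in> V" "x \<noteq> y"
  shows "\<not> no_edges \<sigma> B {x} (V - {x})"
proof
  let ?G = "with_proj (ring_edge_graph V \<sigma> B)"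
  interpret wf_digraph ?G by (rule wf_ring_edge_graph)
  assume *: "no_edges \<sigma> B {x} (V - {x})"
  have "x \<rightarrow>\<^sup>*\<^bsub>?G\<^esub> y"
    using assms unfolding Digraph_Component.connected_def strongly_connected_def ring_edge_graph_symmetric
    by (auto simp: ring_edge_graph_def)
  then show False
  proof (cases rule: converse_reachable_cases)
    case (step z)
    have "z \<in> V - {x} \<and> \<sigma> x \<inter> \<sigma> z \<noteq> {} \<and> B {x, z}"
      using step(1) unfolding ring_edge_graph_arcs by auto
    then show False using * by (auto simp: no_edges_def)
  qed (use assms in auto)
qed

text \<open>If \<open>u\<close> does not reach \<open>v\<close>, no edge leaves the set reached from
  \<open>u\<close>. That set or its complement has at most half of the nodes, and
  \<open>no_edges\<close> is symmetric.\<close>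

lemma not_connected_imp_no_edges:
  assumes "\<not> Digraph_Component.connected (with_proj (ring_edge_graph V \<sigma> B))" "finite V" "V \<noteq> {}"
  obtains S where "S \<subseteq> V" "S \<noteq> {}" "2 * card S \<le> card V" "no_edges \<sigma> B S (V - S)"
proof -
  let ?G = "with_proj (ring_edge_graph V \<sigma> B)"
  interpret wf_digraph ?G by (rule wf_ring_edge_graph)
  obtain u v where uv: "u \<in> V" "v \<in> V" "\<not> u \<rightarrow>\<^sup>*\<^bsub>?G\<^esub> v"
    using assms unfolding Digraph_Component.connected_def strongly_connected_def ring_edge_graph_symmetric
    by (auto simp: ring_edge_graph_def)
  define S where "S = {w \<in> V. u \<rightarrow>\<^sup>*\<^bsub>?G\<^esub> w}"
  have "verts ?G = V" by (simp add: ring_edge_graph_def)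
  then have u: "u \<in> S" using uv reachable_refl[of u] by (auto simp: S_def)
  have cut: "no_edges \<sigma> B S (V - S)"
    unfolding no_edges_def
  proof (intro ballI impI notI)
    fix x z assume xz: "x \<in> S" "z \<in> V - S" "\<sigma> x \<inter> \<sigma> z \<noteq> {}" "B {x, z}"
    then have "x \<rightarrow>\<^bsub>?G\<^esub> z" unfolding ring_edge_graph_arcs by (auto simp: S_def)
    then have "u \<rightarrow>\<^sup>*\<^bsub>?G\<^esub> z" using xz(1) by (auto simp: S_def intro: reachable_adj_trans)
    then show False using xz by (auto simp: S_def)
  qed
  have S: "S \<subseteq> V" "v \<in> V - S" using uv by (auto simp: S_def)
  have card: "card S + card (V - S) = card V"
    using S assms(2) by (metis card_Diff_subset card_mono finite_subset le_add_diff_inverse)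
  show thesis
  proof (cases "2 * card S \<le> card V")
    case True
    then show thesis using that[of S] S u cut by auto
  next
    case False
    have "V - (V - S) = S" using S by auto
    then show thesis
      using False card S cut that[of "V - S"] no_edges_commute[OF cut] by auto
  qed
qed

section \<open>Estimates\<close>

text \<open>The probability that a uniformly random ring of \<open>k\<close> keys out of
  \<open>P\<close> misses a fixed set of \<open>u\<close> keys.\<close>

definition miss_prob :: "nat \<Rightarrow> nat \<Rightarrow> nat \<Rightarrow> real" where
  "miss_prob P u k = real ((P - u) choose k) / real (P choose k)"

lemma key_prob_eq_miss: "key_prob K P i j = 1 - miss_prob P (K i) (K j)"
  by (simp add: key_prob_def miss_prob_def)

lemma miss_prob_0 [simp]: "k \<le> P \<Longrightarrow> miss_prob P 0 k = 1"
  by (simp add: miss_prob_def)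

lemma choose_pred_mult: "((m - 1) choose k) * m = (m choose k) * (m - k)"
proof (cases m)
  case (Suc n)
  then show ?thesis
    using binomial_absorb_comp[of "Suc n" k] by (simp add: mult.commute)
qed simp

text \<open>The factor is the conditional probability of missing one more key. The bounds in
  \<open>u\<close> below are all read off from these ratios.\<close>

lemma miss_prob_Suc:
  assumes "u < P"
  shows "miss_prob P (Suc u) k = miss_prob P u k * (real (P - u - k) / real (P - u))"
proof -
  have "real ((P - u - 1) choose k) * real (P - u) = real ((P - u) choose k) * real (P - u - k)"
    using choose_pred_mult[of "P - u" k] by (metis of_nat_mult)
  then have "real ((P - Suc u) choose k) = real ((P - u) choose k) * real (P - u - k) / real (P - u)"
    using assms by (simp add: field_simps)
  then show ?thesis by (simp add: miss_prob_def)
qed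

lemma miss_prob_nonneg: "0 \<le> miss_prob P u k"
  by (simp add: miss_prob_def)

lemma miss_prob_le_1: "miss_prob P u k \<le> 1"
  using binomial_right_mono[of "P - u" P k] by (auto simp: miss_prob_def divide_simps)

lemma miss_prob_pos: "u + k \<le> P \<Longrightarrow> 0 < miss_prob P u k"
  by (auto simp: miss_prob_def)

lemma miss_ratio_antimono:
  assumes "u \<le> v" "v < P"
  shows "real (P - v - k) / real (P - v) \<le> real (P - u - k) / real (P - u)"
proof (cases "v + k \<le> P")
  case True
  then show ?thesis using assms
    by (simp add: of_nat_diff field_simps) (simp add: algebra_simps flip: of_nat_mult)
qed (use assms in auto)

lemma miss_prob_add_le:
  assumes "u + v \<le> P"
  shows "miss_prob P (u + v) k \<le> miss_prob P u k * (real (P - u - k) / real (P - u)) ^ v"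
  using assms
proof (induction v)
  case (Suc v)
  have "miss_prob P (u + Suc v) k = miss_prob P (u + v) k * (real (P - (u+v) - k) / real (P - (u+v)))"
    using miss_prob_Suc[of "u + v" P k] Suc.prems by simp
  also have "\<dots> \<le> (miss_prob P u k * (real (P - u - k) / real (P - u)) ^ v) *
      (real (P - u - k) / real (P - u))"
    using Suc.prems
    by (intro mult_mono Suc.IH miss_ratio_antimono mult_nonneg_nonneg miss_prob_nonneg) auto
  finally show ?case by (simp add: mult_ac)
qed simp

lemma miss_prob_le_power:
  assumes "u \<le> P" "k \<le> P"
  shows "miss_prob P u k \<le> (1 - real k / real P) ^ u"
  using miss_prob_add_le[of 0 u P k] assms
  by (cases "P = 0") (auto simp: of_nat_diff diff_divide_distrib)

lemma miss_prob_ge_power: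
  assumes "u \<le> v" "v < P" "k \<le> P"
  shows "miss_prob P u k \<ge> (real (P - v - k) / real (P - v)) ^ u"
  using assms
proof (induction u)
  case (Suc u)
  have "miss_prob P (Suc u) k = miss_prob P u k * (real (P - u - k) / real (P - u))"
    using miss_prob_Suc[of u P k] Suc.prems by simp
  also have "\<dots> \<ge> (real (P - v - k) / real (P - v)) ^ u * (real (P - v - k) / real (P - v))"
    using Suc.prems by (intro mult_mono Suc.IH miss_ratio_antimono miss_prob_nonneg) auto
  finally show ?case by (simp add: mult_ac)
qed simp

text \<open>
  The ratios of consecutive values of \<^const>\<open>miss_prob\<close> decrease, so their geometric means do.
\<close>

lemma miss_prob_power_mono:
  assumes "v \<le> u" "u \<le> P" "k \<le> P"
  shows "miss_prob P u k ^ v \<le> miss_prob P v k ^ u"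
proof (cases "v < P")
  case True
  let ?r = "real (P - v - k) / real (P - v)"
  have "miss_prob P u k ^ v \<le> (miss_prob P v k * ?r ^ (u - v)) ^ v"
    using miss_prob_add_le[of v "u - v" P k] assms by (intro power_mono miss_prob_nonneg) auto
  also have "\<dots> = miss_prob P v k ^ v * (?r ^ v) ^ (u - v)"
    by (simp add: power_mult_distrib mult.commute flip: power_mult)
  also have "\<dots> \<le> miss_prob P v k ^ v * miss_prob P v k ^ (u - v)"
    using True assms
    by (intro mult_left_mono power_mono miss_prob_ge_power zero_le_power miss_prob_nonneg) auto
  also have "\<dots> = miss_prob P v k ^ u"
    using assms by (simp flip: power_add)
  finally show ?thesis .
next
  case False
  then have "u = v" using assms by auto
  then show ?thesis by simp
qed

text \<open>Missing two disjoint sets of \<open>v\<close> keys is at most as likely as under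
  independence. By inclusion-exclusion the same then holds for hitting both, which is how it enters
  the second moment.\<close>

lemma miss_prob_double:
  assumes "2 * v \<le> P" "k \<le> P" "0 < v"
  shows "miss_prob P (2 * v) k \<le> (miss_prob P v k)\<^sup>2"
proof -
  have "miss_prob P (2 * v) k ^ v \<le> ((miss_prob P v k)\<^sup>2) ^ v"
    using miss_prob_power_mono[of v "2 * v" P k] assms by (simp flip: power_mult)
  then show ?thesis using assms(3) by (rule_tac power_le_imp_le_base[of _ "v - 1"]) auto
qed

text \<open>The exponent must be real: a union of i rings is only known to have (1 - \<epsilon>) i K
  keys, so it counts as (1 - \<epsilon>) i rings of v = K keys.\<close>

lemma miss_prob_powr:
  fixes s :: real
  assumes "v \<le> u" "u \<le> P" "v + k \<le> P" "0 < v" "0 \<le> s" "s * v \<le> u"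
  shows "miss_prob P u k \<le> miss_prob P v k powr s"
proof -
  let ?q = "miss_prob P v k"
  have q: "0 < ?q" "?q \<le> 1" using miss_prob_pos miss_prob_le_1 assms by auto
  have "miss_prob P u k ^ v \<le> ?q ^ u"
    using miss_prob_power_mono[of v u P k] assms by auto
  also have "\<dots> = ?q powr real u" using q by (simp add: powr_realpow)
  also have "\<dots> \<le> ?q powr (s * real v)"
    using q assms by (intro powr_mono') auto
  also have "\<dots> = (?q powr s) ^ v"
    using q by (simp add: powr_powr[symmetric] powr_realpow)
  finally show ?thesis using assms(4) by (rule_tac power_le_imp_le_base[of _ "v - 1"]) auto
qed

lemma miss_prob_le_exp:
  assumes "u \<le> P" "k \<le> P" "0 < P"
  shows "miss_prob P u k \<le> exp (- real u * real k / real P)"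
proof -
  have "miss_prob P u k \<le> (1 - real k / real P) ^ u" by (rule miss_prob_le_power) fact+
  also have "\<dots> \<le> exp (- (real k / real P)) ^ u"
    using assms exp_ge_add_one_self[of "- (real k / real P)"]
    by (intro power_mono) (auto simp: divide_simps)
  also have "\<dots> = exp (- real u * real k / real P)"
    by (simp flip: exp_of_nat_mult)
  finally show ?thesis .
qed

lemma miss_prob_ge:
  assumes "u < P" "u + k \<le> P"
  shows "1 - real u * real k / real (P - u) \<le> miss_prob P u k"
proof -
  have "1 - real u * (real k / real (P - u)) \<le> (1 - real k / real (P - u)) ^ u"
    using Bernoulli_inequality[of "- (real k / real (P - u))" u] assms
    by (auto simp: divide_simps)
  also have "1 - real k / real (P - u) = real (P - u - k) / real (P - u)"
    using assms by (simp add: of_nat_diff field_simps)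
  also have "\<dots> ^ u \<le> miss_prob P u k"
    using miss_prob_ge_power[of u u P k] assms by auto
  finally show ?thesis by simp
qed

text \<open>Factor by factor, (w - j) / (P - j) is at most w / P. Cleared of denominators, so that
  the induction also passes through degenerate values.\<close>

lemma choose_ratio_le_power:
  assumes "w \<le> P"
  shows "real (w choose k) * real P ^ k \<le> real (P choose k) * real w ^ k"
proof (induction k)
  case (Suc k)
  have *: "real (Suc k) * real (m choose Suc k) = real (m - k) * real (m choose k)" for m
    using binomial_absorb_comp[of m k] binomial_absorption[of k m] by (metis of_nat_mult)
  have **: "real (w - k) * real P \<le> real (P - k) * real w"
  proof (cases "k \<le> w")
    case True
    then show ?thesis using assms by (simp add: of_nat_diff algebra_simps flip: of_nat_mult)
  qed auto
  have "real (Suc k) * (real (w choose Suc k) * real P ^ Suc k)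
      = (real (w - k) * real P) * (real (w choose k) * real P ^ k)"
    using *[of w] by (simp add: mult_ac)
  also have "\<dots> \<le> (real (P - k) * real w) * (real (P choose k) * real w ^ k)"
    by (intro mult_mono ** Suc.IH) auto
  also have "\<dots> = real (Suc k) * (real (P choose Suc k) * real w ^ Suc k)"
    using *[of P] by (simp add: mult_ac)
  finally show ?case by (simp del: of_nat_Suc power_Suc)
qed simp

lemma miss_prob_antimono_right:
  assumes "k \<le> k'" "k' \<le> P"
  shows "miss_prob P u k' \<le> miss_prob P u k"
  using assms
proof (induction k' rule: dec_induct)
  case (step j)
  have *: "real (m choose Suc j) = real (m - j) * real (m choose j) / real (Suc j)" for m
    using binomial_absorb_comp[of m j] binomial_absorption[of j m]
    by (metis nonzero_mult_div_cancel_left of_nat_Suc of_nat_mult of_nat_neq_0)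
  have "miss_prob P u (Suc j) = miss_prob P u j * (real (P - u - j) / real (P - j))"
    using step by (simp add: miss_prob_def * mult_ac del: of_nat_Suc)
  also have "\<dots> \<le> miss_prob P u j * 1"
    using step by (intro mult_left_mono miss_prob_nonneg) (auto simp: divide_simps)
  finally show ?case using step by simp
qed simp

section \<open>Elementary inequalities\<close>

lemma powr_le_affine:
  fixes q a :: real
  assumes "0 < q" "0 \<le> a" "a \<le> 1"
  shows "q powr a \<le> 1 - a * (1 - q)"
proof -
  \<comment> \<open>Convexity of \<open>q powr a\<close> in the exponent: the chord between 0 and 1
    lies above. This later turns an exponent 1 - \<epsilon> into a factor 1 - \<epsilon> on the edge
    probability.\<close>
  have "exp ((1 - a) *\<^sub>R 0 + a *\<^sub>R ln q) \<le> (1 - a) * exp 0 + a * exp (ln q)"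
    using assms by (intro convex_onD[OF exp_convex]) auto
  then show ?thesis using assms by (simp add: powr_def algebra_simps)
qed

text \<open>The bound (e n / k)^k for the binomial coefficient, multiplied out so that it includes k
  = 0.\<close>

lemma choose_mult_power_le:
  "real (n choose k) * real k ^ k \<le> (exp 1 * real n) ^ k"
proof -
  have "real k ^ k / fact k \<le> exp (real k)"
    using sum_le_suminf[OF summable_exp[of "real k"], of "{k}"]
    by (simp add: exp_def scaleR_conv_of_real divide_inverse mult.commute)
  then have "real (n choose k) * real k ^ k \<le> real (n choose k) * (exp (real k) * fact k)"
    by (intro mult_left_mono) (auto simp: field_simps)
  also have "\<dots> = exp (real k) * real ((n choose k) * fact k)" by simp
  also have "\<dots> \<le> exp (real k) * real (n ^ k)"
    by (intro mult_left_mono of_nat_mono binomial_fact_pow) auto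
  also have "\<dots> = (exp 1 * real n) ^ k"
    by (simp add: power_mult_distrib flip: exp_of_nat_mult)
  finally show ?thesis .
qed

text \<open>
  As \<open>1 - \<theta> = (1 - p) (1 - 1 / M)\<close>, the bound agrees with the left-hand side for \<open>s \<le> 1\<close>. It is
  a combination of exponentials in \<open>s\<close>, so its mean over a random subset is explicit.
\<close>

lemma power_min_le:
  fixes p :: real and M s :: nat
  assumes p: "0 \<le> p" "p < 1" and M: "M \<ge> 1"
  defines "\<theta> \<equiv> p + (1 - p) / real M"
  shows "(1 - p) ^ min s M \<le> 1 - p / \<theta> * (1 - (1 - \<theta>) ^ s)"
proof -
  have \<theta>: "0 < \<theta>" "\<theta> \<le> 1" "p \<le> \<theta>"
    using p M divide_left_mono[of 1 "real M" "1 - p"]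
    by (auto simp: \<theta>_def add_nonneg_pos)
  have low: "(1 - p) ^ s \<le> 1 - p / \<theta> * (1 - (1 - \<theta>) ^ s)" for s
  proof (induction s)
    case (Suc s)
    have "(1 - p) ^ Suc s = (1 - p) ^ s - p * (1 - p) ^ s" by (simp add: algebra_simps)
    also have "\<dots> \<le> 1 - p / \<theta> * (1 - (1 - \<theta>) ^ s) - p * (1 - \<theta>) ^ s"
      using p \<theta> by (intro diff_mono Suc.IH mult_left_mono power_mono) auto
    also have "\<dots> = 1 - p / \<theta> * (1 - (1 - \<theta>) ^ Suc s)"
      using \<theta> by (simp add: field_simps)
    finally show ?case .
  qed simp
  show ?thesis
  proof (cases "s \<le> M")
    case False
    \<comment> \<open>This is where the form of \<theta> comes from: the limit 1 - p / \<theta> of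
      the right-hand side for large s is exactly Bernoulli's bound for (1 - p)^M.\<close>
    have "1 + real M * (p / (1 - p)) \<le> (1 + p / (1 - p)) ^ M"
      using p by (intro Bernoulli_inequality) (auto simp: divide_simps)
    also have "1 + p / (1 - p) = inverse (1 - p)" using p by (simp add: field_simps)
    finally have "inverse (inverse (1 - p) ^ M) \<le> inverse (1 + real M * (p / (1 - p)))"
      using p by (intro le_imp_inverse_le) (auto intro!: add_pos_nonneg)
    then have "(1 - p) ^ M \<le> inverse (1 + real M * (p / (1 - p)))"
      by (simp add: power_inverse)
    also have "\<dots> = 1 - p / \<theta>"
      using p M \<theta> by (simp add: \<theta>_def field_simps)
    also have "\<dots> \<le> 1 - p / \<theta> * (1 - (1 - \<theta>) ^ s)"
      using p \<theta> by (simp add: field_simps)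
    finally show ?thesis using False by (simp add: min_def)
  qed (use low in simp)
qed

text \<open>The generating function of the size of a random subset of \<open>S\<close> that contains
  each element independently with probability \<alpha>.\<close>

lemma sum_weights_Pow:
  fixes \<alpha> y :: real
  assumes "finite S"
  shows "(\<Sum>R\<in>Pow S. \<alpha> ^ card R * (1 - \<alpha>) ^ card (S - R) * y ^ card R) = (1 - \<alpha> * (1 - y)) ^ card S"
proof -
  have "(\<Prod>x\<in>S. \<alpha> * y + (1 - \<alpha>)) = (\<Sum>R\<in>Pow S. (\<Prod>x\<in>R. \<alpha> * y) * (\<Prod>x\<in>S-R. 1 - \<alpha>))"
    by (rule prod_add) fact
  then show ?thesis by (simp add: power_mult_distrib algebra_simps)
qed

text \<open>A second-order Bonferroni bound. The induction step has x^2 / 2 to spare, because l (l -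
  1) has been weakened to l^2.\<close>

lemma one_minus_power_ge:
  fixes x :: real assumes "0 \<le> x" "x \<le> 1"
  shows "real l * x - (real l * x)\<^sup>2 / 2 \<le> 1 - (1 - x) ^ l"
proof (induction l)
  case (Suc l)
  have "1 - (1 - x) ^ Suc l = 1 - (1 - x) ^ l + x * (1 - x) ^ l" by (simp add: algebra_simps)
  also have "\<dots> \<ge> real l * x - (real l * x)\<^sup>2 / 2 + x * (1 - real l * x)"
    using Bernoulli_inequality[of "-x" l] assms by (intro add_mono Suc.IH mult_left_mono) auto
  also have "real l * x - (real l * x)\<^sup>2 / 2 + x * (1 - real l * x)
     = real (Suc l) * x - (real (Suc l) * x)\<^sup>2 / 2 + x\<^sup>2 / 2"
    by (simp add: field_simps power2_eq_square)
  finally show ?case by (smt (verit) zero_le_power2 divide_nonneg_nonneg)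
qed simp

lemma sum_power_le_double:
  fixes \<eta> :: real
  assumes \<eta>0: "0 \<le> \<eta>" and \<eta>: "\<eta> \<le> 1 / 2"
  shows "(\<Sum>i=1..n. \<eta> ^ i) \<le> 2 * \<eta>"
proof (induction n)
  case (Suc k)
  have "(\<Sum>i=1..Suc k. \<eta> ^ i) = (\<Sum>i<Suc k. \<eta> ^ Suc i)"
    unfolding One_nat_def by (rule sum.atLeast1_atMost_eq)
  also have "\<dots> = \<eta> ^ Suc 0 + (\<Sum>i<k. \<eta> ^ Suc (Suc i))" by (rule sum.lessThan_Suc_shift)
  also have "(\<Sum>i<k. \<eta> ^ Suc (Suc i)) = \<eta> * (\<Sum>i<k. \<eta> ^ Suc i)" by (simp add: sum_distrib_left)
  also have "(\<Sum>i<k. \<eta> ^ Suc i) = (\<Sum>i=1..k. \<eta> ^ i)"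
    unfolding One_nat_def by (rule sum.atLeast1_atMost_eq[symmetric])
  also have "\<eta> ^ Suc 0 + \<eta> * (\<Sum>i=1..k. \<eta> ^ i) \<le> \<eta> + \<eta> * (2 * \<eta>)"
    using \<eta>0 Suc by (simp add: mult_left_mono)
  also have "\<dots> \<le> \<eta> + \<eta> * 1" using \<eta>0 \<eta> by (intro add_left_mono mult_left_mono) auto
  finally show ?case by simp
qed (use \<eta>0 in auto)

text \<open>One term of the expansion of (1 + x)^n. A small x exploits that l is small against n,
  while x = 1 bounds all binomial coefficients alike.\<close>

lemma choose_le_exp:
  fixes x :: real
  assumes "0 < x"
  shows "real (n choose l) \<le> exp (x * real n - real l * ln x)"
proof (cases "l \<le> n")
  case True
  define g where "g k = real (n choose k) * x ^ k * 1 ^ (n - k)" for k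
  have "real (n choose l) * x ^ l = g l" by (simp add: g_def)
  also have "g l \<le> sum g {..n}"
    using assms True by (intro member_le_sum) (auto simp: g_def)
  also have "sum g {..n} = (\<Sum>k\<le>n. real (n choose k) * x ^ k * 1 ^ (n - k))" by (simp add: g_def)
  also have "\<dots> = (x + 1) ^ n" by (rule binomial_ring[symmetric])
  also have "\<dots> \<le> exp x ^ n"
    using assms exp_ge_add_one_self[of x] by (intro power_mono) (auto simp: add.commute)
  finally have "real (n choose l) * x ^ l \<le> exp (x * real n)"
    by (simp add: mult.commute flip: exp_of_nat_mult)
  moreover have "x ^ l = exp (real l * ln x)" using assms by (simp add: exp_of_nat_mult)
  ultimately show ?thesis by (simp add: exp_diff field_simps)
qed (simp add: binomial_eq_0)

section \<open>Expectations and the second moment\<close>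

lemma expectation_pair_pmf_finite:
  fixes f :: "'a \<times> 'b \<Rightarrow> real"
  assumes "finite (set_pmf A)" "finite (set_pmf B)"
  shows "measure_pmf.expectation (pair_pmf A B) f
     = measure_pmf.expectation A (\<lambda>a. measure_pmf.expectation B (\<lambda>b. f (a, b)))"
proof -
  have "measure_pmf.expectation (pair_pmf A B) f
      = (\<Sum>(a, b)\<in>set_pmf A \<times> set_pmf B. (pmf A a * pmf B b) * f (a, b))"
    using assms by (subst integral_measure_pmf[of "set_pmf A \<times> set_pmf B"]) (auto simp: pmf_pair intro!: sum.cong)
  also have "\<dots> = (\<Sum>a\<in>set_pmf A. pmf A a * (\<Sum>b\<in>set_pmf B. pmf B b * f (a, b)))"
    by (simp add: sum.cartesian_product[symmetric] sum_distrib_left mult_ac)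
  also have "\<dots> = (\<Sum>a\<in>set_pmf A. pmf A a * measure_pmf.expectation B (\<lambda>b. f (a, b)))"
    using assms by (subst integral_measure_pmf[of "set_pmf B"]) auto
  also have "\<dots> = measure_pmf.expectation A (\<lambda>a. measure_pmf.expectation B (\<lambda>b. f (a, b)))"
    using assms by (subst integral_measure_pmf[of "set_pmf A" A]) auto
  finally show ?thesis .
qed

text \<open>Chebyshev's inequality for the number \<open>N\<close> of events that occur: where
  \<open>N\<close> vanishes, (N / s - 1)^2 equals 1.\<close>

lemma second_moment_bound:
  fixes E :: "'a \<Rightarrow> 'b set"
  assumes "finite V" and s: "s = (\<Sum>x\<in>V. measure_pmf.prob J (E x))" "0 < s"
  shows "measure_pmf.prob J {\<omega>. \<forall>x\<in>V. \<omega> \<notin> E x}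
    \<le> (\<Sum>x\<in>V. \<Sum>y\<in>V. measure_pmf.prob J (E x \<inter> E y)) / s\<^sup>2 - 1"
proof -
  define N where "N \<omega> = (\<Sum>x\<in>V. indicator (E x) \<omega> :: real)" for \<omega>
  have N2: "(N \<omega>)\<^sup>2 = (\<Sum>x\<in>V. \<Sum>y\<in>V. indicator (E x \<inter> E y) \<omega>)" for \<omega>
    by (simp add: N_def power2_eq_square sum_product indicator_inter_arith)
  have ind: "integrable (measure_pmf J) (indicator X :: _ \<Rightarrow> real)" for X
    by (rule measure_pmf.integrable_const_bound[where B=1]) (auto simp: indicator_def)
  have int: "integrable (measure_pmf J) N" "integrable (measure_pmf J) (\<lambda>\<omega>. (N \<omega>)\<^sup>2)"
    unfolding N2 unfolding N_def by (auto intro!: Bochner_Integration.integrable_sum ind)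
  have EN: "measure_pmf.expectation J N = s"
    unfolding N_def s by (subst Bochner_Integration.integral_sum) (auto simp: ind)
  have EN2: "measure_pmf.expectation J (\<lambda>\<omega>. (N \<omega>)\<^sup>2)
      = (\<Sum>x\<in>V. \<Sum>y\<in>V. measure_pmf.prob J (E x \<inter> E y))"
    unfolding N2
    by (subst Bochner_Integration.integral_sum) (auto simp: Bochner_Integration.integral_sum ind)
  have "measure_pmf.prob J {\<omega>. \<forall>x\<in>V. \<omega> \<notin> E x}
      = measure_pmf.expectation J (indicator {\<omega>. \<forall>x\<in>V. \<omega> \<notin> E x})" by simp
  also have "\<dots> \<le> measure_pmf.expectation J (\<lambda>\<omega>. (N \<omega>)\<^sup>2 / s\<^sup>2 - 2 * N \<omega> / s + 1)"
  proof (rule integral_mono)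
    fix \<omega>
    have "N \<omega> = 0" if "\<forall>x\<in>V. \<omega> \<notin> E x" using that by (simp add: N_def)
    moreover have "(N \<omega>)\<^sup>2 / s\<^sup>2 - 2 * N \<omega> / s + 1 = (N \<omega> / s - 1)\<^sup>2"
      by (simp add: power2_diff power_divide)
    ultimately show "indicator {\<omega>. \<forall>x\<in>V. \<omega> \<notin> E x} \<omega> \<le> (N \<omega>)\<^sup>2 / s\<^sup>2 - 2 * N \<omega> / s + 1"
      by (auto simp: indicator_def)
  qed (use int ind in auto)
  also have "\<dots> = measure_pmf.expectation J (\<lambda>\<omega>. (N \<omega>)\<^sup>2) / s\<^sup>2 - 2 * measure_pmf.expectation J N / s + 1"
    using int by simp
  also have "\<dots> = (\<Sum>x\<in>V. \<Sum>y\<in>V. measure_pmf.prob J (E x \<inter> E y)) / s\<^sup>2 - 1"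
    using s(2) unfolding EN EN2 by simp
  finally show ?thesis .
qed

text \<open>Here \<open>B\<close> is the probability that a third node avoids both of two given
  nodes, and \<open>x\<close> its excess over the independent value q^2. There are n - 2 such nodes
  but 2 (n - 1) factors q in the squared mean, whence the spare 1 / q^2.\<close>

lemma power_quotient_le_exp:
  fixes q x B y :: real
  assumes "0 < q" "0 \<le> B" "B \<le> q\<^sup>2 + x" "0 \<le> x" "2 \<le> n" "real n * x / q\<^sup>2 \<le> y"
  shows "B ^ (n - 2) / q ^ (2 * (n - 1)) \<le> exp y / q\<^sup>2"
proof -
  have "q\<^sup>2 + x = q\<^sup>2 * (1 + x / q\<^sup>2)" using assms by (simp add: field_simps)
  also have "\<dots> \<le> q\<^sup>2 * exp (x / q\<^sup>2)" by (intro mult_left_mono exp_ge_add_one_self) auto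
  finally have "B \<le> q\<^sup>2 * exp (x / q\<^sup>2)" using assms by linarith
  then have "B ^ (n - 2) \<le> (q\<^sup>2 * exp (x / q\<^sup>2)) ^ (n - 2)" using assms by (intro power_mono)
  also have "\<dots> = q ^ (2 * (n - 2)) * exp (real (n - 2) * (x / q\<^sup>2))"
    by (simp add: power_mult_distrib power_mult flip: exp_of_nat_mult)
  also have "\<dots> \<le> q ^ (2 * (n - 2)) * exp y"
  proof -
    have "real (n - 2) * (x / q\<^sup>2) \<le> real n * (x / q\<^sup>2)" using assms by (intro mult_right_mono) auto
    then show ?thesis using assms by (intro mult_left_mono) auto
  qed
  finally have "B ^ (n - 2) / q ^ (2 * (n - 1)) \<le> q ^ (2 * (n - 2)) * exp y / q ^ (2 * (n - 1))"
    using assms by (intro divide_right_mono) auto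
  also have "\<dots> = exp y / q\<^sup>2"
  proof -
    have "2 * (n - 1) = 2 * (n - 2) + 2" using assms by simp
    then have "q ^ (2 * (n - 1)) = q ^ (2 * (n - 2)) * q\<^sup>2" by (simp only: power_add)
    then show ?thesis using assms by simp
  qed
  finally show ?thesis .
qed

text \<open>The factor (1 - \<Lambda>)^2 in the hypothesis on n \<Lambda> absorbs the divisions by q
  = 1 - \<Lambda> and by q^2, so that the exponents are stated with \<open>c\<close> itself.\<close>

lemma isolated_moment_estimate:
  fixes \<Lambda> p \<alpha> m c :: real
  assumes n: "2 \<le> n" and \<Lambda>: "0 < \<Lambda>" "\<Lambda> \<le> 1 / 2" "real n * \<Lambda> \<le> c * (1 - \<Lambda>)\<^sup>2 * ln (real n)"
    and m: "0 < m" "m \<le> 1" and p: "0 \<le> p" "p \<le> 1" and \<alpha>: "0 < \<alpha>" "\<alpha> < 1" and pm: "m * (\<alpha> * p) \<le> \<Lambda>"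
    and c: "0 < c"
  shows "1 / (real n * m * (1 - \<Lambda>) ^ (n - 1))
      + ((1 - p) * (1 - 2 * \<Lambda> + \<Lambda>\<^sup>2 / m) ^ (n - 2) + p * (1 - 2 * \<Lambda> + \<alpha> * \<Lambda>) ^ (n - 2))
        / (1 - \<Lambda>) ^ (2 * (n - 1)) - 1
    \<le> real n powr (c - 1) / m
      + (exp ((c * ln (real n))\<^sup>2 / (m * real n)) + c\<^sup>2 * (ln (real n))\<^sup>2 * real n powr (c - 1) / m) / (1 - \<Lambda>)\<^sup>2 - 1"
proof -
  define q where "q = 1 - \<Lambda>"
  define L where "L = ln (real n)"
  have q: "0 < q" "q \<le> 1" using \<Lambda> by (auto simp: q_def)
  have q2: "q\<^sup>2 \<le> 1" using q by (simp add: power_le_one)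
  have L: "0 < L" using n by (simp add: L_def)
  have nL: "real n * \<Lambda> \<le> c * q\<^sup>2 * L" using \<Lambda> by (simp add: q_def L_def)
  also have "\<dots> \<le> c * 1 * L" using q2 c L by (intro mult_right_mono mult_left_mono) auto
  finally have nL1: "real n * \<Lambda> \<le> c * L" by simp
  have npow: "real n powr c = exp (c * L)" using n by (simp add: powr_def L_def)
  have np1: "real n powr (c - 1) = exp (c * L) / real n" using n by (simp add: powr_diff npow)
  have 1: "1 / (real n * m * q ^ (n - 1)) \<le> real n powr (c - 1) / m"
  proof -
    have "1 / q = 1 + \<Lambda> / q" using q by (simp add: q_def field_simps)
    also have "\<dots> \<le> exp (\<Lambda> / q)" by (rule exp_ge_add_one_self)
    finally have e: "1 / q \<le> exp (\<Lambda> / q)" .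
    have "(1 / q) ^ (n - 1) \<le> exp (\<Lambda> / q) ^ (n - 1)" using e q by (intro power_mono) auto
    also have "\<dots> = exp (real (n - 1) * (\<Lambda> / q))" by (simp flip: exp_of_nat_mult)
    also have "\<dots> \<le> exp (c * L)"
    proof -
      have "real (n - 1) * (\<Lambda> / q) \<le> real n * (\<Lambda> / q)" using \<Lambda> q by (intro mult_right_mono) auto
      also have "\<dots> \<le> c * q\<^sup>2 * L / q" using nL q by (simp add: divide_right_mono)
      also have "\<dots> = c * L * q" using q by (simp add: power2_eq_square)
      also have "\<dots> \<le> c * L * 1" using q c L by (intro mult_left_mono) auto
      finally show ?thesis by simp
    qed
    finally have "1 / q ^ (n - 1) \<le> exp (c * L)" by (simp add: power_one_over)
    then have "1 / (real n * m) * (1 / q ^ (n - 1)) \<le> 1 / (real n * m) * exp (c * L)"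
      using m by (intro mult_left_mono) auto
    then show ?thesis by (simp add: np1)
  qed
  \<comment> \<open>Disjoint rings: the excess \<Lambda>^2 / m is of second order.\<close>
  have 2: "(1 - 2 * \<Lambda> + \<Lambda>\<^sup>2 / m) ^ (n - 2) / q ^ (2 * (n - 1)) \<le> exp ((c * L)\<^sup>2 / (m * real n)) / q\<^sup>2"
  proof (rule power_quotient_le_exp)
    show "1 - 2 * \<Lambda> + \<Lambda>\<^sup>2 / m \<le> q\<^sup>2 + \<Lambda>\<^sup>2 / m" by (simp add: q_def power2_diff)
    show "0 \<le> 1 - 2 * \<Lambda> + \<Lambda>\<^sup>2 / m" using \<Lambda> m by (intro add_nonneg_nonneg) auto
    have "(real n * \<Lambda>)\<^sup>2 \<le> (c * q\<^sup>2 * L)\<^sup>2" using nL \<Lambda> by (intro power_mono) auto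
    then have "(real n * \<Lambda>)\<^sup>2 / (real n * m * q\<^sup>2) \<le> (c * q\<^sup>2 * L)\<^sup>2 / (real n * m * q\<^sup>2)"
      using m by (intro divide_right_mono) auto
    also have "\<dots> = (c * L)\<^sup>2 / (m * real n) * q\<^sup>2"
      using q n by (simp add: power2_eq_square mult_ac)
    also have "\<dots> \<le> (c * L)\<^sup>2 / (m * real n) * 1" using q2 m by (intro mult_left_mono) auto
    finally show "real n * (\<Lambda>\<^sup>2 / m) / q\<^sup>2 \<le> (c * L)\<^sup>2 / (m * real n)"
      using n by (simp add: power2_eq_square mult_ac)
  qed (use q m n in auto)
  \<comment> \<open>Meeting rings: the excess \<alpha> \<Lambda> is of first order and costs a power
    of n.\<close>
  have 3: "(1 - 2 * \<Lambda> + \<alpha> * \<Lambda>) ^ (n - 2) / q ^ (2 * (n - 1)) \<le> exp (\<alpha> * (c * L)) / q\<^sup>2"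
  proof (rule power_quotient_le_exp)
    show "1 - 2 * \<Lambda> + \<alpha> * \<Lambda> \<le> q\<^sup>2 + \<alpha> * \<Lambda>" by (simp add: q_def power2_diff)
    show "0 \<le> 1 - 2 * \<Lambda> + \<alpha> * \<Lambda>" using \<Lambda> \<alpha> by (intro add_nonneg_nonneg) auto
    have "\<alpha> * (real n * \<Lambda>) / q\<^sup>2 \<le> \<alpha> * (c * q\<^sup>2 * L) / q\<^sup>2"
      using nL \<alpha> by (intro divide_right_mono mult_left_mono) auto
    then show "real n * (\<alpha> * \<Lambda>) / q\<^sup>2 \<le> \<alpha> * (c * L)" using q by (simp add: mult_ac)
  qed (use q \<alpha> \<Lambda> n in auto)
  let ?U = "exp ((c * L)\<^sup>2 / (m * real n))" and ?E = "exp (\<alpha> * (c * L))"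
  have U1: "1 \<le> ?U" using m by simp
  \<comment> \<open>Only the product \<alpha> p is small, p alone need not be. The estimate e^y - 1
    \<le> y e^y supplies the factor \<alpha>, after which \<alpha> p \<le> \<Lambda> / m
    applies.\<close>
  have pE: "p * (?E - 1) \<le> c\<^sup>2 * L\<^sup>2 * real n powr (c - 1) / m"
  proof -
    let ?y = "\<alpha> * (c * L)"
    have y: "0 \<le> ?y" using \<alpha> c L by simp
    have "(1 - ?y) * ?E \<le> exp (- ?y) * ?E"
      using exp_ge_add_one_self[of "- ?y"] by (intro mult_right_mono) auto
    then have "?E - 1 \<le> ?y * ?E" by (simp add: algebra_simps flip: exp_add)
    then have "p * (?E - 1) \<le> p * (?y * ?E)" using p by (intro mult_left_mono)
    also have "\<dots> = (\<alpha> * p) * (c * L) * ?E" by simp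
    also have "\<dots> \<le> (c * L / (real n * m)) * (c * L) * exp (c * L)"
    proof (intro mult_mono)
      have "m * (\<alpha> * p) * real n \<le> \<Lambda> * real n" using pm by (intro mult_right_mono) auto
      also have "\<dots> \<le> c * L" using nL1 by (simp add: mult.commute)
      finally show "\<alpha> * p \<le> c * L / (real n * m)" using m n by (simp add: field_simps)
      show "?E \<le> exp (c * L)" using \<alpha> c L by (simp add: mult_left_le_one_le)
    qed (use \<alpha> p c L m in auto)
    also have "\<dots> = c\<^sup>2 * L\<^sup>2 * real n powr (c - 1) / m"
      by (simp add: np1 power2_eq_square)
    finally show ?thesis .
  qed
  have "((1 - p) * (1 - 2 * \<Lambda> + \<Lambda>\<^sup>2 / m) ^ (n - 2) + p * (1 - 2 * \<Lambda> + \<alpha> * \<Lambda>) ^ (n - 2)) / q ^ (2 * (n - 1))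
      = (1 - p) * ((1 - 2 * \<Lambda> + \<Lambda>\<^sup>2 / m) ^ (n - 2) / q ^ (2 * (n - 1)))
        + p * ((1 - 2 * \<Lambda> + \<alpha> * \<Lambda>) ^ (n - 2) / q ^ (2 * (n - 1)))"
    by (simp add: add_divide_distrib)
  also have "\<dots> \<le> (1 - p) * (?U / q\<^sup>2) + p * (?E / q\<^sup>2)"
    using p by (intro add_mono mult_left_mono 2 3) auto
  also have "\<dots> = ((1 - p) * ?U + p * ?E) / q\<^sup>2" by (simp add: add_divide_distrib)
  also have "\<dots> \<le> (?U + c\<^sup>2 * L\<^sup>2 * real n powr (c - 1) / m) / q\<^sup>2"
  proof (intro divide_right_mono)
    have "(1 - p) * ?U + p * ?E = ?U + p * (?E - 1) - p * (?U - 1)" by (simp add: algebra_simps)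
    also have "\<dots> \<le> ?U + p * (?E - 1)" using p U1 by simp
    finally show "(1 - p) * ?U + p * ?E \<le> ?U + c\<^sup>2 * L\<^sup>2 * real n powr (c - 1) / m" using pE by linarith
  qed auto
  finally show ?thesis using 1 by (simp add: q_def L_def)
qed

section \<open>Random key rings\<close>

locale key_rings =
  fixes r :: nat and \<mu> :: "nat pmf" and K :: "nat \<Rightarrow> nat" and P :: nat
  assumes r: "1 \<le> r" and \<mu>: "set_pmf \<mu> = {1..r}"
    and K1: "1 \<le> K 1" and K_mono: "mono_on {1..r} K" and K_le: "2 * K r \<le> P"
begin

abbreviation "\<rho> \<equiv> ring_pmf \<mu> K P"
abbreviation "rings k \<equiv> {S. S \<subseteq> {1..P} \<and> card S = k}"

lemma K_bounds:
  assumes "j \<in> {1..r}" shows "K 1 \<le> K j" "2 * K j \<le> P" "1 \<le> K j" "K j \<le> P" "0 < P"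
proof -
  show "K 1 \<le> K j" using K_mono assms r by (auto simp: mono_on_def)
  then show "1 \<le> K j" using K1 by simp
  have "K j \<le> K r" using K_mono assms r by (auto simp: mono_on_def)
  then show "2 * K j \<le> P" "K j \<le> P" using K_le by auto
  then show "0 < P" using \<open>1 \<le> K j\<close> by simp
qed

lemma rings: "finite (rings k)" "card (rings k) = P choose k" "k \<le> P \<Longrightarrow> rings k \<noteq> {}"
proof -
  show f: "finite (rings k)" by (rule finite_subset[of _ "Pow {1..P}"]) auto
  show c: "card (rings k) = P choose k" using n_subsets[of "{1..P}" k] by simp
  show "rings k \<noteq> {}" if "k \<le> P"
    using c that by (metis card.empty less_irrefl zero_less_binomial_iff)
qed

lemma set_ring_pmf: "set_pmf \<rho> = (\<Union>j\<in>{1..r}. rings (K j))"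
proof -
  have "set_pmf (pmf_of_set (rings (K j))) = rings (K j)" if "j \<in> {1..r}" for j
    using rings K_bounds(4)[OF that] by (intro set_pmf_of_set) auto
  then show ?thesis by (simp add: ring_pmf_def \<mu>)
qed

lemma ring_pmf_support:
  assumes "Z \<in> set_pmf \<rho>" shows "Z \<subseteq> {1..P}" "K 1 \<le> card Z" "finite Z"
  using assms K_bounds(1) by (auto simp: set_ring_pmf intro: finite_subset)

lemma finite_set_ring_pmf: "finite (set_pmf \<rho>)"
  unfolding set_ring_pmf using rings by auto

lemma expectation_ring_pmf:
  fixes f :: "nat set \<Rightarrow> real"
  shows "measure_pmf.expectation \<rho> f
       = (\<Sum>j=1..r. pmf \<mu> j * measure_pmf.expectation (pmf_of_set (rings (K j))) f)"
proof -
  have "finite (set_pmf (pmf_of_set (rings (K j))))" if "j \<in> {1..r}" for j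
    using rings K_bounds(4)[OF that] by (subst set_pmf_of_set) auto
  then show ?thesis
    unfolding ring_pmf_def using \<mu> by (subst pmf_expectation_bind[of "{1..r}"]) auto
qed

lemma prob_ring_pmf:
  "measure_pmf.prob \<rho> A = (\<Sum>j=1..r. pmf \<mu> j * measure_pmf.prob (pmf_of_set (rings (K j))) A)"
  using expectation_ring_pmf[of "indicator A"] by simp

lemma sum_pmf: "(\<Sum>j=1..r. pmf \<mu> j) = 1"
  using sum_pmf_eq_1[of "{1..r}" \<mu>] \<mu> by simp

lemma prob_rings_avoid:
  assumes "A \<subseteq> {1..P}" "k \<le> P"
  shows "measure_pmf.prob (pmf_of_set (rings k)) {Z. A \<inter> Z = {}} = miss_prob P (card A) k"
proof -
  have "rings k \<inter> {Z. A \<inter> Z = {}} = {Z. Z \<subseteq> {1..P} - A \<and> card Z = k}" by auto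
  moreover have "card {Z. Z \<subseteq> {1..P} - A \<and> card Z = k} = (P - card A) choose k"
    using assms by (subst n_subsets) (auto simp: card_Diff_subset finite_subset)
  ultimately show ?thesis
    using rings assms by (subst measure_pmf_of_set) (auto simp: miss_prob_def)
qed

lemma prob_rings_subset:
  assumes "W \<subseteq> {1..P}" "k \<le> P"
  shows "measure_pmf.prob (pmf_of_set (rings k)) {Z. Z \<subseteq> W} \<le> (real (card W) / real P) ^ k"
proof (cases "P = 0")
  case False
  have "rings k \<inter> {Z. Z \<subseteq> W} = {Z. Z \<subseteq> W \<and> card Z = k}" using assms by auto
  moreover have "card {Z. Z \<subseteq> W \<and> card Z = k} = card W choose k"
    using assms by (subst n_subsets) (auto simp: finite_subset)
  ultimately have "measure_pmf.prob (pmf_of_set (rings k)) {Z. Z \<subseteq> W}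
      = real (card W choose k) / real (P choose k)"
    using rings assms by (subst measure_pmf_of_set) auto
  also have "\<dots> \<le> (real (card W) / real P) ^ k"
    using choose_ratio_le_power[of "card W" P k] assms False card_mono[OF _ assms(1)]
    by (simp add: power_divide divide_simps mult.commute)
  finally show ?thesis .
qed (use assms in auto)

lemma prob_ring_avoid:
  assumes "A \<subseteq> {1..P}"
  shows "measure_pmf.prob \<rho> {Z. A \<inter> Z = {}} = (\<Sum>j=1..r. pmf \<mu> j * miss_prob P (card A) (K j))"
  unfolding prob_ring_pmf
  by (intro sum.cong refl arg_cong2[of _ _ _ _ "(*)"] prob_rings_avoid assms K_bounds(4))

text \<open>Every class has rings of at least \<open>K 1\<close> keys, and larger rings are less
  likely to fit into \<open>W\<close>.\<close>

lemma prob_ring_subset: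
  assumes "W \<subseteq> {1..P}"
  shows "measure_pmf.prob \<rho> {Z. Z \<subseteq> W} \<le> (real (card W) / real P) ^ K 1"
proof -
  have W: "real (card W) / real P \<le> 1" using card_mono[OF _ assms] by (auto simp: divide_simps)
  have "measure_pmf.prob \<rho> {Z. Z \<subseteq> W}
      \<le> (\<Sum>j=1..r. pmf \<mu> j * (real (card W) / real P) ^ K 1)"
    unfolding prob_ring_pmf
  proof (intro sum_mono mult_left_mono)
    fix j assume j: "j \<in> {1..r}"
    have "measure_pmf.prob (pmf_of_set (rings (K j))) {Z. Z \<subseteq> W} \<le> (real (card W) / real P) ^ K j"
      using assms K_bounds(4)[OF j] by (rule prob_rings_subset)
    also have "\<dots> \<le> (real (card W) / real P) ^ K 1"
      using W K_bounds(1)[OF j] by (intro power_decreasing) auto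
    finally show "measure_pmf.prob (pmf_of_set (rings (K j))) {Z. Z \<subseteq> W} \<le> (real (card W) / real P) ^ K 1" .
  qed auto
  also have "\<dots> = (real (card W) / real P) ^ K 1"
    by (simp only: sum_distrib_right[symmetric] sum_pmf mult_1)
  finally show ?thesis .
qed

section \<open>Expansion of the key rings\<close>

text \<open>The cap by \<kappa> P is essential: many rings together may exhaust the key pool. Only
  the rings of \<open>S\<close> occur, so the property can be imposed before the outside nodes are
  exposed, and it passes to subsets of \<open>S\<close>.\<close>

definition expanding :: "real \<Rightarrow> real \<Rightarrow> 'a set \<Rightarrow> ('a \<Rightarrow> nat set) \<Rightarrow> bool" where
  "expanding \<epsilon> \<kappa> S \<sigma> \<longleftrightarrow> (\<forall>R\<subseteq>S. R \<noteq> {} \<longrightarrow> real (card R * K 1) \<le> \<kappa> * real P \<longrightarrow>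
     (1 - \<epsilon>) * real (card R * K 1) \<le> real (card (\<Union>x\<in>R. \<sigma> x)))"

lemma P_pos: "0 < P" using K_bounds(5)[of 1] r by simp

text \<open>A union of at most \<open>u\<close> keys fits into a set \<open>W\<close> of exactly
  \<open>u\<close> keys; sum over \<open>W\<close> and use that the rings are independent.\<close>

lemma prob_small_union:
  assumes "finite V" "R \<subseteq> V" "u \<le> P"
  shows "measure_pmf.prob (Pi_pmf V {} (\<lambda>_. \<rho>)) {\<sigma>. card (\<Union>x\<in>R. \<sigma> x) \<le> u}
     \<le> real (P choose u) * (real u / real P) ^ (K 1 * card R)"
proof -
  let ?M = "Pi_pmf V {} (\<lambda>_. \<rho>)"
  let ?E = "\<lambda>W. Pi V (\<lambda>x. if x \<in> R then {Z. Z \<subseteq> W} else UNIV)"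
  have fin: "finite R" using assms finite_subset by auto
  have "{\<sigma>. card (\<Union>x\<in>R. \<sigma> x) \<le> u} \<inter> set_pmf ?M \<subseteq> (\<Union>W\<in>rings u. ?E W)"
  proof
    fix \<sigma> assume \<sigma>: "\<sigma> \<in> {\<sigma>. card (\<Union>x\<in>R. \<sigma> x) \<le> u} \<inter> set_pmf ?M"
    then have "\<sigma> x \<in> set_pmf \<rho>" if "x \<in> R" for x
      using set_Pi_pmf_subset'[OF assms(1), of "{}" "\<lambda>_. \<rho>"] assms(2) that by (auto simp: PiE_dflt_def)
    then have sub: "(\<Union>x\<in>R. \<sigma> x) \<subseteq> {1..P}" using ring_pmf_support(1) by blast
    obtain W where W: "(\<Union>x\<in>R. \<sigma> x) \<subseteq> W" "W \<subseteq> {1..P}" "card W = u"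
      using exists_subset_between[OF _ _ sub, of u] \<sigma> assms(3) by auto
    then have "\<sigma> x \<subseteq> W" if "x \<in> R" for x using that by blast
    then have "\<sigma> \<in> ?E W" by auto
    then show "\<sigma> \<in> (\<Union>W\<in>rings u. ?E W)" using W by auto
  qed
  then have "measure_pmf.prob ?M {\<sigma>. card (\<Union>x\<in>R. \<sigma> x) \<le> u} \<le> measure_pmf.prob ?M (\<Union>W\<in>rings u. ?E W)"
    by (subst measure_Int_set_pmf[symmetric], intro measure_pmf.finite_measure_mono) auto
  also have "\<dots> \<le> (\<Sum>W\<in>rings u. measure_pmf.prob ?M (?E W))"
    using rings(1) by (intro measure_UNION_le) auto
  also have "\<dots> \<le> (\<Sum>W\<in>rings u. (real u / real P) ^ (K 1 * card R))"
  proof (intro sum_mono)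
    fix W assume W: "W \<in> rings u"
    have "measure_pmf.prob ?M (?E W) = (\<Prod>x\<in>V. measure_pmf.prob \<rho> (if x \<in> R then {Z. Z \<subseteq> W} else UNIV))"
      by (rule measure_Pi_pmf_Pi[OF assms(1)])
    also have "\<dots> = (\<Prod>x\<in>R. measure_pmf.prob \<rho> {Z. Z \<subseteq> W})"
      using assms by (intro prod.mono_neutral_cong_right) auto
    also have "\<dots> \<le> (\<Prod>x\<in>R. (real u / real P) ^ K 1)"
      using W prob_ring_subset[of W] by (intro prod_mono) auto
    finally show "measure_pmf.prob ?M (?E W) \<le> (real u / real P) ^ (K 1 * card R)"
      by (simp add: power_mult)
  qed
  also have "\<dots> = real (P choose u) * (real u / real P) ^ (K 1 * card R)"
    using rings(2)[of u] by simp
  finally show ?thesis .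
qed

text \<open>Put m = i K 1. Bounding the binomial coefficient by (e P / u)^u cancels (u / P)^u and
  leaves (u / P)^(m - u). Here m - u \<ge> \<epsilon> m: the deficit of the union is what makes the
  bound small.\<close>

lemma small_union_bound:
  fixes \<epsilon> :: real
  assumes \<epsilon>: "0 < \<epsilon>" "\<epsilon> < 1" and i: "0 < i" "real (i * K 1) \<le> exp (- 1 - 1 / \<epsilon>) * real P"
    and u: "real u \<le> (1 - \<epsilon>) * real (i * K 1)" and K: "1 \<le> \<epsilon> * real (K 1)"
  shows "real (P choose u) * (real u / real P) ^ (K 1 * i)
     \<le> (exp (1 / \<epsilon>) * (real (i * K 1) / real P) * exp (1 - \<epsilon> * real (K 1))) ^ i"
proof -
  define m where "m = i * K 1"
  define y where "y = real m / real P"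
  have m: "0 < m" using i K1 by (auto simp: m_def)
  have P: "0 < P" by (rule P_pos)
  have y: "0 < y" "y \<le> exp (- 1 - 1 / \<epsilon>)" using i m P by (auto simp: y_def m_def field_simps)
  have y1: "y \<le> 1" using y(2) \<epsilon> by (smt (verit) exp_le_one_iff divide_nonneg_nonneg)
  have um: "u \<le> m"
  proof -
    have "(1 - \<epsilon>) * real m \<le> 1 * real m" using \<epsilon> by (intro mult_right_mono) auto
    then have "real u \<le> real m" using u unfolding m_def by linarith
    then show ?thesis by simp
  qed
  have "real (P choose u) * (real u / real P) ^ m
     = (real (P choose u) * real u ^ u) / real P ^ u * (real u / real P) ^ (m - u)"
    using um by (simp add: power_divide power_add[symmetric] flip: times_divide_eq_right)
       (simp add: field_simps flip: power_add)
  also have "\<dots> \<le> (exp 1 * real P) ^ u / real P ^ u * (real m / real P) ^ (m - u)"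
    using um by (intro mult_mono divide_right_mono choose_mult_power_le power_mono) auto
  also have "\<dots> = exp (real u) * y ^ (m - u)"
    using P by (simp add: y_def power_mult_distrib flip: exp_of_nat_mult)
  also have "\<dots> \<le> exp (real m) * y powr (\<epsilon> * real m)"
  proof (intro mult_mono)
    have "y ^ (m - u) = y powr real (m - u)" using y by (simp add: powr_realpow)
    also have "\<dots> \<le> y powr (\<epsilon> * real m)"
      using y y1 u um by (intro powr_mono') (auto simp: of_nat_diff m_def algebra_simps)
    finally show "y ^ (m - u) \<le> y powr (\<epsilon> * real m)" .
  qed (use um y in auto)
  \<comment> \<open>The crude factor e^m is the power \<epsilon> m of exp (1 / \<epsilon>), so it
    moves into the base. The cap exp (-1 - 1 / \<epsilon>) on y is made to keep this base below 1 /
    e.\<close>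
  also have "\<dots> = ((exp (1 / \<epsilon>) * y) powr (\<epsilon> * real (K 1))) ^ i"
  proof -
    have "exp (1 / \<epsilon>) powr (\<epsilon> * real m) = exp (real m)" using \<epsilon> by (simp add: powr_def)
    then have "exp (real m) * y powr (\<epsilon> * real m) = (exp (1 / \<epsilon>) * y) powr (\<epsilon> * real m)"
      using y by (simp add: powr_mult)
    also have "\<dots> = (exp (1 / \<epsilon>) * y) powr (\<epsilon> * real (K 1) * real i)" by (simp add: m_def mult_ac)
    also have "\<dots> = ((exp (1 / \<epsilon>) * y) powr (\<epsilon> * real (K 1))) ^ i"
    proof -
      have "(exp (1 / \<epsilon>) * y) powr (\<epsilon> * real (K 1) * real i)
          = ((exp (1 / \<epsilon>) * y) powr (\<epsilon> * real (K 1))) powr real i" by (rule powr_powr[symmetric])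
      also have "\<dots> = ((exp (1 / \<epsilon>) * y) powr (\<epsilon> * real (K 1))) ^ i"
        using y by (intro powr_realpow) simp
      finally show ?thesis .
    qed
    finally show ?thesis .
  qed
  also have "\<dots> \<le> (exp (1 / \<epsilon>) * y * exp (1 - \<epsilon> * real (K 1))) ^ i"
  proof (intro power_mono)
    let ?x = "exp (1 / \<epsilon>) * y"
    have x: "0 < ?x" using y by simp
    have "?x \<le> exp (1 / \<epsilon>) * exp (- 1 - 1 / \<epsilon>)" using y by (intro mult_left_mono) auto
    also have "\<dots> = exp (- 1)" by (simp flip: exp_add)
    finally have x1: "?x \<le> exp (- 1)" .
    \<comment> \<open>One factor of the base is kept, as its y is needed against the number of sets
      of i nodes; the others are replaced by 1 / e.\<close>
    have "?x powr (\<epsilon> * real (K 1)) = ?x * ?x powr (\<epsilon> * real (K 1) - 1)"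
      using x by (simp add: powr_diff)
    also have "\<dots> \<le> ?x * exp (- 1) powr (\<epsilon> * real (K 1) - 1)"
      using x x1 K by (intro mult_left_mono powr_mono2) auto
    also have "exp (- 1) powr (\<epsilon> * real (K 1) - 1) = exp (1 - \<epsilon> * real (K 1))"
      by (simp add: powr_def)
    finally show "?x powr (\<epsilon> * real (K 1)) \<le> ?x * exp (1 - \<epsilon> * real (K 1))" .
  qed auto
  finally show ?thesis by (simp add: y_def m_def mult.commute)
qed

text \<open>In the union bound over sets of i nodes, (e n / i)^i meets the factor i K 1 / P kept in
  \<open>small_union_bound\<close>: i cancels and n / P \<le> 1 / s remains. This is why the key
  pool must grow at least linearly. The base \<eta> no longer depends on i, so the sum is
  geometric.\<close>

lemma prob_not_expanding:
  fixes \<epsilon> s :: real and V :: "'a set"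
  assumes V: "finite V" and \<epsilon>: "0 < \<epsilon>" "\<epsilon> < 1" and s: "0 < s" "s * real (card V) \<le> real P"
    and K: "1 \<le> \<epsilon> * real (K 1)"
  defines "\<eta> \<equiv> exp 2 * (exp (1 / \<epsilon>) / s) * real (K 1) * exp (- \<epsilon> * real (K 1))"
  assumes \<eta>: "\<eta> \<le> 1 / 2"
  shows "measure_pmf.prob (Pi_pmf V {} (\<lambda>_. \<rho>)) {\<sigma>. \<not> expanding \<epsilon> (exp (- 1 - 1 / \<epsilon>)) V \<sigma>} \<le> 2 * \<eta>"
proof -
  let ?M = "Pi_pmf V {} (\<lambda>_. \<rho>)" and ?\<kappa> = "exp (- 1 - 1 / \<epsilon>)"
  define n where "n = card V"
  define bad where "bad = (\<lambda>R. {\<sigma> :: 'a \<Rightarrow> nat set. real (card (\<Union>x\<in>R. \<sigma> x)) < (1 - \<epsilon>) * real (card R * K 1)})"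
  define \<R> where "\<R> = (\<lambda>i. {R. R \<subseteq> V \<and> card R = i})"
  define I where "I = {i \<in> {1..n}. real (i * K 1) \<le> ?\<kappa> * real P}"
  have fin: "finite (\<R> i)" for i
    unfolding \<R>_def by (rule finite_subset[of _ "Pow V"]) (use V in auto)
  have \<eta>0: "0 \<le> \<eta>" using s by (auto simp: \<eta>_def)
  have badR: "measure_pmf.prob ?M (bad R)
      \<le> (exp (1 / \<epsilon>) * (real (i * K 1) / real P) * exp (1 - \<epsilon> * real (K 1))) ^ i"
    if R: "R \<in> \<R> i" and i: "i \<in> I" for R i
  proof -
    let ?t = "(1 - \<epsilon>) * real (i * K 1)"
    \<comment> \<open>The largest integer strictly below \<open>?t\<close>, since a bad set violates
      expansion strictly.\<close>
    define u where "u = nat (\<lceil>?t\<rceil> - 1)"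
    have t: "0 < ?t" using \<epsilon> i K1 by (auto simp: I_def)
    then have c1: "1 \<le> \<lceil>?t\<rceil>" by simp
    have u: "real u \<le> ?t" "\<And>c. real c < ?t \<longleftrightarrow> c \<le> u"
    proof -
      have "real u = of_int \<lceil>?t\<rceil> - 1" using c1 by (simp add: u_def)
      then show "real u \<le> ?t" by linarith
      show "real c < ?t \<longleftrightarrow> c \<le> u" for c
        using c1 unfolding u_def by (simp add: le_nat_iff less_ceiling_iff[symmetric]) linarith
    qed
    have "u \<le> P"
    proof -
      have "?t \<le> 1 * real (i * K 1)" using \<epsilon> by (intro mult_right_mono) auto
      also have "real (i * K 1) \<le> ?\<kappa> * real P" using i by (auto simp: I_def)
      also have "\<dots> \<le> 1 * real P"
      proof (intro mult_right_mono)
        have "0 < 1 / \<epsilon>" using \<epsilon> by simp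
        then have "- 1 - 1 / \<epsilon> \<le> 0" by linarith
        then show "?\<kappa> \<le> 1" by (simp only: exp_le_one_iff)
      qed auto
      finally show ?thesis using u by simp
    qed
    have "bad R = {\<sigma>. card (\<Union>x\<in>R. \<sigma> x) \<le> u}"
      using R u(2) by (auto simp: bad_def \<R>_def)
    then have "measure_pmf.prob ?M (bad R) \<le> real (P choose u) * (real u / real P) ^ (K 1 * i)"
      using prob_small_union[OF V, of R u] R \<open>u \<le> P\<close> by (auto simp: \<R>_def)
    also have "\<dots> \<le> (exp (1 / \<epsilon>) * (real (i * K 1) / real P) * exp (1 - \<epsilon> * real (K 1))) ^ i"
      using i \<epsilon> K u by (intro small_union_bound) (auto simp: I_def)
    finally show ?thesis .
  qed
  have "{\<sigma>. \<not> expanding \<epsilon> ?\<kappa> V \<sigma>} \<subseteq> (\<Union>i\<in>I. \<Union>R\<in>\<R> i. bad R)"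
  proof
    fix \<sigma> assume "\<sigma> \<in> {\<sigma>. \<not> expanding \<epsilon> ?\<kappa> V \<sigma>}"
    then obtain R where R: "R \<subseteq> V" "R \<noteq> {}" "real (card R * K 1) \<le> ?\<kappa> * real P" "\<sigma> \<in> bad R"
      by (auto simp: expanding_def bad_def not_le)
    have "0 < card R" "card R \<le> n"
      using R V by (auto simp: n_def card_gt_0_iff finite_subset intro: card_mono)
    then show "\<sigma> \<in> (\<Union>i\<in>I. \<Union>R\<in>\<R> i. bad R)"
      using R by (auto simp: I_def \<R>_def Suc_le_eq)
  qed
  then have "measure_pmf.prob ?M {\<sigma>. \<not> expanding \<epsilon> ?\<kappa> V \<sigma>} \<le> measure_pmf.prob ?M (\<Union>i\<in>I. \<Union>R\<in>\<R> i. bad R)"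
    by (intro measure_pmf.finite_measure_mono) auto
  also have "\<dots> \<le> (\<Sum>i\<in>I. measure_pmf.prob ?M (\<Union>R\<in>\<R> i. bad R))"
    by (intro measure_UNION_le) (auto simp: I_def)
  also have "\<dots> \<le> (\<Sum>i\<in>I. \<eta> ^ i)"
  proof (intro sum_mono)
    fix i assume i: "i \<in> I"
    let ?b = "exp (1 / \<epsilon>) * (real (i * K 1) / real P) * exp (1 - \<epsilon> * real (K 1))"
    have i0: "0 < i" "i \<le> n" using i by (auto simp: I_def)
    have "measure_pmf.prob ?M (\<Union>R\<in>\<R> i. bad R) \<le> (\<Sum>R\<in>\<R> i. measure_pmf.prob ?M (bad R))"
      by (intro measure_UNION_le fin) auto
    also have "\<dots> \<le> (\<Sum>R\<in>\<R> i. ?b ^ i)"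
      by (intro sum_mono badR i)
    also have "\<dots> = real (n choose i) * ?b ^ i"
      using n_subsets[OF V, of i] by (simp add: \<R>_def n_def)
    also have "\<dots> \<le> (exp 1 * real n / real i) ^ i * ?b ^ i"
      using choose_mult_power_le[of n i] i0
      by (intro mult_right_mono) (auto simp: power_divide field_simps)
    also have "\<dots> = (exp 1 * real n / real i * ?b) ^ i" by (simp only: power_mult_distrib)
    also have "\<dots> \<le> \<eta> ^ i"
    proof (intro power_mono)
      have "real n / real P \<le> 1 / s"
        using s P_pos by (auto simp: n_def field_simps)
      then have "real n / real P * (exp 2 * exp (1 / \<epsilon>) * real (K 1) * exp (- \<epsilon> * real (K 1)))
          \<le> 1 / s * (exp 2 * exp (1 / \<epsilon>) * real (K 1) * exp (- \<epsilon> * real (K 1)))"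
        by (intro mult_right_mono) auto
      also have "real n / real P * (exp 2 * exp (1 / \<epsilon>) * real (K 1) * exp (- \<epsilon> * real (K 1)))
          = exp 1 * real n / real i * ?b"
      proof -
        have "exp 2 = exp (1::real) * exp 1" by (simp flip: exp_add)
        then show ?thesis using i0 P_pos by (simp add: exp_diff exp_minus field_simps)
      qed
      finally show "exp 1 * real n / real i * ?b \<le> \<eta>" by (simp add: \<eta>_def mult_ac)
    qed auto
    finally show "measure_pmf.prob ?M (\<Union>R\<in>\<R> i. bad R) \<le> \<eta> ^ i" .
  qed
  also have "\<dots> \<le> (\<Sum>i=1..n. \<eta> ^ i)"
    using \<eta>0 by (intro sum_mono2) (auto simp: I_def)
  also have "\<dots> \<le> 2 * \<eta>" using \<eta>0 \<eta> by (rule sum_power_le_double)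
  finally show ?thesis .
qed

section \<open>Avoiding a set of nodes whose rings expand\<close>

definition miss_base :: "real \<Rightarrow> nat \<Rightarrow> real" where
  "miss_base \<epsilon> j = miss_prob P (K 1) (K j) powr (1 - \<epsilon>)"

text \<open>The number of rings up to which expansion may be invoked. The maximum with 1 is
  legitimate because a single ring has at least \<open>K 1\<close> keys in any case.\<close>

definition cover_max :: "real \<Rightarrow> nat" where
  "cover_max \<kappa> = max 1 (nat \<lfloor>\<kappa> * real P / real (K 1)\<rfloor>)"

text \<open>\<open>miss_base\<close> is the factor that each ring contributes, on the expansion
  event, to the probability that a class-j ring misses the union. Its exponent 1 - \<epsilon> pays
  for overlaps. The comparison with class 1 serves large sets, where one base for all classes is
  enough.\<close>

lemma miss_base:
  assumes "j \<in> {1..r}" "0 \<le> \<epsilon>" "\<epsilon> < 1"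
  shows "0 < miss_base \<epsilon> j" "miss_base \<epsilon> j \<le> 1 - (1 - \<epsilon>) * key_prob K P 1 j"
    "1 - key_prob K P 1 j \<le> miss_base \<epsilon> j" "miss_base \<epsilon> j \<le> 1"
    "miss_base \<epsilon> j \<le> miss_base \<epsilon> 1"
proof -
  let ?q = "miss_prob P (K 1) (K j)"
  have q: "0 < ?q" "?q \<le> 1"
    using K_bounds[OF assms(1)] K_bounds[of 1] r by (auto intro!: miss_prob_pos miss_prob_le_1)
  show "0 < miss_base \<epsilon> j" using q by (simp add: miss_base_def)
  show "miss_base \<epsilon> j \<le> 1 - (1 - \<epsilon>) * key_prob K P 1 j"
    using powr_le_affine[of ?q "1 - \<epsilon>"] q assms by (simp add: miss_base_def key_prob_eq_miss)
  show "miss_base \<epsilon> j \<le> 1"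
    using q assms by (simp add: miss_base_def powr_le1)
  show "1 - key_prob K P 1 j \<le> miss_base \<epsilon> j"
    using powr_mono'[of "1 - \<epsilon>" 1 ?q] q assms by (simp add: miss_base_def key_prob_eq_miss)
  show "miss_base \<epsilon> j \<le> miss_base \<epsilon> 1"
    using K_bounds[OF assms(1)] assms q miss_prob_antimono_right[of "K 1" "K j" P "K 1"]
    by (auto simp: miss_base_def intro!: powr_mono2)
qed

text \<open>Beyond \<open>cover_max\<close> nodes expansion says nothing about \<open>R\<close>, so
  a subset of that size stands in for it: its union is only smaller.\<close>

lemma prob_avoid_union_le:
  assumes S: "finite S" "\<And>x. x \<in> S \<Longrightarrow> \<sigma> x \<in> set_pmf \<rho>" and R: "R \<subseteq> S"
    and exp: "expanding \<epsilon> \<kappa> S \<sigma>" and \<epsilon>: "0 \<le> \<epsilon>" "\<epsilon> \<le> 1 / 2"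
  shows "measure_pmf.prob \<rho> {Z. (\<Union>x\<in>R. \<sigma> x) \<inter> Z = {}}
     \<le> (\<Sum>j=1..r. pmf \<mu> j * miss_base \<epsilon> j ^ min (card R) (cover_max \<kappa>))"
proof (cases "R = {}")
  case True
  then show ?thesis using sum_pmf by simp
next
  case False
  let ?U = "\<lambda>R. \<Union>x\<in>R. \<sigma> x"
  define i where "i = min (card R) (cover_max \<kappa>)"
  have finR: "finite R" using S R finite_subset by auto
  have i1: "1 \<le> i" using False finR by (auto simp: i_def cover_max_def Suc_le_eq card_gt_0_iff)
  obtain R' where R': "R' \<subseteq> R" "card R' = i"
    by (rule obtain_subset_with_card_n[of i R]) (auto simp: i_def)
  have R'0: "R' \<noteq> {}" using R'(2) i1 by auto
  have supp: "\<sigma> x \<subseteq> {1..P}" "K 1 \<le> card (\<sigma> x)" "finite (\<sigma> x)" if "x \<in> R" for x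
    using ring_pmf_support[OF S(2)[of x]] that R by auto
  have UP: "?U R \<subseteq> {1..P}" using supp(1) by blast
  then have cU: "card (?U R) \<le> P" "finite (?U R)"
    using card_mono[OF _ UP] finite_subset[OF UP] by auto
  have le: "card (?U R') \<le> card (?U R)"
    using R' cU by (intro card_mono) auto
  have uK: "K 1 \<le> card (?U R)"
  proof -
    obtain x where "x \<in> R" using False by auto
    then show ?thesis using supp(2) cU(2) card_mono[of "?U R" "\<sigma> x"] by fastforce
  qed
  have ui: "(1 - \<epsilon>) * real i * real (K 1) \<le> real (card (?U R))"
  \<comment> \<open>For i = 1 the cap in \<open>expanding\<close> may be exceeded, but the size of
    one ring suffices.\<close>
  proof (cases "i = 1")
    case True
    have "(1 - \<epsilon>) * real (K 1) \<le> 1 * real (K 1)" using \<epsilon> by (intro mult_right_mono) auto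
    then show ?thesis using True uK by simp
  next
    case False
    have "i \<le> nat \<lfloor>\<kappa> * real P / real (K 1)\<rfloor>" using i1 False by (auto simp: i_def cover_max_def)
    then have "real i \<le> \<kappa> * real P / real (K 1)" using i1 by linarith
    then have "real (card R' * K 1) \<le> \<kappa> * real P" using R' K1 by (simp add: field_simps)
    then have "(1 - \<epsilon>) * real (card R' * K 1) \<le> real (card (?U R'))"
      using exp R R' R'0 unfolding expanding_def by blast
    then show ?thesis using R' le by (simp add: mult_ac)
  qed
  have "measure_pmf.prob \<rho> {Z. ?U R \<inter> Z = {}} = (\<Sum>j=1..r. pmf \<mu> j * miss_prob P (card (?U R)) (K j))"
    by (rule prob_ring_avoid[OF UP])
  also have "\<dots> \<le> (\<Sum>j=1..r. pmf \<mu> j * miss_base \<epsilon> j ^ i)"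
  proof (intro sum_mono mult_left_mono)
    fix j assume j: "j \<in> {1..r}"
    have q: "0 < miss_prob P (K 1) (K j)"
      using K_bounds[OF j] K_bounds[of 1] r by (intro miss_prob_pos) auto
    have "miss_prob P (card (?U R)) (K j) \<le> miss_prob P (K 1) (K j) powr ((1 - \<epsilon>) * real i)"
      using uK ui cU K_bounds[OF j] K_bounds[of 1] r \<epsilon>
      by (intro miss_prob_powr) auto
    also have "\<dots> = miss_base \<epsilon> j ^ i"
      using q by (simp add: miss_base_def powr_powr[symmetric] powr_realpow)
    finally show "miss_prob P (card (?U R)) (K j) \<le> miss_base \<epsilon> j ^ i" .
  qed auto
  finally show ?thesis by (simp add: i_def)
qed

text \<open>Multiply out over \<open>S\<close>. The subset \<open>R\<close> is the set of neighbours
  in the Erdos-Renyi graph, with its binomial weight.\<close>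

lemma avoid_prob_eq_sum:
  assumes "finite S"
  shows "avoid_prob \<rho> \<alpha> S \<sigma> = (\<Sum>R\<in>Pow S. \<alpha> ^ card R * (1 - \<alpha>) ^ card (S - R) *
     measure_pmf.prob \<rho> {Z. (\<Union>x\<in>R. \<sigma> x) \<inter> Z = {}})"
proof -
  have "avoid_fun \<alpha> S \<sigma> = (\<lambda>Z. \<Sum>R\<in>Pow S. \<alpha> ^ card R * (1 - \<alpha>) ^ card (S - R) *
      indicator {Z. (\<Union>x\<in>R. \<sigma> x) \<inter> Z = {}} Z)"
  proof
    fix Z
    have "avoid_fun \<alpha> S \<sigma> Z = (\<Prod>x\<in>S. \<alpha> * of_bool (\<sigma> x \<inter> Z = {}) + (1 - \<alpha>))"
      unfolding avoid_fun_def by (intro prod.cong) auto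
    also have "\<dots> = (\<Sum>R\<in>Pow S. (\<Prod>x\<in>R. \<alpha> * of_bool (\<sigma> x \<inter> Z = {})) * (\<Prod>x\<in>S - R. 1 - \<alpha>))"
      by (rule prod_add) fact
    also have "\<dots> = (\<Sum>R\<in>Pow S. \<alpha> ^ card R * (1 - \<alpha>) ^ card (S - R) *
      indicator {Z. (\<Union>x\<in>R. \<sigma> x) \<inter> Z = {}} Z)"
    proof (intro sum.cong refl)
      fix R assume "R \<in> Pow S"
      then have fin: "finite R" using assms finite_subset by auto
      have "(\<Prod>x\<in>R. of_bool (\<sigma> x \<inter> Z = {}) :: real) = indicator {Z. (\<Union>x\<in>R. \<sigma> x) \<inter> Z = {}} Z"
      proof (cases "\<forall>x\<in>R. \<sigma> x \<inter> Z = {}")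
        case False
        then have "(\<Prod>x\<in>R. of_bool (\<sigma> x \<inter> Z = {}) :: real) = 0" using fin by (auto simp: prod_zero_iff)
        then show ?thesis using False by (auto simp: indicator_def)
      next
        case True
        then have "(\<Prod>x\<in>R. of_bool (\<sigma> x \<inter> Z = {}) :: real) = 1" by (intro prod.neutral) auto
        then show ?thesis using True by (auto simp: indicator_def)
      qed
      then show "(\<Prod>x\<in>R. \<alpha> * of_bool (\<sigma> x \<inter> Z = {})) * (\<Prod>x\<in>S - R. 1 - \<alpha>) =
          \<alpha> ^ card R * (1 - \<alpha>) ^ card (S - R) * indicator {Z. (\<Union>x\<in>R. \<sigma> x) \<inter> Z = {}} Z"
        by (simp add: prod.distrib)
    qed
    finally show "avoid_fun \<alpha> S \<sigma> Z = (\<Sum>R\<in>Pow S. \<alpha> ^ card R * (1 - \<alpha>) ^ card (S - R) *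
      indicator {Z. (\<Union>x\<in>R. \<sigma> x) \<inter> Z = {}} Z)" .
  qed
  then show ?thesis
    unfolding avoid_prob_def
    by (simp add: Bochner_Integration.integral_sum integrable_measure_pmf_finite finite_set_ring_pmf)
qed

lemma avoid_prob_le:
  assumes S: "finite S" "\<And>x. x \<in> S \<Longrightarrow> \<sigma> x \<in> set_pmf \<rho>"
    and exp: "expanding \<epsilon> \<kappa> S \<sigma>" and \<epsilon>: "0 \<le> \<epsilon>" "\<epsilon> \<le> 1 / 2" and \<alpha>: "\<alpha> \<in> {0..1}"
  shows "avoid_prob \<rho> \<alpha> S \<sigma> \<le> (\<Sum>j=1..r. pmf \<mu> j * (\<Sum>R\<in>Pow S. \<alpha> ^ card R * (1 - \<alpha>) ^ card (S - R) *
     miss_base \<epsilon> j ^ min (card R) (cover_max \<kappa>)))"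
proof -
  have "avoid_prob \<rho> \<alpha> S \<sigma> \<le> (\<Sum>R\<in>Pow S. \<alpha> ^ card R * (1 - \<alpha>) ^ card (S - R) *
     (\<Sum>j=1..r. pmf \<mu> j * miss_base \<epsilon> j ^ min (card R) (cover_max \<kappa>)))"
    unfolding avoid_prob_eq_sum[OF S(1)]
    using \<alpha> by (intro sum_mono mult_left_mono prob_avoid_union_le[OF S _ exp \<epsilon>]) auto
  also have "\<dots> = (\<Sum>j=1..r. pmf \<mu> j * (\<Sum>R\<in>Pow S. \<alpha> ^ card R * (1 - \<alpha>) ^ card (S - R) *
     miss_base \<epsilon> j ^ min (card R) (cover_max \<kappa>)))"
    unfolding sum_distrib_left by (subst sum.swap) (simp add: mult_ac)
  finally show ?thesis .
qed

text \<open>\<open>power_min_le\<close> makes the mean over the random subset explicit, and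
  \<open>one_minus_power_ge\<close> linearises it. One factor 1 - \<epsilon> is the overlap loss in
  \<open>miss_base\<close>; the other is the quadratic term, at most a fraction \<epsilon> of the
  linear one when \<alpha> |S| \<theta> \<le> 2 \<epsilon>.\<close>

lemma avoid_prob_le_small:
  assumes S: "finite S" "\<And>x. x \<in> S \<Longrightarrow> \<sigma> x \<in> set_pmf \<rho>"
    and exp: "expanding \<epsilon> \<kappa> S \<sigma>" and \<epsilon>: "0 \<le> \<epsilon>" "\<epsilon> \<le> 1 / 2" and \<alpha>: "\<alpha> \<in> {0..1}"
    and small: "\<And>j. j \<in> {1..r} \<Longrightarrow>
      \<alpha> * real (card S) * (key_prob K P 1 j + 1 / real (cover_max \<kappa>)) \<le> 2 * \<epsilon>"
  shows "avoid_prob \<rho> \<alpha> S \<sigma> \<le> 1 - (1 - \<epsilon>)\<^sup>2 * real (card S) * mean_edge_prob r \<mu> K P \<alpha> 1"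
proof -
  let ?M = "cover_max \<kappa>" and ?l = "card S"
  have M: "1 \<le> ?M" by (simp add: cover_max_def)
  have main: "(\<Sum>R\<in>Pow S. \<alpha> ^ card R * (1 - \<alpha>) ^ card (S - R) * miss_base \<epsilon> j ^ min (card R) ?M)
      \<le> 1 - (1 - \<epsilon>)\<^sup>2 * real ?l * \<alpha> * key_prob K P 1 j" if j: "j \<in> {1..r}" for j
  proof -
    define p where "p = 1 - miss_base \<epsilon> j"
    define \<theta> where "\<theta> = p + (1 - p) / real ?M"
    have b: "0 \<le> p" "p < 1" "(1 - \<epsilon>) * key_prob K P 1 j \<le> p" "p \<le> key_prob K P 1 j"
      using miss_base[OF j, of \<epsilon>] \<epsilon> by (auto simp: p_def)
    have \<theta>: "0 < \<theta>" "\<theta> \<le> 1" "\<theta> \<le> key_prob K P 1 j + 1 / real ?M"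
      using b M divide_left_mono[of 1 "real ?M" "1 - p"] divide_right_mono[of "1 - p" 1 "real ?M"]
      by (auto simp: \<theta>_def add_nonneg_pos)
    have "(\<Sum>R\<in>Pow S. \<alpha> ^ card R * (1 - \<alpha>) ^ card (S - R) * miss_base \<epsilon> j ^ min (card R) ?M)
        \<le> (\<Sum>R\<in>Pow S. \<alpha> ^ card R * (1 - \<alpha>) ^ card (S - R) * (1 - p / \<theta> * (1 - (1 - \<theta>) ^ card R)))"
      using power_min_le[OF b(1,2) M] \<alpha> unfolding p_def[symmetric] \<theta>_def
      by (intro sum_mono mult_left_mono) (auto simp: p_def)
    also have "\<dots> = (1 - p / \<theta>) * (\<Sum>R\<in>Pow S. \<alpha> ^ card R * (1 - \<alpha>) ^ card (S - R) * 1 ^ card R)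
        + p / \<theta> * (\<Sum>R\<in>Pow S. \<alpha> ^ card R * (1 - \<alpha>) ^ card (S - R) * (1 - \<theta>) ^ card R)"
      by (simp add: sum_distrib_left sum.distrib[symmetric] algebra_simps)
    also have "\<dots> = 1 - p / \<theta> * (1 - (1 - \<alpha> * \<theta>) ^ ?l)"
      unfolding sum_weights_Pow[OF S(1)] by (simp add: algebra_simps)
    also have "\<dots> \<le> 1 - p / \<theta> * (real ?l * (\<alpha> * \<theta>) - (real ?l * (\<alpha> * \<theta>))\<^sup>2 / 2)"
      using \<theta> b \<alpha> mult_le_one[of \<alpha> \<theta>] by (intro diff_left_mono mult_left_mono one_minus_power_ge) auto
    also have "p / \<theta> * (real ?l * (\<alpha> * \<theta>) - (real ?l * (\<alpha> * \<theta>))\<^sup>2 / 2)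
        = p * (real ?l * \<alpha>) * (1 - \<alpha> * real ?l * \<theta> / 2)"
      using \<theta> by (simp add: field_simps power2_eq_square)
    also have "1 - p * (real ?l * \<alpha>) * (1 - \<alpha> * real ?l * \<theta> / 2)
        \<le> 1 - ((1 - \<epsilon>) * key_prob K P 1 j) * (real ?l * \<alpha>) * (1 - \<epsilon>)"
    proof (intro diff_left_mono mult_mono)
      have "\<alpha> * real ?l * \<theta> \<le> \<alpha> * real ?l * (key_prob K P 1 j + 1 / real ?M)"
        using \<theta> \<alpha> by (intro mult_left_mono) auto
      then show "\<alpha> * real ?l * \<theta> / 2 \<le> \<epsilon>" using small[OF j] by linarith
    qed (use b \<alpha> \<epsilon> in auto)
    finally show ?thesis by (simp add: power2_eq_square mult_ac)
  qed
  have "avoid_prob \<rho> \<alpha> S \<sigma> \<le> (\<Sum>j=1..r. pmf \<mu> j * (\<Sum>R\<in>Pow S. \<alpha> ^ card R * (1 - \<alpha>) ^ card (S - R) *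
     miss_base \<epsilon> j ^ min (card R) (cover_max \<kappa>)))"
    by (rule avoid_prob_le[OF S exp \<epsilon> \<alpha>])
  also have "\<dots> \<le> (\<Sum>j=1..r. pmf \<mu> j * (1 - (1 - \<epsilon>)\<^sup>2 * real ?l * \<alpha> * key_prob K P 1 j))"
    by (intro sum_mono mult_left_mono main pmf_nonneg)
  also have "\<dots> = 1 - (1 - \<epsilon>)\<^sup>2 * real ?l * mean_edge_prob r \<mu> K P \<alpha> 1"
    using sum_pmf
    by (simp add: right_diff_distrib sum_subtractf mean_edge_prob_def mean_key_prob_def sum_distrib_left mult_ac)
  finally show ?thesis .
qed

text \<open>A power with exponent min (|R|, M) is at most the sum of the two powers. The first
  averages to an exponential in |S|. For the second, the base is at most exp (- (K 1)^2 / (2 P)) and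
  M is at least \<kappa> P / (2 K 1), so P cancels.\<close>

lemma avoid_prob_le_large:
  assumes S: "finite S" "\<And>x. x \<in> S \<Longrightarrow> \<sigma> x \<in> set_pmf \<rho>"
    and exp: "expanding \<epsilon> \<kappa> S \<sigma>" and \<epsilon>: "0 \<le> \<epsilon>" "\<epsilon> \<le> 1 / 2" and \<alpha>: "\<alpha> \<in> {0..1}" and \<kappa>: "0 < \<kappa>"
  shows "avoid_prob \<rho> \<alpha> S \<sigma>
     \<le> exp (- (real (card S) * \<alpha> * key_prob K P 1 1 / 2)) + exp (- (\<kappa> * real (K 1) / 4))"
proof -
  let ?M = "cover_max \<kappa>" and ?l = "card S" and ?b = "miss_base \<epsilon> 1"
  have r1: "1 \<in> {1..r}" using r by auto
  have b: "0 < ?b" "?b \<le> 1 - (1 - \<epsilon>) * key_prob K P 1 1" "?b \<le> 1"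
    using miss_base[OF r1, of \<epsilon>] \<epsilon> by auto
  have key: "0 \<le> key_prob K P 1 1" using miss_prob_le_1 by (simp add: key_prob_eq_miss)
  have main: "(\<Sum>R\<in>Pow S. \<alpha> ^ card R * (1 - \<alpha>) ^ card (S - R) * miss_base \<epsilon> j ^ min (card R) ?M)
      \<le> (1 - \<alpha> * (1 - ?b)) ^ ?l + ?b ^ ?M" if j: "j \<in> {1..r}" for j
  proof -
    have "miss_base \<epsilon> j ^ min (card R) ?M \<le> ?b ^ card R + ?b ^ ?M" for R :: "'a set"
    proof -
      have "miss_base \<epsilon> j ^ min (card R) ?M \<le> ?b ^ min (card R) ?M"
        using miss_base[OF j, of \<epsilon>] \<epsilon> by (intro power_mono) auto
      also have "\<dots> \<le> ?b ^ card R + ?b ^ ?M" using b by (auto simp: min_def)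
      finally show ?thesis .
    qed
    then have "(\<Sum>R\<in>Pow S. \<alpha> ^ card R * (1 - \<alpha>) ^ card (S - R) * miss_base \<epsilon> j ^ min (card R) ?M)
        \<le> (\<Sum>R\<in>Pow S. \<alpha> ^ card R * (1 - \<alpha>) ^ card (S - R) * (?b ^ card R + ?b ^ ?M))"
      using \<alpha> by (intro sum_mono mult_left_mono) auto
    also have "\<dots> = (\<Sum>R\<in>Pow S. \<alpha> ^ card R * (1 - \<alpha>) ^ card (S - R) * ?b ^ card R)
        + ?b ^ ?M * (\<Sum>R\<in>Pow S. \<alpha> ^ card R * (1 - \<alpha>) ^ card (S - R) * 1 ^ card R)"
      by (simp add: sum_distrib_left sum.distrib[symmetric] algebra_simps)
    also have "\<dots> = (1 - \<alpha> * (1 - ?b)) ^ ?l + ?b ^ ?M"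
      unfolding sum_weights_Pow[OF S(1)] by simp
    finally show ?thesis .
  qed
  have "avoid_prob \<rho> \<alpha> S \<sigma> \<le> (\<Sum>j=1..r. pmf \<mu> j * (\<Sum>R\<in>Pow S. \<alpha> ^ card R * (1 - \<alpha>) ^ card (S - R) *
     miss_base \<epsilon> j ^ min (card R) (cover_max \<kappa>)))"
    by (rule avoid_prob_le[OF S exp \<epsilon> \<alpha>])
  also have "\<dots> \<le> (\<Sum>j=1..r. pmf \<mu> j * ((1 - \<alpha> * (1 - ?b)) ^ ?l + ?b ^ ?M))"
    by (intro sum_mono mult_left_mono main pmf_nonneg)
  also have "\<dots> = (1 - \<alpha> * (1 - ?b)) ^ ?l + ?b ^ ?M"
    by (simp only: sum_distrib_right[symmetric] sum_pmf mult_1)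
  also have "(1 - \<alpha> * (1 - ?b)) ^ ?l \<le> exp (- (\<alpha> * (1 - ?b))) ^ ?l"
    using b \<alpha> mult_le_one[of \<alpha> "1 - ?b"] exp_ge_add_one_self[of "- (\<alpha> * (1 - ?b))"]
    by (intro power_mono) auto
  also have "\<dots> = exp (- (real ?l * \<alpha> * (1 - ?b)))"
    by (simp flip: exp_of_nat_mult)
  also have "\<dots> \<le> exp (- (real ?l * \<alpha> * key_prob K P 1 1 / 2))"
  proof -
    have "key_prob K P 1 1 / 2 \<le> (1 - \<epsilon>) * key_prob K P 1 1"
      using \<epsilon> key mult_right_mono[of "1/2" "1 - \<epsilon>" "key_prob K P 1 1"] by simp
    also have "\<dots> \<le> 1 - ?b" using b by simp
    finally have "real ?l * \<alpha> * (key_prob K P 1 1 / 2) \<le> real ?l * \<alpha> * (1 - ?b)"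
      using \<alpha> by (intro mult_left_mono) auto
    then show ?thesis by simp
  qed
  also have "?b ^ ?M \<le> exp (- (\<kappa> * real (K 1) / 4))"
  proof -
    \<comment> \<open>The floor of x is at least x / 2 once x \<ge> 1; the maximum with 1 covers
      smaller x.\<close>
    have M: "\<kappa> * real P / real (K 1) / 2 \<le> real ?M"
      unfolding cover_max_def using \<kappa> by (auto simp: max_def) linarith+
    have "?b \<le> exp (- real (K 1) * real (K 1) / real P) powr (1 - \<epsilon>)"
      unfolding miss_base_def using \<epsilon> K_bounds[OF r1] P_pos
      by (intro powr_mono2 miss_prob_le_exp miss_prob_nonneg) auto
    also have "\<dots> = exp (- ((1 - \<epsilon>) * (real (K 1) * real (K 1) / real P)))"
      by (simp add: powr_def)
    also have "\<dots> \<le> exp (- (1 / 2 * (real (K 1) * real (K 1) / real P)))"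
      using \<epsilon> mult_right_mono[of "1/2" "1 - \<epsilon>" "real (K 1) * real (K 1) / real P"] by simp
    finally have "?b ^ ?M \<le> exp (- (1 / 2 * (real (K 1) * real (K 1) / real P))) ^ ?M"
      using b by (intro power_mono) auto
    also have "\<dots> = exp (- (real ?M * (1 / 2 * (real (K 1) * real (K 1) / real P))))"
      by (simp flip: exp_of_nat_mult)
    also have "\<dots> \<le> exp (- (\<kappa> * real P / real (K 1) / 2 * (1 / 2 * (real (K 1) * real (K 1) / real P))))"
      using mult_right_mono[OF M, of "1 / 2 * (real (K 1) * real (K 1) / real P)"] by simp
    also have "\<dots> = exp (- (\<kappa> * real (K 1) / 4))"
      using P_pos K1 by simp
    finally show ?thesis .
  qed
  finally show ?thesis by simp
qed

lemma expanding_subset: "expanding \<epsilon> \<kappa> V \<sigma> \<Longrightarrow> S \<subseteq> V \<Longrightarrow> expanding \<epsilon> \<kappa> S \<sigma>"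
  by (auto simp: expanding_def)

text \<open>Forgetting part of \<open>S\<close> only makes avoidance likelier. The subset
  \<open>S'\<close> lets an estimate valid for small sets serve larger ones, while the exponent
  keeps counting the nodes outside \<open>S\<close>.\<close>

lemma prob_cut_le:
  assumes V: "finite V" "S \<subseteq> V" "S' \<subseteq> S" and \<alpha>: "\<alpha> \<in> {0..1}" and b: "0 \<le> b"
    and le: "\<And>\<sigma>. (\<And>x. x \<in> S' \<Longrightarrow> \<sigma> x \<in> set_pmf \<rho>) \<Longrightarrow> expanding \<epsilon> \<kappa> S' \<sigma> \<Longrightarrow>
       avoid_prob \<rho> \<alpha> S' \<sigma> \<le> b"
  shows "measure_pmf.prob (joint_pmf V \<rho> \<alpha>) {(\<sigma>, B). expanding \<epsilon> \<kappa> V \<sigma> \<and> no_edges \<sigma> B S (V - S)}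
     \<le> b ^ card (V - S)"
proof -
  let ?M = "Pi_pmf S {} (\<lambda>_. \<rho>)"
  have fin: "finite S" using V finite_subset by auto
  have "measure_pmf.prob (joint_pmf V \<rho> \<alpha>) {(\<sigma>, B). expanding \<epsilon> \<kappa> V \<sigma> \<and> no_edges \<sigma> B S (V - S)}
      \<le> measure_pmf.prob (joint_pmf V \<rho> \<alpha>) {(\<sigma>, B). expanding \<epsilon> \<kappa> S \<sigma> \<and> no_edges \<sigma> B S (V - S)}"
    using expanding_subset V(2) by (intro measure_pmf.finite_measure_mono) auto
  also have "\<dots> = measure_pmf.expectation ?M
      (\<lambda>\<sigma>. of_bool (expanding \<epsilon> \<kappa> S \<sigma>) * avoid_prob \<rho> \<alpha> S \<sigma> ^ card (V - S))"
  proof (rule prob_no_edges[OF V(1,2) \<alpha>])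
    fix \<sigma> \<sigma>' :: "'a \<Rightarrow> nat set" assume *: "\<And>x. x \<in> S \<Longrightarrow> \<sigma> x = \<sigma>' x"
    have "(\<Union>x\<in>R. \<sigma> x) = (\<Union>x\<in>R. \<sigma>' x)" if "R \<subseteq> S" for R using that * by auto
    then show "expanding \<epsilon> \<kappa> S \<sigma> = expanding \<epsilon> \<kappa> S \<sigma>'" by (simp add: expanding_def cong: imp_cong)
  qed
  also have "\<dots> \<le> b ^ card (V - S)"
  proof (rule measure_pmf.integral_le_const)
    show "integrable (measure_pmf ?M) (\<lambda>\<sigma>. of_bool (expanding \<epsilon> \<kappa> S \<sigma>) * avoid_prob \<rho> \<alpha> S \<sigma> ^ card (V - S))"
      by (rule measure_pmf.integrable_const_bound[where B=1])
         (use power_le_one[OF avoid_prob_bounds[OF \<alpha>, of \<rho> S]] in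
           \<open>auto simp: avoid_prob_bounds(1)[OF \<alpha>]\<close>)
    show "AE \<sigma> in ?M. of_bool (expanding \<epsilon> \<kappa> S \<sigma>) * avoid_prob \<rho> \<alpha> S \<sigma> ^ card (V - S) \<le> b ^ card (V - S)"
    proof (rule AE_pmfI)
      fix \<sigma> assume "\<sigma> \<in> set_pmf ?M"
      then have \<sigma>: "\<sigma> x \<in> set_pmf \<rho>" if "x \<in> S" for x
        using set_Pi_pmf_subset'[OF fin, of "{}" "\<lambda>_. \<rho>"] that by (auto simp: PiE_dflt_def)
      show "of_bool (expanding \<epsilon> \<kappa> S \<sigma>) * avoid_prob \<rho> \<alpha> S \<sigma> ^ card (V - S) \<le> b ^ card (V - S)"
      proof (cases "expanding \<epsilon> \<kappa> S \<sigma>")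
        case True
        have "avoid_prob \<rho> \<alpha> S \<sigma> \<le> avoid_prob \<rho> \<alpha> S' \<sigma>"
          unfolding avoid_prob_def
        proof (rule integral_mono)
          fix Z
          have "avoid_fun \<alpha> S \<sigma> Z = avoid_fun \<alpha> S' \<sigma> Z * avoid_fun \<alpha> (S - S') \<sigma> Z"
            unfolding avoid_fun_def by (subst prod.subset_diff[OF V(3) fin]) (rule mult.commute)
          also have "\<dots> \<le> avoid_fun \<alpha> S' \<sigma> Z * 1"
            by (intro mult_left_mono avoid_fun_bounds \<alpha>)
          finally show "avoid_fun \<alpha> S \<sigma> Z \<le> avoid_fun \<alpha> S' \<sigma> Z" by simp
        qed (intro integrable_avoid_fun \<alpha>)+
        also have "\<dots> \<le> b" using \<sigma> V(3) True expanding_subset by (intro le) auto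
        finally have "avoid_prob \<rho> \<alpha> S \<sigma> ^ card (V - S) \<le> b ^ card (V - S)"
          by (intro power_mono avoid_prob_bounds \<alpha>)
        then show ?thesis using True by simp
      qed (use b in auto)
    qed
  qed
  finally show ?thesis .
qed

section \<open>Union bound over cuts\<close>

abbreviation "cut_event \<epsilon> \<kappa> V S \<equiv> {(\<sigma>, B). expanding \<epsilon> \<kappa> V \<sigma> \<and> no_edges \<sigma> B S (V - S)}"

text \<open>With x = (K 1)^2 / P the key probability is at least min (x, 1) / 2, and
  \<open>cover_max\<close> is at least \<kappa> P / (2 K 1). Hence the truncation term 1 / M in
  \<theta> costs only a constant multiple of the key probability.\<close>

lemma key_prob_cover_max:
  assumes "0 < \<kappa>" "\<kappa> \<le> 1"
  shows "\<kappa> / 4 \<le> key_prob K P 1 1 * real (cover_max \<kappa>)"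
proof -
  define x where "x = real (K 1) * real (K 1) / real P"
  have r1: "1 \<in> {1..r}" using r by auto
  have x: "0 \<le> x" by (simp add: x_def)
  have p: "1 - exp (- x) \<le> key_prob K P 1 1"
    using miss_prob_le_exp[of "K 1" P "K 1"] K_bounds[OF r1] by (simp add: x_def key_prob_eq_miss)
  have M: "1 \<le> real (cover_max \<kappa>)" "\<kappa> * real P / real (K 1) / 2 \<le> real (cover_max \<kappa>)"
    unfolding cover_max_def using assms by (auto simp: max_def) linarith+
  show ?thesis
  proof (cases "1 \<le> x")
    case True
    have "exp (- x) \<le> exp (- 1)" using True by simp
    also have "exp (- 1) \<le> (1 / 2 :: real)"
      using exp_ge_add_one_self[of 1] by (simp add: exp_minus field_simps)
    finally have "1 / 2 \<le> key_prob K P 1 1" using p by simp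
    then have "1 / 2 * 1 \<le> key_prob K P 1 1 * real (cover_max \<kappa>)" using M by (intro mult_mono) auto
    then show ?thesis using assms by simp
  next
    case False
    have "exp (- x) * (1 + x) \<le> exp (- x) * exp x" using exp_ge_add_one_self[of x] by (intro mult_left_mono) auto
    also have "\<dots> = 1" by (simp flip: exp_add)
    finally have "exp (- x) \<le> 1 / (1 + x)" using x by (simp add: field_simps)
    also have "\<dots> \<le> 1 - x / 2" using x False mult_left_mono[of x 1 x] by (simp add: field_simps)
    finally have "x / 2 \<le> key_prob K P 1 1" using p by simp
    then have "x / 2 * (\<kappa> * real P / real (K 1) / 2) \<le> key_prob K P 1 1 * real (cover_max \<kappa>)"
      using M x assms by (intro mult_mono) auto
    moreover have "x / 2 * (\<kappa> * real P / real (K 1) / 2) = \<kappa> * real (K 1) / 4"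
      using P_pos K1 by (simp add: x_def)
    moreover have "\<kappa> * 1 \<le> \<kappa> * real (K 1)" using assms K1 by (intro mult_left_mono) auto
    ultimately show ?thesis by linarith
  qed
qed

lemma key_prob_bounds: "0 \<le> key_prob K P i j" "key_prob K P i j \<le> 1"
  using miss_prob_le_1 miss_prob_nonneg by (auto simp: key_prob_eq_miss)

lemma mean_key_prob_ge: "j \<in> {1..r} \<Longrightarrow> pmf \<mu> j * key_prob K P i j \<le> mean_key_prob r \<mu> K P i"
  unfolding mean_key_prob_def
  by (rule member_le_sum[of j "{1..r}"]) (auto intro!: mult_nonneg_nonneg key_prob_bounds)

text \<open>Each \<alpha> times a key probability of class 1 is at most \<Lambda> / m, and 1 / M is
  at most 4 / \<kappa> times the key probability within class 1. So the smallness condition of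
  \<open>avoid_prob_le_small\<close> becomes one on |S'| \<Lambda> alone, uniformly in the
  class.\<close>

lemma prob_cut_small:
  assumes V: "finite V" "S \<subseteq> V" "S' \<subseteq> S" and \<alpha>: "\<alpha> \<in> {0..1}"
    and \<epsilon>: "0 \<le> \<epsilon>" "\<epsilon> \<le> 1 / 2" and \<kappa>: "0 < \<kappa>" "\<kappa> \<le> 1"
    and m: "0 < m" "\<And>j. j \<in> {1..r} \<Longrightarrow> m \<le> pmf \<mu> j"
    and t: "t * (1 + 4 / \<kappa>) \<le> 2 * \<epsilon> * m" "real (card S') * mean_edge_prob r \<mu> K P \<alpha> 1 \<le> t"
  shows "measure_pmf.prob (joint_pmf V \<rho> \<alpha>) (cut_event \<epsilon> \<kappa> V S)
     \<le> exp (- ((1 - \<epsilon>)\<^sup>2 * real (card S') * mean_edge_prob r \<mu> K P \<alpha> 1 * real (card (V - S))))"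
proof -
  let ?\<Lambda> = "mean_edge_prob r \<mu> K P \<alpha> 1" and ?M = "real (cover_max \<kappa>)" and ?p = "key_prob K P 1"
  have M: "1 \<le> ?M" by (simp add: cover_max_def)
  have r1: "1 \<in> {1..r}" using r by auto
  have \<Lambda>: "m * (\<alpha> * ?p j) \<le> ?\<Lambda>" if j: "j \<in> {1..r}" for j
  proof -
    have "m * (\<alpha> * ?p j) \<le> pmf \<mu> j * (\<alpha> * ?p j)"
      using m(2)[OF j] \<alpha> key_prob_bounds by (intro mult_right_mono) auto
    also have "\<dots> = \<alpha> * (pmf \<mu> j * ?p j)" by simp
    also have "\<dots> \<le> ?\<Lambda>"
      unfolding mean_edge_prob_def using \<alpha> mean_key_prob_ge[OF j] by (intro mult_left_mono) auto
    finally show ?thesis .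
  qed
  have small: "\<alpha> * real (card S') * (?p j + 1 / ?M) \<le> 2 * \<epsilon>" if j: "j \<in> {1..r}" for j
  proof -
    have "1 / ?M \<le> 4 / \<kappa> * ?p 1"
      using key_prob_cover_max[OF \<kappa>] M \<kappa> by (simp add: field_simps)
    then have "m * (\<alpha> * real (card S') * (?p j + 1 / ?M)) \<le> m * (\<alpha> * real (card S') * (?p j + 4 / \<kappa> * ?p 1))"
      using m \<alpha> by (intro mult_left_mono) auto
    also have "\<dots> = real (card S') * (m * (\<alpha> * ?p j) + 4 / \<kappa> * (m * (\<alpha> * ?p 1)))"
      by (simp add: algebra_simps)
    also have "\<dots> \<le> real (card S') * (?\<Lambda> + 4 / \<kappa> * ?\<Lambda>)"
      using \<Lambda>[OF j] \<Lambda>[OF r1] \<kappa> by (intro mult_left_mono add_mono) auto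
    also have "\<dots> = real (card S') * ?\<Lambda> * (1 + 4 / \<kappa>)" by (simp add: algebra_simps)
    also have "\<dots> \<le> t * (1 + 4 / \<kappa>)" using t \<kappa> by (intro mult_right_mono) (auto intro: add_nonneg_nonneg)
    also have "\<dots> \<le> m * (2 * \<epsilon>)" using t by (simp add: mult_ac)
    finally show ?thesis using m by simp
  qed
  have "measure_pmf.prob (joint_pmf V \<rho> \<alpha>) (cut_event \<epsilon> \<kappa> V S)
     \<le> exp (- ((1 - \<epsilon>)\<^sup>2 * real (card S') * ?\<Lambda>)) ^ card (V - S)"
  proof (rule prob_cut_le[OF V \<alpha>])
    fix \<sigma> assume \<sigma>: "\<And>x. x \<in> S' \<Longrightarrow> \<sigma> x \<in> set_pmf \<rho>" "expanding \<epsilon> \<kappa> S' \<sigma>"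
    have "finite S'" using V finite_subset by metis
    then have "avoid_prob \<rho> \<alpha> S' \<sigma> \<le> 1 - (1 - \<epsilon>)\<^sup>2 * real (card S') * ?\<Lambda>"
      by (rule avoid_prob_le_small[OF _ \<sigma>(1) \<sigma>(2) \<epsilon> \<alpha> small])
    also have "\<dots> \<le> exp (- ((1 - \<epsilon>)\<^sup>2 * real (card S') * ?\<Lambda>))"
      using exp_ge_add_one_self[of "- ((1 - \<epsilon>)\<^sup>2 * real (card S') * ?\<Lambda>)"] by simp
    finally show "avoid_prob \<rho> \<alpha> S' \<sigma> \<le> exp (- ((1 - \<epsilon>)\<^sup>2 * real (card S') * ?\<Lambda>))" .
  qed auto
  then show ?thesis by (simp add: mult_ac flip: exp_of_nat_mult)
qed

lemma prob_cut_large: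
  assumes V: "finite V" "S \<subseteq> V" and \<alpha>: "\<alpha> \<in> {0..1}"
    and \<epsilon>: "0 \<le> \<epsilon>" "\<epsilon> \<le> 1 / 2" and \<kappa>: "0 < \<kappa>"
    and b: "exp (- (real (card S) * \<alpha> * key_prob K P 1 1 / 2)) + exp (- (\<kappa> * real (K 1) / 4)) \<le> b"
  shows "measure_pmf.prob (joint_pmf V \<rho> \<alpha>) (cut_event \<epsilon> \<kappa> V S) \<le> b ^ card (V - S)"
proof (rule prob_cut_le[OF V order_refl \<alpha>])
  show "0 \<le> b" using b by (smt (verit) exp_ge_zero)
  fix \<sigma> assume \<sigma>: "\<And>x. x \<in> S \<Longrightarrow> \<sigma> x \<in> set_pmf \<rho>" "expanding \<epsilon> \<kappa> S \<sigma>"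
  have "finite S" using V finite_subset by metis
  then show "avoid_prob \<rho> \<alpha> S \<sigma> \<le> b"
    by (rule order_trans[OF avoid_prob_le_large[OF _ \<sigma>(1) \<sigma>(2) \<epsilon> \<alpha> \<kappa>] b])
qed

lemma prob_not_connected_le_sum:
  assumes V: "finite V" "V \<noteq> {}"
    and f: "\<And>S. S \<subseteq> V \<Longrightarrow> S \<noteq> {} \<Longrightarrow> 2 * card S \<le> card V \<Longrightarrow>
      measure_pmf.prob (joint_pmf V \<rho> \<alpha>) (cut_event \<epsilon> \<kappa> V S) \<le> f (card S)"
    and f0: "\<And>l. 0 \<le> f l"
  shows "measure_pmf.prob (joint_pmf V \<rho> \<alpha>)
      {(\<sigma>, B). \<not> Digraph_Component.connected (with_proj (ring_edge_graph V \<sigma> B))}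
    \<le> measure_pmf.prob (Pi_pmf V {} (\<lambda>_. \<rho>)) {\<sigma>. \<not> expanding \<epsilon> \<kappa> V \<sigma>}
      + (\<Sum>l\<in>{l \<in> {1..card V}. 2 * l \<le> card V}. real (card V choose l) * f l)"
proof -
  let ?J = "joint_pmf V \<rho> \<alpha>" and ?I = "{l \<in> {1..card V}. 2 * l \<le> card V}"
  let ?S = "\<lambda>l. {S. S \<subseteq> V \<and> card S = l}"
  have fin: "finite (?S l)" for l by (rule finite_subset[of _ "Pow V"]) (use V in auto)
  have "{(\<sigma>, B). \<not> Digraph_Component.connected (with_proj (ring_edge_graph V \<sigma> B))}
      \<subseteq> {(\<sigma>, B). \<not> expanding \<epsilon> \<kappa> V \<sigma>} \<union> (\<Union>l\<in>?I. \<Union>S\<in>?S l. cut_event \<epsilon> \<kappa> V S)"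
  proof (intro subsetI, clarify)
    fix \<sigma> :: "'a \<Rightarrow> nat set" and B
    assume nc: "\<not> Digraph_Component.connected (with_proj (ring_edge_graph V \<sigma> B))"
      and not: "(\<sigma>, B) \<notin> (\<Union>l\<in>?I. \<Union>S\<in>?S l. cut_event \<epsilon> \<kappa> V S)" and exp: "expanding \<epsilon> \<kappa> V \<sigma>"
    obtain S where S: "S \<subseteq> V" "S \<noteq> {}" "2 * card S \<le> card V" "no_edges \<sigma> B S (V - S)"
      using not_connected_imp_no_edges[OF nc V] .
    have "0 < card S" using S V by (auto simp: card_gt_0_iff finite_subset)
    then have "card S \<in> ?I" using S(3) by auto
    moreover have "S \<in> ?S (card S)" using S by auto
    moreover have "(\<sigma>, B) \<in> cut_event \<epsilon> \<kappa> V S" using S exp by auto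
    ultimately have "(\<sigma>, B) \<in> (\<Union>l\<in>?I. \<Union>S\<in>?S l. cut_event \<epsilon> \<kappa> V S)" by blast
    then show False using not by contradiction
  qed
  then have "measure_pmf.prob ?J {(\<sigma>, B). \<not> Digraph_Component.connected (with_proj (ring_edge_graph V \<sigma> B))}
      \<le> measure_pmf.prob ?J ({(\<sigma>, B). \<not> expanding \<epsilon> \<kappa> V \<sigma>} \<union> (\<Union>l\<in>?I. \<Union>S\<in>?S l. cut_event \<epsilon> \<kappa> V S))"
    by (intro measure_pmf.finite_measure_mono) auto
  also have "\<dots> \<le> measure_pmf.prob ?J {(\<sigma>, B). \<not> expanding \<epsilon> \<kappa> V \<sigma>}
      + measure_pmf.prob ?J (\<Union>l\<in>?I. \<Union>S\<in>?S l. cut_event \<epsilon> \<kappa> V S)"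
    by (rule measure_Un_le) auto
  also have "measure_pmf.prob ?J {(\<sigma>, B). \<not> expanding \<epsilon> \<kappa> V \<sigma>}
      = measure_pmf.prob (map_pmf fst ?J) {\<sigma>. \<not> expanding \<epsilon> \<kappa> V \<sigma>}"
    by (simp add: vimage_def case_prod_unfold)
  also have "map_pmf fst ?J = Pi_pmf V {} (\<lambda>_. \<rho>)"
    by (simp add: joint_pmf_def map_fst_pair_pmf)
  also have "measure_pmf.prob ?J (\<Union>l\<in>?I. \<Union>S\<in>?S l. cut_event \<epsilon> \<kappa> V S)
      \<le> (\<Sum>l\<in>?I. measure_pmf.prob ?J (\<Union>S\<in>?S l. cut_event \<epsilon> \<kappa> V S))"
    by (intro measure_UNION_le) auto
  also have "\<dots> \<le> (\<Sum>l\<in>?I. real (card V choose l) * f l)"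
  proof (intro sum_mono)
    fix l assume l: "l \<in> ?I"
    have "measure_pmf.prob ?J (\<Union>S\<in>?S l. cut_event \<epsilon> \<kappa> V S)
        \<le> (\<Sum>S\<in>?S l. measure_pmf.prob ?J (cut_event \<epsilon> \<kappa> V S))"
      by (intro measure_UNION_le fin) auto
    also have "\<dots> \<le> (\<Sum>S\<in>?S l. f l)"
    proof (intro sum_mono)
      fix S assume "S \<in> ?S l"
      then have S: "S \<subseteq> V" "card S = l" by auto
      moreover have "S \<noteq> {}" using S(2) l by auto
      ultimately show "measure_pmf.prob ?J (cut_event \<epsilon> \<kappa> V S) \<le> f l" using f[of S] l by simp
    qed
    also have "\<dots> = real (card V choose l) * f l"
      using n_subsets[OF V(1), of l] by simp
    finally show "measure_pmf.prob ?J (\<Union>S\<in>?S l. cut_event \<epsilon> \<kappa> V S) \<le> real (card V choose l) * f l" .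
  qed
  finally show ?thesis by simp
qed

text \<open>One summand of the bound for each range of |S|: up to t / \<Lambda>, from there to
  \<epsilon>2 n, and beyond. Adding the summands gives a single bound for all sizes.\<close>

lemma prob_cut_term_le:
  fixes V :: "'a set"
  assumes V: "finite V" "S \<subseteq> V" "S \<noteq> {}" "2 * card S \<le> card V" and \<alpha>: "\<alpha> \<in> {0..1}"
    and \<epsilon>: "0 \<le> \<epsilon>" "\<epsilon> \<le> 1 / 2" and \<kappa>: "0 < \<kappa>" "\<kappa> \<le> 1"
    and m: "0 < m" "\<And>j. j \<in> {1..r} \<Longrightarrow> m \<le> pmf \<mu> j"
    and t: "0 < t" "t * (1 + 4 / \<kappa>) \<le> 2 * \<epsilon> * m"
    and \<epsilon>2: "- \<epsilon>2 * ln (t / 64) \<le> t / 64" "t \<le> 64"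
  defines "n \<equiv> real (card V)" and "\<Lambda> \<equiv> mean_edge_prob r \<mu> K P \<alpha> 1"
  assumes H1: "(1 + \<delta>) * ln n \<le> (1 - \<epsilon>) ^ 3 * \<Lambda> * n" and H2: "t \<le> \<epsilon> * \<Lambda> * n" and H3: "2 * \<Lambda> \<le> t"
    and \<Lambda>: "0 < \<Lambda>"
    and H4: "exp (- (\<epsilon>2 * n * \<alpha> * key_prob K P 1 1 / 2)) + exp (- (\<kappa> * real (K 1) / 4)) \<le> exp (- 4)"
  shows "real (card V choose card S) * measure_pmf.prob (joint_pmf V \<rho> \<alpha>) (cut_event \<epsilon> \<kappa> V S)
    \<le> (n powr (- \<delta>)) ^ card S + exp (- (t * n / 32)) + exp (- n)"
proof -
  let ?l = "card S" and ?pr = "measure_pmf.prob (joint_pmf V \<rho> \<alpha>) (cut_event \<epsilon> \<kappa> V S)"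
  have fin: "finite S" using V finite_subset by auto
  have l0: "0 < ?l" using fin V by (simp add: card_gt_0_iff)
  have n0: "0 < n" using V l0 by (simp add: n_def)
  have nl: "n / 2 \<le> real (card (V - S))" "real (card (V - S)) = n - real ?l"
    using V fin l0 by (auto simp: n_def card_Diff_subset of_nat_diff)
  consider "real ?l * \<Lambda> \<le> t" | "t < real ?l * \<Lambda>" "real ?l \<le> \<epsilon>2 * n" | "\<epsilon>2 * n < real ?l" by linarith
  then show ?thesis
  proof cases
    case 1
    have "real ?l * \<Lambda> \<le> \<epsilon> * n * \<Lambda>" using 1 H2 by (simp add: mult_ac)
    then have "real ?l \<le> \<epsilon> * n" using \<Lambda> by simp
    \<comment> \<open>A third factor 1 - \<epsilon>, besides the two of the cut estimate: |S| \<le>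
      \<epsilon> n leaves at least (1 - \<epsilon>) n outside nodes.\<close>
    then have le: "(1 - \<epsilon>) * n \<le> real (card (V - S))" using nl by (simp add: algebra_simps)
    have "?pr \<le> exp (- ((1 - \<epsilon>)\<^sup>2 * real ?l * \<Lambda> * real (card (V - S))))"
      unfolding \<Lambda>_def
      by (rule prob_cut_small[OF V(1,2) order_refl \<alpha> \<epsilon> \<kappa> m t(2)]) (use 1 in \<open>auto simp: \<Lambda>_def\<close>)
    also have "\<dots> \<le> exp (- (real ?l * ((1 + \<delta>) * ln n)))"
    proof -
      have "real ?l * ((1 + \<delta>) * ln n) \<le> real ?l * ((1 - \<epsilon>) ^ 3 * \<Lambda> * n)"
        by (intro mult_left_mono H1) auto
      also have "\<dots> = (1 - \<epsilon>)\<^sup>2 * real ?l * \<Lambda> * ((1 - \<epsilon>) * n)"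
        by (simp add: power2_eq_square power3_eq_cube)
      also have "\<dots> \<le> (1 - \<epsilon>)\<^sup>2 * real ?l * \<Lambda> * real (card (V - S))"
        using \<Lambda> by (intro mult_left_mono le) auto
      finally show ?thesis by simp
    qed
    finally have pr: "?pr \<le> exp (- (real ?l * ((1 + \<delta>) * ln n)))" .
    have "real (card V choose ?l) \<le> real (card V ^ ?l)"
      using V fin by (intro of_nat_mono binomial_le_pow card_mono)
    also have "\<dots> = exp (real ?l * ln n)" using n0 by (simp add: exp_of_nat_mult n_def)
    finally have "real (card V choose ?l) * ?pr \<le> exp (real ?l * ln n) * exp (- (real ?l * ((1 + \<delta>) * ln n)))"
      using pr by (intro mult_mono) auto
    also have "\<dots> = (n powr (- \<delta>)) ^ ?l"
      using n0 by (simp add: powr_def algebra_simps flip: exp_add exp_of_nat_mult)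
    finally show ?thesis by (smt (verit) exp_ge_zero)
  next
    case 2
    define k where "k = nat \<lfloor>t / \<Lambda>\<rfloor>"
    have k: "real k \<le> t / \<Lambda>" "t / \<Lambda> - 1 \<le> real k" using t \<Lambda> by (auto simp: k_def)
    have "t / \<Lambda> < real ?l" using 2 \<Lambda> by (simp add: field_simps)
    then have "k \<le> ?l" using k by linarith
    then obtain S' where S': "S' \<subseteq> S" "card S' = k"
      by (rule obtain_subset_with_card_n)
    have k\<Lambda>: "real k * \<Lambda> \<le> t" "t / 2 \<le> real k * \<Lambda>"
    proof -
      show "real k * \<Lambda> \<le> t" using k \<Lambda> by (simp add: field_simps)
      have "(t / \<Lambda> - 1) * \<Lambda> \<le> real k * \<Lambda>"
        using k \<Lambda> by (intro mult_right_mono) auto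
      also have "(t / \<Lambda> - 1) * \<Lambda> = t - \<Lambda>" using \<Lambda> by (simp add: left_diff_distrib)
      finally show "t / 2 \<le> real k * \<Lambda>" using H3 by linarith
    qed
    have "?pr \<le> exp (- ((1 - \<epsilon>)\<^sup>2 * real (card S') * \<Lambda> * real (card (V - S))))"
      unfolding \<Lambda>_def
      by (rule prob_cut_small[OF V(1,2) S'(1) \<alpha> \<epsilon> \<kappa> m t(2)]) (use k\<Lambda> S' in \<open>auto simp: \<Lambda>_def\<close>)
    also have "\<dots> \<le> exp (- (t * n / 16))"
    proof -
      have "(1 / 2)\<^sup>2 * (t / 2) * (n / 2) \<le> (1 - \<epsilon>)\<^sup>2 * (real k * \<Lambda>) * real (card (V - S))"
        using \<epsilon> nl k\<Lambda> t n0 by (intro mult_mono power_mono) auto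
      then show ?thesis using S' by (simp add: power2_eq_square mult_ac)
    qed
    finally have pr: "?pr \<le> exp (- (t * n / 16))" .
    \<comment> \<open>With x = t / 64 and |S| \<le> \<epsilon>2 n the number of sets is at most exp
      (t n / 32), half of the exponent t n / 16 gained from the cut.\<close>
    have "real (card V choose ?l) \<le> exp (t / 64 * n - real ?l * ln (t / 64))"
      using choose_le_exp[of "t / 64" "card V" ?l] t by (simp add: n_def)
    also have "\<dots> \<le> exp (t / 64 * n + t / 64 * n)"
    proof -
      have "- ln (t / 64) * real ?l \<le> - ln (t / 64) * (\<epsilon>2 * n)"
        using 2 t \<epsilon>2 by (intro mult_left_mono) auto
      also have "\<dots> = (- \<epsilon>2 * ln (t / 64)) * n" by simp
      also have "\<dots> \<le> t / 64 * n" using n0 by (intro mult_right_mono \<epsilon>2) auto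
      finally show ?thesis by (simp add: mult_ac)
    qed
    finally have "real (card V choose ?l) * ?pr \<le> exp (t / 64 * n + t / 64 * n) * exp (- (t * n / 16))"
      using pr by (intro mult_mono) auto
    also have "\<dots> = exp (- (t * n / 32))" by (simp flip: exp_add)
    finally show ?thesis by (smt (verit) exp_ge_zero powr_ge_zero zero_le_power)
  next
    case 3
    have "exp (- (real ?l * \<alpha> * key_prob K P 1 1 / 2)) \<le> exp (- (\<epsilon>2 * n * \<alpha> * key_prob K P 1 1 / 2))"
    proof -
      have "\<epsilon>2 * n * (\<alpha> * key_prob K P 1 1) \<le> real ?l * (\<alpha> * key_prob K P 1 1)"
        using 3 \<alpha> key_prob_bounds by (intro mult_right_mono) auto
      then show ?thesis by (simp add: mult_ac)
    qed
    then have "exp (- (real ?l * \<alpha> * key_prob K P 1 1 / 2)) + exp (- (\<kappa> * real (K 1) / 4)) \<le> exp (- 4)"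
      using H4 by linarith
    then have "?pr \<le> exp (- 4) ^ card (V - S)"
      by (rule prob_cut_large[OF V(1,2) \<alpha> \<epsilon> \<kappa>(1)])
    also have "\<dots> = exp (- (4 * real (card (V - S))))" by (simp add: mult.commute flip: exp_of_nat_mult)
    also have "\<dots> \<le> exp (- (2 * n))" using nl by simp
    finally have pr: "?pr \<le> exp (- (2 * n))" .
    \<comment> \<open>There are at most e^n sets, and exp (-4) per outside node, for at least n / 2
      of them, yields exp (-2 n).\<close>
    have "real (card V choose ?l) \<le> exp (1 * n - real ?l * ln 1)"
      using choose_le_exp[of 1 "card V" ?l] by (simp add: n_def)
    then have "real (card V choose ?l) * ?pr \<le> exp (1 * n - real ?l * ln 1) * exp (- (2 * n))"
      using pr by (intro mult_mono) auto
    also have "\<dots> = exp (- n)" by (simp flip: exp_add)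
    finally show ?thesis by (smt (verit) exp_ge_zero powr_ge_zero zero_le_power)
  qed
qed

lemma prob_not_connected_le:
  fixes V :: "'a set"
  assumes V: "finite V" "V \<noteq> {}" and \<alpha>: "\<alpha> \<in> {0..1}" and \<epsilon>: "0 < \<epsilon>" "\<epsilon> \<le> 1 / 2"
    and m: "0 < m" "\<And>j. j \<in> {1..r} \<Longrightarrow> m \<le> pmf \<mu> j"
    and s: "0 < s" "s * real (card V) \<le> real P" and K: "1 \<le> \<epsilon> * real (K 1)"
  defines "\<kappa> \<equiv> exp (- 1 - 1 / \<epsilon>)"
    and "\<eta> \<equiv> exp 2 * (exp (1 / \<epsilon>) / s) * real (K 1) * exp (- \<epsilon> * real (K 1))"
    and "n \<equiv> real (card V)" and "\<Lambda> \<equiv> mean_edge_prob r \<mu> K P \<alpha> 1"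
  assumes \<eta>: "\<eta> \<le> 1 / 2"
    and t: "0 < t" "t * (1 + 4 / \<kappa>) \<le> 2 * \<epsilon> * m"
    and \<epsilon>2: "- \<epsilon>2 * ln (t / 64) \<le> t / 64" "t \<le> 64"
    and H1: "(1 + \<delta>) * ln n \<le> (1 - \<epsilon>) ^ 3 * \<Lambda> * n" and H2: "t \<le> \<epsilon> * \<Lambda> * n" and H3: "2 * \<Lambda> \<le> t"
    and \<Lambda>: "0 < \<Lambda>"
    and H4: "exp (- (\<epsilon>2 * n * \<alpha> * key_prob K P 1 1 / 2)) + exp (- (\<kappa> * real (K 1) / 4)) \<le> exp (- 4)"
    and \<delta>: "n powr (- \<delta>) \<le> 1 / 2"
  shows "measure_pmf.prob (joint_pmf V \<rho> \<alpha>)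
      {(\<sigma>, B). \<not> Digraph_Component.connected (with_proj (ring_edge_graph V \<sigma> B))}
    \<le> 2 * \<eta> + (2 * n powr (- \<delta>) + n * (exp (- (t * n / 32)) + exp (- n)))"
proof -
  define g where "g l = (n powr (- \<delta>)) ^ l + (exp (- (t * n / 32)) + exp (- n))" for l :: nat
  \<comment> \<open>Dividing by the binomial coefficient lets the union bound return the sum of
    \<open>g\<close>.\<close>
  define f where "f l = g l / real (card V choose l)" for l
  let ?I = "{l \<in> {1..card V}. 2 * l \<le> card V}"
  have g0: "0 \<le> g l" for l by (auto simp: g_def intro!: add_nonneg_nonneg)
  have \<kappa>: "0 < \<kappa>" "\<kappa> \<le> 1"
  proof -
    have "0 < 1 / \<epsilon>" using \<epsilon> by simp
    then have "- 1 - 1 / \<epsilon> \<le> 0" by linarith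
    then show "\<kappa> \<le> 1" unfolding \<kappa>_def by (simp only: exp_le_one_iff)
  qed (simp add: \<kappa>_def)
  have "measure_pmf.prob (joint_pmf V \<rho> \<alpha>)
      {(\<sigma>, B). \<not> Digraph_Component.connected (with_proj (ring_edge_graph V \<sigma> B))}
    \<le> measure_pmf.prob (Pi_pmf V {} (\<lambda>_. \<rho>)) {\<sigma>. \<not> expanding \<epsilon> \<kappa> V \<sigma>}
      + (\<Sum>l\<in>?I. real (card V choose l) * f l)"
  proof (rule prob_not_connected_le_sum[OF V])
    fix S assume S: "S \<subseteq> V" "S \<noteq> {}" "2 * card S \<le> card V"
    have C: "0 < card V choose card S" using S by simp
    have "real (card V choose card S) * measure_pmf.prob (joint_pmf V \<rho> \<alpha>) (cut_event \<epsilon> \<kappa> V S) \<le> g (card S)"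
      using prob_cut_term_le[OF V(1) S \<alpha> _ \<epsilon>(2) \<kappa> m t \<epsilon>2 H1[unfolded n_def \<Lambda>_def] H2[unfolded n_def \<Lambda>_def]
          H3[unfolded \<Lambda>_def] \<Lambda>[unfolded \<Lambda>_def] H4[unfolded n_def]] \<epsilon>
      by (simp add: g_def n_def)
    then show "measure_pmf.prob (joint_pmf V \<rho> \<alpha>) (cut_event \<epsilon> \<kappa> V S) \<le> f (card S)"
      using C by (simp add: f_def field_simps)
  qed (use g0 in \<open>auto simp: f_def\<close>)
  also have "\<dots> \<le> 2 * \<eta> + (\<Sum>l=1..card V. g l)"
  proof (intro add_mono)
    show "measure_pmf.prob (Pi_pmf V {} (\<lambda>_. \<rho>)) {\<sigma>. \<not> expanding \<epsilon> \<kappa> V \<sigma>} \<le> 2 * \<eta>"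
      unfolding \<kappa>_def \<eta>_def
      using \<epsilon> by (intro prob_not_expanding V s K \<eta>[unfolded \<eta>_def]) auto
    have "(\<Sum>l\<in>?I. real (card V choose l) * f l) = (\<Sum>l\<in>?I. g l)"
      by (intro sum.cong) (auto simp: f_def)
    also have "\<dots> \<le> (\<Sum>l=1..card V. g l)" using g0 by (intro sum_mono2) auto
    finally show "(\<Sum>l\<in>?I. real (card V choose l) * f l) \<le> (\<Sum>l=1..card V. g l)" .
  qed
  also have "(\<Sum>l=1..card V. g l) = (\<Sum>l=1..card V. (n powr (- \<delta>)) ^ l) + n * (exp (- (t * n / 32)) + exp (- n))"
    unfolding g_def by (simp add: sum.distrib n_def)
  also have "\<dots> \<le> 2 * n powr (- \<delta>) + n * (exp (- (t * n / 32)) + exp (- n))"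
    by (intro add_right_mono sum_power_le_double \<delta>) auto
  finally show ?thesis by simp
qed

text \<open>By Bernoulli's inequality and P - K 1 \<ge> P / 2. It serves to force \<open>K 1\<close>
  to infinity.\<close>

lemma key_prob_le: "key_prob K P 1 1 * real P \<le> 2 * (real (K 1))\<^sup>2"
proof -
  have K: "1 \<le> K 1" "2 * K 1 \<le> P" using K_bounds[of 1] r by auto
  have "1 - real (K 1) * real (K 1) / real (P - K 1) \<le> miss_prob P (K 1) (K 1)"
    using K by (intro miss_prob_ge) auto
  then have "key_prob K P 1 1 \<le> real (K 1) * real (K 1) / real (P - K 1)"
    by (simp add: key_prob_eq_miss)
  also have "\<dots> \<le> real (K 1) * real (K 1) / (real P / 2)"
    using K by (intro divide_left_mono) (auto simp: of_nat_diff)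
  finally show ?thesis using P_pos by (simp add: field_simps power2_eq_square)
qed

section \<open>Isolated nodes\<close>

text \<open>The event concerns the ring size and not the class, as several classes may share the
  size \<open>K 1\<close>.\<close>

abbreviation "full_prob \<equiv> measure_pmf.prob \<rho> {Z. card Z = K 1}"

lemma full_prob_eq: "full_prob = (\<Sum>j=1..r. pmf \<mu> j * of_bool (K j = K 1))"
  unfolding prob_ring_pmf
proof (intro sum.cong refl arg_cong2[of _ _ _ _ "(*)"])
  fix j assume j: "j \<in> {1..r}"
  have "rings (K j) \<inter> {Z. card Z = K 1} = (if K j = K 1 then rings (K j) else {})" by auto
  then show "measure_pmf.prob (pmf_of_set (rings (K j))) {Z. card Z = K 1} = of_bool (K j = K 1)"
    using rings[of "K j"] K_bounds(4)[OF j] by (subst measure_pmf_of_set) auto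
qed

lemma full_prob_ge: "pmf \<mu> 1 \<le> full_prob"
proof -
  have "pmf \<mu> 1 * of_bool (K 1 = K 1) \<le> (\<Sum>j=1..r. pmf \<mu> j * of_bool (K j = K 1))"
    using r by (intro member_le_sum[of 1 "{1..r}" "\<lambda>j. pmf \<mu> j * of_bool (K j = K 1)"]) auto
  then show ?thesis unfolding full_prob_eq by simp
qed

lemma prob_full_avoid:
  assumes "A \<subseteq> {1..P}" "card A = K 1"
  shows "measure_pmf.prob \<rho> {Z. card Z = K 1 \<and> A \<inter> Z = {}} = full_prob * (1 - key_prob K P 1 1)"
  unfolding full_prob_eq sum_distrib_right unfolding prob_ring_pmf
proof (intro sum.cong refl)
  fix j assume j: "j \<in> {1..r}"
  have "measure_pmf.prob (pmf_of_set (rings (K j))) {Z. card Z = K 1 \<and> A \<inter> Z = {}}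
      = of_bool (K j = K 1) * (1 - key_prob K P 1 1)"
  proof (cases "K j = K 1")
    case True
    have "measure_pmf.prob (pmf_of_set (rings (K j))) {Z. card Z = K 1 \<and> A \<inter> Z = {}}
        = measure_pmf.prob (pmf_of_set (rings (K j))) {Z. A \<inter> Z = {}}"
      using rings[of "K j"] K_bounds(4)[OF j] True by (intro measure_pmf.finite_measure_eq_AE) (auto simp: AE_measure_pmf_iff)
    also have "\<dots> = miss_prob P (card A) (K j)"
      using assms K_bounds(4)[OF j] by (intro prob_rings_avoid)
    finally show ?thesis using True assms by (simp add: key_prob_eq_miss)
  next
    case False
    have "rings (K j) \<inter> {Z. card Z = K 1 \<and> A \<inter> Z = {}} = {}" using False by auto
    then show ?thesis
      using False rings[of "K j"] K_bounds(4)[OF j] by (subst measure_pmf_of_set) auto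
  qed
  then show "pmf \<mu> j * measure_pmf.prob (pmf_of_set (rings (K j))) {Z. card Z = K 1 \<and> A \<inter> Z = {}}
      = pmf \<mu> j * of_bool (K j = K 1) * (1 - key_prob K P 1 1)" by simp
qed

lemma prob_ring_hit:
  assumes "A \<subseteq> {1..P}" "card A = K 1"
  shows "measure_pmf.prob \<rho> {Z. A \<inter> Z \<noteq> {}} = mean_key_prob r \<mu> K P 1"
proof -
  have "measure_pmf.prob \<rho> {Z. A \<inter> Z \<noteq> {}} = 1 - measure_pmf.prob \<rho> {Z. A \<inter> Z = {}}"
    using measure_pmf.prob_compl[of "{Z. A \<inter> Z = {}}" \<rho>] by (simp add: Compl_eq_Diff_UNIV[symmetric] Collect_neg_eq)
  also have "\<dots> = (\<Sum>j=1..r. pmf \<mu> j) - (\<Sum>j=1..r. pmf \<mu> j * miss_prob P (K 1) (K j))"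
    unfolding prob_ring_avoid[OF assms(1)] assms(2) sum_pmf ..
  also have "\<dots> = mean_key_prob r \<mu> K P 1"
    by (simp add: mean_key_prob_def key_prob_eq_miss right_diff_distrib sum_subtractf)
  finally show ?thesis .
qed

lemma avoid_prob_single:
  assumes "\<sigma> x \<subseteq> {1..P}" "card (\<sigma> x) = K 1"
  shows "avoid_prob \<rho> \<alpha> {x} \<sigma> = 1 - mean_edge_prob r \<mu> K P \<alpha> 1"
proof -
  have "avoid_fun \<alpha> {x} \<sigma> = (\<lambda>Z. 1 - \<alpha> * indicator {Z. \<sigma> x \<inter> Z \<noteq> {}} Z)"
    by (auto simp: avoid_fun_def indicator_def)
  then show ?thesis
    by (simp add: avoid_prob_def integrable_measure_pmf_finite finite_set_ring_pmf
        prob_ring_hit[OF assms] mean_edge_prob_def)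
qed

lemma avoid_prob_pair:
  assumes "x \<noteq> y" "\<sigma> x \<subseteq> {1..P}" "card (\<sigma> x) = K 1" "\<sigma> y \<subseteq> {1..P}" "card (\<sigma> y) = K 1"
  shows "avoid_prob \<rho> \<alpha> {x, y} \<sigma> = 1 - 2 * mean_edge_prob r \<mu> K P \<alpha> 1
     + \<alpha>\<^sup>2 * measure_pmf.prob \<rho> {Z. \<sigma> x \<inter> Z \<noteq> {} \<and> \<sigma> y \<inter> Z \<noteq> {}}"
proof -
  have "avoid_fun \<alpha> {x, y} \<sigma> = (\<lambda>Z. 1 - \<alpha> * indicator {Z. \<sigma> x \<inter> Z \<noteq> {}} Z - \<alpha> * indicator {Z. \<sigma> y \<inter> Z \<noteq> {}} Z
      + \<alpha>\<^sup>2 * indicator {Z. \<sigma> x \<inter> Z \<noteq> {} \<and> \<sigma> y \<inter> Z \<noteq> {}} Z)"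
    using assms(1) by (auto simp: avoid_fun_def indicator_def power2_eq_square algebra_simps)
  then show ?thesis
    by (simp add: avoid_prob_def integrable_measure_pmf_finite finite_set_ring_pmf
        prob_ring_hit[OF assms(2,3)] prob_ring_hit[OF assms(4,5)] mean_edge_prob_def)
qed

text \<open>Within a fixed class of the third ring, hitting \<open>A\<close> and hitting
  \<open>B\<close> are negatively correlated. Mixing over the classes can destroy this, but p_1j
  \<le> \<lambda>_1 / m limits the damage to a factor 1 / m.\<close>

lemma prob_hit_both_le:
  assumes A: "A \<subseteq> {1..P}" "card A = K 1" and B: "B \<subseteq> {1..P}" "card B = K 1" and disj: "A \<inter> B = {}"
    and m: "0 < m" "\<And>j. j \<in> {1..r} \<Longrightarrow> m \<le> pmf \<mu> j"
  shows "measure_pmf.prob \<rho> {Z. A \<inter> Z \<noteq> {} \<and> B \<inter> Z \<noteq> {}} \<le> (mean_key_prob r \<mu> K P 1)\<^sup>2 / m"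
proof -
  let ?p = "key_prob K P 1" and ?l = "mean_key_prob r \<mu> K P 1"
  have r1: "1 \<in> {1..r}" using r by auto
  have l0: "0 \<le> ?l" unfolding mean_key_prob_def by (intro sum_nonneg mult_nonneg_nonneg key_prob_bounds) auto
  have each: "measure_pmf.prob (pmf_of_set (rings (K j))) {Z. A \<inter> Z \<noteq> {} \<and> B \<inter> Z \<noteq> {}} \<le> (?p j)\<^sup>2"
    if j: "j \<in> {1..r}" for j
  proof -
    let ?M = "pmf_of_set (rings (K j))"
    let ?A = "{Z. A \<inter> Z = {}}" and ?B = "{Z. B \<inter> Z = {}}"
    have KP: "K j \<le> P" by (rule K_bounds(4)[OF j])
    have "card (A \<union> B) = 2 * K 1"
      using A B disj by (subst card_Un_disjoint) (auto intro: finite_subset)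
    moreover have "?A \<inter> ?B = {Z. (A \<union> B) \<inter> Z = {}}" by auto
    ultimately have AB: "measure_pmf.prob ?M (?A \<inter> ?B) \<le> (miss_prob P (K 1) (K j))\<^sup>2"
      using prob_rings_avoid[of "A \<union> B" "K j"] A B KP miss_prob_double[of "K 1" P "K j"] K_bounds[OF r1]
      by auto
    have pA: "measure_pmf.prob ?M ?A = miss_prob P (K 1) (K j)"
      using prob_rings_avoid[OF A(1) KP] A by simp
    have pB: "measure_pmf.prob ?M ?B = miss_prob P (K 1) (K j)"
      using prob_rings_avoid[OF B(1) KP] B by simp
    have "measure_pmf.prob ?M {Z. A \<inter> Z \<noteq> {} \<and> B \<inter> Z \<noteq> {}} = 1 - measure_pmf.prob ?M (?A \<union> ?B)"
    proof -
      have "{Z. A \<inter> Z \<noteq> {} \<and> B \<inter> Z \<noteq> {}} = UNIV - (?A \<union> ?B)" by auto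
      then show ?thesis using measure_pmf.prob_compl[of "?A \<union> ?B" ?M] by simp
    qed
    also have "measure_pmf.prob ?M (?A \<union> ?B)
        = measure_pmf.prob ?M ?A + measure_pmf.prob ?M ?B - measure_pmf.prob ?M (?A \<inter> ?B)"
      by (rule measure_Un3) (auto simp: measure_pmf.fmeasurable_eq_sets)
    finally show ?thesis
      using AB unfolding pA pB key_prob_eq_miss by (simp add: power2_eq_square algebra_simps)
  qed
  have "measure_pmf.prob \<rho> {Z. A \<inter> Z \<noteq> {} \<and> B \<inter> Z \<noteq> {}} \<le> (\<Sum>j=1..r. pmf \<mu> j * (?p j)\<^sup>2)"
    unfolding prob_ring_pmf by (intro sum_mono mult_left_mono each) auto
  also have "\<dots> \<le> (\<Sum>j=1..r. pmf \<mu> j * ?p j * (?l / m))"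
  proof (intro sum_mono)
    fix j assume j: "j \<in> {1..r}"
    have "m * ?p j \<le> pmf \<mu> j * ?p j"
      using m(2)[OF j] key_prob_bounds by (intro mult_right_mono) auto
    also have "\<dots> \<le> ?l" by (rule mean_key_prob_ge[OF j])
    finally have "?p j \<le> ?l / m" using m by (simp add: field_simps)
    then have "pmf \<mu> j * ?p j * ?p j \<le> pmf \<mu> j * ?p j * (?l / m)"
      using key_prob_bounds by (intro mult_left_mono) auto
    then show "pmf \<mu> j * (?p j)\<^sup>2 \<le> pmf \<mu> j * ?p j * (?l / m)" by (simp add: power2_eq_square mult_ac)
  qed
  also have "\<dots> = ?l\<^sup>2 / m"
    unfolding sum_distrib_right[symmetric] mean_key_prob_def[symmetric] by (simp add: power2_eq_square)
  finally show ?thesis .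
qed

text \<open>The restriction to smallest rings makes the conditional probability of isolation a
  constant, so the first moment is exact.\<close>

definition isolated_event ::
    "'a set \<Rightarrow> 'a \<Rightarrow> (('a \<Rightarrow> nat set) \<times> ('a set \<Rightarrow> bool)) set" where
  "isolated_event V x = {(\<sigma>, B). card (\<sigma> x) = K 1 \<and> no_edges \<sigma> B {x} (V - {x})}"

lemma prob_isolated:
  assumes V: "finite V" "x \<in> V" and \<alpha>: "\<alpha> \<in> {0..1}"
  shows "measure_pmf.prob (joint_pmf V \<rho> \<alpha>) (isolated_event V x)
    = full_prob * (1 - mean_edge_prob r \<mu> K P \<alpha> 1) ^ (card V - 1)"
proof -
  let ?M = "Pi_pmf {x} {} (\<lambda>_. \<rho>)" and ?\<Lambda> = "mean_edge_prob r \<mu> K P \<alpha> 1"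
  have "measure_pmf.prob (joint_pmf V \<rho> \<alpha>) (isolated_event V x)
      = measure_pmf.expectation ?M
        (\<lambda>\<sigma>. of_bool (card (\<sigma> x) = K 1) * avoid_prob \<rho> \<alpha> {x} \<sigma> ^ card (V - {x}))"
    unfolding isolated_event_def using V \<alpha> by (intro prob_no_edges) auto
  also have "\<dots> = measure_pmf.expectation ?M
        (\<lambda>\<sigma>. of_bool (card (\<sigma> x) = K 1) * (1 - ?\<Lambda>) ^ (card V - 1))"
  proof (intro integral_cong_AE)
    show "AE \<sigma> in ?M. of_bool (card (\<sigma> x) = K 1) * avoid_prob \<rho> \<alpha> {x} \<sigma> ^ card (V - {x})
        = of_bool (card (\<sigma> x) = K 1) * (1 - ?\<Lambda>) ^ (card V - 1)"
    proof (rule AE_pmfI)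
      fix \<sigma> assume "\<sigma> \<in> set_pmf ?M"
      then have "\<sigma> x \<in> set_pmf \<rho>"
        using set_Pi_pmf_subset'[of "{x}" "{}" "\<lambda>_. \<rho>"] by (auto simp: PiE_dflt_def)
      then show "of_bool (card (\<sigma> x) = K 1) * avoid_prob \<rho> \<alpha> {x} \<sigma> ^ card (V - {x})
        = of_bool (card (\<sigma> x) = K 1) * (1 - ?\<Lambda>) ^ (card V - 1)"
        using V avoid_prob_single[OF ring_pmf_support(1), of \<sigma> x \<alpha>] by (auto simp: card_Diff_singleton)
    qed
  qed auto
  also have "\<dots> = measure_pmf.expectation (map_pmf (\<lambda>\<sigma>. \<sigma> x) ?M)
        (\<lambda>Z. indicator {Z. card Z = K 1} Z * (1 - ?\<Lambda>) ^ (card V - 1))"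
    by (simp add: indicator_def of_bool_def)
  also have "\<dots> = full_prob * (1 - ?\<Lambda>) ^ (card V - 1)"
    by (subst Pi_pmf_component) auto
  finally show ?thesis .
qed

text \<open>If the two rings are disjoint, \<open>prob_hit_both_le\<close> applies. If they meet, a
  shared key lets a third ring hit both at once, and only the bound by a single hit is available;
  the two independent edges still contribute \<alpha>^2, which gives the excess \<alpha>
  \<Lambda>.\<close>

lemma prob_isolated_pair_le:
  fixes V :: "'a set"
  assumes V: "finite V" "x \<in> V" "y \<in> V" "x \<noteq> y" and \<alpha>: "\<alpha> \<in> {0..1}"
    and m: "0 < m" "\<And>j. j \<in> {1..r} \<Longrightarrow> m \<le> pmf \<mu> j"
  defines "\<Lambda> \<equiv> mean_edge_prob r \<mu> K P \<alpha> 1" and "p \<equiv> key_prob K P 1 1"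
  shows "measure_pmf.prob (joint_pmf V \<rho> \<alpha>) (isolated_event V x \<inter> isolated_event V y)
    \<le> full_prob\<^sup>2 * ((1 - p) * (1 - 2 * \<Lambda> + \<Lambda>\<^sup>2 / m) ^ (card V - 2)
        + p * (1 - 2 * \<Lambda> + \<alpha> * \<Lambda>) ^ (card V - 2))"
proof -
  let ?M = "Pi_pmf {x, y} {} (\<lambda>_. \<rho>)" and ?k = "card V - 2"
  let ?A = "(1 - 2 * \<Lambda> + \<Lambda>\<^sup>2 / m) ^ ?k" and ?B = "(1 - 2 * \<Lambda> + \<alpha> * \<Lambda>) ^ ?k"
  let ?Q = "\<lambda>\<sigma>. card (\<sigma> x) = K 1 \<and> card (\<sigma> y) = K 1"
  define h where "h = (\<lambda>(Z1 :: nat set, Z2 :: nat set). of_bool (card Z1 = K 1) * (of_bool (card Z2 = K 1) *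
      (if Z1 \<inter> Z2 = {} then ?A else ?B)) :: real)"
  have finM: "finite (set_pmf ?M)"
    by (rule finite_subset[OF set_Pi_pmf_subset']) (auto intro!: finite_PiE_dflt finite_set_ring_pmf)
  \<comment> \<open>The possible edge between x and y is dropped, so that only a cut around the pair
    remains.\<close>
  have "measure_pmf.prob (joint_pmf V \<rho> \<alpha>) (isolated_event V x \<inter> isolated_event V y)
      \<le> measure_pmf.prob (joint_pmf V \<rho> \<alpha>) {(\<sigma>, B). ?Q \<sigma> \<and> no_edges \<sigma> B {x, y} (V - {x, y})}"
    by (intro measure_pmf.finite_measure_mono) (auto simp: isolated_event_def no_edges_def)
  also have "\<dots> = measure_pmf.expectation ?M
      (\<lambda>\<sigma>. of_bool (?Q \<sigma>) * avoid_prob \<rho> \<alpha> {x, y} \<sigma> ^ card (V - {x, y}))"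
    using V \<alpha> by (intro prob_no_edges) auto
  also have "\<dots> \<le> measure_pmf.expectation ?M (\<lambda>\<sigma>. h (\<sigma> x, \<sigma> y))"
  proof (intro integral_mono_AE integrable_measure_pmf_finite finM AE_pmfI)
    fix \<sigma> :: "'a \<Rightarrow> nat set" assume "\<sigma> \<in> set_pmf ?M"
    then have "\<sigma> x \<in> set_pmf \<rho>" "\<sigma> y \<in> set_pmf \<rho>"
      using set_Pi_pmf_subset'[of "{x, y}" "{}" "\<lambda>_. \<rho>"] by (auto simp: PiE_dflt_def)
    then have sub: "\<sigma> x \<subseteq> {1..P}" "\<sigma> y \<subseteq> {1..P}" using ring_pmf_support(1) by auto
    show "of_bool (?Q \<sigma>) * avoid_prob \<rho> \<alpha> {x, y} \<sigma> ^ card (V - {x, y}) \<le> h (\<sigma> x, \<sigma> y)"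
    proof (cases "?Q \<sigma>")
      case True
      have card: "card (V - {x, y}) = ?k" using V by (simp add: card_Diff_subset)
      let ?a = "avoid_prob \<rho> \<alpha> {x, y} \<sigma>"
      let ?h = "measure_pmf.prob \<rho> {Z. \<sigma> x \<inter> Z \<noteq> {} \<and> \<sigma> y \<inter> Z \<noteq> {}}"
      have a0: "0 \<le> ?a" by (rule avoid_prob_bounds[OF \<alpha>])
      have a: "?a = 1 - 2 * \<Lambda> + \<alpha>\<^sup>2 * ?h"
        unfolding \<Lambda>_def using avoid_prob_pair[OF V(4)] sub True by auto
      have "?a ^ ?k \<le> (if \<sigma> x \<inter> \<sigma> y = {} then ?A else ?B)"
      proof (cases "\<sigma> x \<inter> \<sigma> y = {}")
        case True': True
        have "\<alpha>\<^sup>2 * ?h \<le> \<alpha>\<^sup>2 * ((mean_key_prob r \<mu> K P 1)\<^sup>2 / m)"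
          using prob_hit_both_le[OF sub(1) _ sub(2) _ True' m] True by (intro mult_left_mono) auto
        also have "\<dots> = \<Lambda>\<^sup>2 / m" by (simp add: \<Lambda>_def mean_edge_prob_def power_mult_distrib)
        finally have "?a ^ ?k \<le> ?A" using a a0 by (intro power_mono) auto
        then show ?thesis using True' by simp
      next
        case False
        have "?h \<le> measure_pmf.prob \<rho> {Z. \<sigma> x \<inter> Z \<noteq> {}}"
          by (intro measure_pmf.finite_measure_mono) auto
        also have "\<dots> = mean_key_prob r \<mu> K P 1" using sub True by (intro prob_ring_hit) auto
        finally have "\<alpha>\<^sup>2 * ?h \<le> \<alpha>\<^sup>2 * mean_key_prob r \<mu> K P 1" by (intro mult_left_mono) auto
        also have "\<dots> = \<alpha> * \<Lambda>" by (simp add: \<Lambda>_def mean_edge_prob_def power2_eq_square)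
        finally have "?a ^ ?k \<le> ?B" using a a0 by (intro power_mono) auto
        then show ?thesis using False by simp
      qed
      then show ?thesis using True card by (simp add: h_def)
    qed (auto simp: h_def)
  qed
  also have "\<dots> = measure_pmf.expectation (pair_pmf \<rho> \<rho>) h"
  proof -
    have "?M = map_pmf (\<lambda>(Z, f). f(x := Z)) (pair_pmf \<rho> (Pi_pmf {y} {} (\<lambda>_. \<rho>)))"
      using V by (subst Pi_pmf_insert) auto
    also have "\<dots> = map_pmf (\<lambda>(Z1, Z2) b. if b = x then Z1 else if b = y then Z2 else {}) (pair_pmf \<rho> \<rho>)"
      unfolding Pi_pmf_singleton pair_map_pmf2 pmf.map_comp
      by (rule map_pmf_cong) (auto simp: apsnd_def map_prod_def fun_eq_iff)
    finally show ?thesis using V by (simp add: case_prod_unfold)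
  qed
  also have "\<dots> = measure_pmf.expectation \<rho> (\<lambda>Z1. measure_pmf.expectation \<rho> (\<lambda>Z2. h (Z1, Z2)))"
    by (rule expectation_pair_pmf_finite) (rule finite_set_ring_pmf)+
  also have "\<dots> = measure_pmf.expectation \<rho> (\<lambda>Z1. indicator {Z. card Z = K 1} Z1 *
      (full_prob * ((1 - p) * ?A + p * ?B)))"
  proof (intro integral_cong_AE AE_pmfI)
    fix Z1 assume Z1: "Z1 \<in> set_pmf \<rho>"
    show "measure_pmf.expectation \<rho> (\<lambda>Z2. h (Z1, Z2)) = indicator {Z. card Z = K 1} Z1 *
      (full_prob * ((1 - p) * ?A + p * ?B))"
    proof (cases "card Z1 = K 1")
      case True
      have "(\<lambda>Z2. h (Z1, Z2)) = (\<lambda>Z2. ?B * indicator {Z. card Z = K 1} Z2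
          + (?A - ?B) * indicator {Z. card Z = K 1 \<and> Z1 \<inter> Z = {}} Z2)"
        using True by (auto simp: h_def indicator_def)
      then have "measure_pmf.expectation \<rho> (\<lambda>Z2. h (Z1, Z2))
          = ?B * full_prob + (?A - ?B) * measure_pmf.prob \<rho> {Z. card Z = K 1 \<and> Z1 \<inter> Z = {}}"
        by (simp add: integrable_measure_pmf_finite finite_set_ring_pmf)
      also have "measure_pmf.prob \<rho> {Z. card Z = K 1 \<and> Z1 \<inter> Z = {}} = full_prob * (1 - p)"
        unfolding p_def using ring_pmf_support(1)[OF Z1] True by (intro prob_full_avoid)
      finally show ?thesis using True by (simp add: algebra_simps)
    qed (simp add: h_def)
  qed auto
  also have "\<dots> = full_prob\<^sup>2 * ((1 - p) * ?A + p * ?B)"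
    by (simp add: power2_eq_square)
  finally show ?thesis .
qed

lemma prob_connected_le:
  fixes V :: "'a set"
  assumes V: "finite V" "2 \<le> card V" and \<alpha>: "\<alpha> \<in> {0..1}"
    and m: "0 < m" "\<And>j. j \<in> {1..r} \<Longrightarrow> m \<le> pmf \<mu> j"
  defines "\<Lambda> \<equiv> mean_edge_prob r \<mu> K P \<alpha> 1" and "p \<equiv> key_prob K P 1 1"
  assumes \<Lambda>: "\<Lambda> < 1"
  shows "measure_pmf.prob (joint_pmf V \<rho> \<alpha>)
      {(\<sigma>, B). Digraph_Component.connected (with_proj (ring_edge_graph V \<sigma> B))}
    \<le> 1 / (real (card V) * m * (1 - \<Lambda>) ^ (card V - 1))
      + ((1 - p) * (1 - 2 * \<Lambda> + \<Lambda>\<^sup>2 / m) ^ (card V - 2) + p * (1 - 2 * \<Lambda> + \<alpha> * \<Lambda>) ^ (card V - 2))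
        / (1 - \<Lambda>) ^ (2 * (card V - 1)) - 1"
proof -
  let ?J = "joint_pmf V \<rho> \<alpha>" and ?E = "isolated_event V" and ?n = "card V"
  define q where "q = full_prob * (1 - \<Lambda>) ^ (?n - 1)"
  define R where "R = (1 - p) * (1 - 2 * \<Lambda> + \<Lambda>\<^sup>2 / m) ^ (?n - 2) + p * (1 - 2 * \<Lambda> + \<alpha> * \<Lambda>) ^ (?n - 2)"
  have r1: "1 \<in> {1..r}" using r by auto
  have pm: "m \<le> full_prob" using m(2)[OF r1] full_prob_ge by linarith
  have q0: "0 < q" unfolding q_def using pm m \<Lambda> by (intro mult_pos_pos) auto
  have qx: "measure_pmf.prob ?J (?E x) = q" if "x \<in> V" for x
    using prob_isolated[OF V(1) that \<alpha>] by (simp add: q_def \<Lambda>_def)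
  have pair: "measure_pmf.prob ?J (?E x \<inter> ?E y) \<le> full_prob\<^sup>2 * R" if "x \<in> V" "y \<in> V" "x \<noteq> y" for x y
    using prob_isolated_pair_le[OF V(1) that \<alpha> m] by (simp add: R_def \<Lambda>_def p_def)
  obtain u v where uv: "u \<in> V" "v \<in> V" "u \<noteq> v"
    using V by (metis card_2_iff' obtain_subset_with_card_n subsetD)
  \<comment> \<open>The sign is read off from the probability below it; the diagonal terms need
    it.\<close>
  have R0: "0 \<le> full_prob\<^sup>2 * R"
    by (rule order_trans[OF measure_nonneg pair[OF uv]])
  let ?s = "\<Sum>x\<in>V. measure_pmf.prob ?J (?E x)"
  have s: "?s = real ?n * q" by (simp add: qx)
  have s0: "0 < real ?n * q" using q0 V by simp
  have "measure_pmf.prob ?J {(\<sigma>, B). Digraph_Component.connected (with_proj (ring_edge_graph V \<sigma> B))}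
      \<le> measure_pmf.prob ?J {\<omega>. \<forall>x\<in>V. \<omega> \<notin> ?E x}"
  proof (intro measure_pmf.finite_measure_mono subsetI)
    fix \<omega> :: "('a \<Rightarrow> nat set) \<times> ('a set \<Rightarrow> bool)"
    assume "\<omega> \<in> {(\<sigma>, B). Digraph_Component.connected (with_proj (ring_edge_graph V \<sigma> B))}"
    then obtain \<sigma> B where \<omega>: "\<omega> = (\<sigma>, B)" "Digraph_Component.connected (with_proj (ring_edge_graph V \<sigma> B))"
      by auto
    have "\<not> no_edges \<sigma> B {x} (V - {x})" if "x \<in> V" for x
    proof -
      obtain y where "y \<in> V" "x \<noteq> y" using uv by metis
      then show ?thesis using connected_imp_not_isolated[OF \<omega>(2) that] by auto
    qed
    then show "\<omega> \<in> {\<omega>. \<forall>x\<in>V. \<omega> \<notin> ?E x}" by (auto simp: \<omega> isolated_event_def)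
  qed auto
  also have "\<dots> \<le> (\<Sum>x\<in>V. \<Sum>y\<in>V. measure_pmf.prob ?J (?E x \<inter> ?E y)) / (real ?n * q)\<^sup>2 - 1"
    using second_moment_bound[OF V(1), of "real ?n * q" ?J ?E] s s0 by simp
  also have "\<dots> \<le> (real ?n * q + (real ?n)\<^sup>2 * (full_prob\<^sup>2 * R)) / (real ?n * q)\<^sup>2 - 1"
  proof (intro diff_right_mono divide_right_mono)
    have "(\<Sum>x\<in>V. \<Sum>y\<in>V. measure_pmf.prob ?J (?E x \<inter> ?E y))
        \<le> (\<Sum>x\<in>V. \<Sum>y\<in>V. (if x = y then q else 0) + full_prob\<^sup>2 * R)"
      using qx pair R0 by (intro sum_mono) (auto simp: q0)
    also have "\<dots> = real ?n * q + (real ?n)\<^sup>2 * (full_prob\<^sup>2 * R)"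
      using V(1) by (simp add: sum.distrib power2_eq_square distrib_left mult.assoc)
    finally show "(\<Sum>x\<in>V. \<Sum>y\<in>V. measure_pmf.prob ?J (?E x \<inter> ?E y))
        \<le> real ?n * q + (real ?n)\<^sup>2 * (full_prob\<^sup>2 * R)" .
  qed auto
  also have "\<dots> = 1 / (real ?n * q) + R / (1 - \<Lambda>) ^ (2 * (?n - 1)) - 1"
  proof -
    have f0: "full_prob \<noteq> 0" using pm m by linarith
    have n0: "real ?n \<noteq> 0" using V by auto
    \<comment> \<open>\<open>full_prob\<close> cancels off the diagonal, so its lower bound
      \<open>m\<close> is used only in the diagonal term.\<close>
    have "(real ?n)\<^sup>2 * (full_prob\<^sup>2 * R) / (real ?n * q)\<^sup>2 = R / (1 - \<Lambda>) ^ (2 * (?n - 1))"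
      using f0 n0 unfolding power_even_eq by (simp add: q_def power_mult_distrib)
    moreover have "real ?n * q / (real ?n * q)\<^sup>2 = 1 / (real ?n * q)" by (simp add: power2_eq_square)
    ultimately show ?thesis by (simp add: add_divide_distrib)
  qed
  also have "1 / (real ?n * q) \<le> 1 / (real ?n * m * (1 - \<Lambda>) ^ (?n - 1))"
  proof (intro divide_left_mono)
    have "m * (1 - \<Lambda>) ^ (?n - 1) \<le> q"
      unfolding q_def using pm \<Lambda> by (intro mult_right_mono) auto
    then show "real ?n * m * (1 - \<Lambda>) ^ (?n - 1) \<le> real ?n * q"
      using mult_left_mono[of "m * (1 - \<Lambda>) ^ (?n - 1)" q "real ?n"] by (simp add: mult_ac)
  qed (use s0 V m \<Lambda> in auto)
  finally show ?thesis by (simp add: R_def)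
qed

end

section \<open>Limits\<close>

locale critical_scaling =
  fixes r :: nat and \<mu> :: "nat pmf"
    and K :: "nat \<Rightarrow> nat \<Rightarrow> nat" and P :: "nat \<Rightarrow> nat" and \<alpha> :: "nat \<Rightarrow> real" and c :: real
  assumes r: "1 \<le> r" and \<mu>: "set_pmf \<mu> = {1..r}" and scaling: "scaling r K P \<alpha>" and c: "0 < c"
    and asymp: "(\<lambda>n. mean_edge_prob r \<mu> (K n) (P n) (\<alpha> n) 1)
      \<sim>[sequentially] (\<lambda>n. c * (ln (real n) / real n))"
begin

abbreviation "\<Lambda> n \<equiv> mean_edge_prob r \<mu> (K n) (P n) (\<alpha> n) 1"
abbreviation "p11 n \<equiv> key_prob (K n) (P n) 1 1"
abbreviation "conn_prob n \<equiv> measure_pmf.prob (random_graph n \<mu> (K n) (P n) (\<alpha> n))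
  {G. Digraph_Component.connected (with_proj G)}"

definition min_pmf :: real where
  "min_pmf = Min (pmf \<mu> ` {1..r})"

lemma min_pmf: "0 < min_pmf" "min_pmf \<le> 1" "\<And>j. j \<in> {1..r} \<Longrightarrow> min_pmf \<le> pmf \<mu> j"
proof -
  have ne: "pmf \<mu> ` {1..r} \<noteq> {}" using r by auto
  show "0 < min_pmf"
    unfolding min_pmf_def using ne \<mu> by (subst Min_gr_iff) (auto simp: pmf_positive_iff)
  have le: "min_pmf \<le> pmf \<mu> j" if "j \<in> {1..r}" for j
    unfolding min_pmf_def using that by (intro Min_le) auto
  then show "\<And>j. j \<in> {1..r} \<Longrightarrow> min_pmf \<le> pmf \<mu> j" .
  show "min_pmf \<le> 1" using le[of 1] r pmf_le_1[of \<mu> 1] by auto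
qed

lemma alpha: "0 < \<alpha> n" "\<alpha> n < 1" "\<alpha> n \<in> {0..1}"
proof -
  have "\<alpha> n \<in> {0<..<1}" using scaling unfolding scaling_def by blast
  then show "0 < \<alpha> n" "\<alpha> n < 1" "\<alpha> n \<in> {0..1}" by auto
qed

lemma key_rings: "2 \<le> n \<Longrightarrow> key_rings r \<mu> (K n) (P n)"
proof
  assume "2 \<le> n"
  then have *: "1 \<le> K n 1" "mono_on {1..r} (K n)" "real (K n r) \<le> real (P n) / 2"
    using scaling unfolding scaling_def by auto
  then show "1 \<le> K n 1" "mono_on {1..r} (K n)" "2 * K n r \<le> P n" by auto
qed (use r \<mu> in auto)

lemma conn_prob_eq:
  "conn_prob n = measure_pmf.prob (joint_pmf {1..n} (ring_pmf \<mu> (K n) (P n)) (\<alpha> n))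
    {(\<sigma>, B). Digraph_Component.connected (with_proj (ring_edge_graph {1..n} \<sigma> B))}"
  unfolding random_graph_eq by (simp add: vimage_def case_prod_unfold)

lemma not_conn_prob_eq:
  "1 - conn_prob n = measure_pmf.prob (joint_pmf {1..n} (ring_pmf \<mu> (K n) (P n)) (\<alpha> n))
    {(\<sigma>, B). \<not> Digraph_Component.connected (with_proj (ring_edge_graph {1..n} \<sigma> B))}"
proof -
  have "UNIV - {(\<sigma> :: nat \<Rightarrow> nat set, B). Digraph_Component.connected (with_proj (ring_edge_graph {1..n} \<sigma> B))}
      = {(\<sigma>, B). \<not> Digraph_Component.connected (with_proj (ring_edge_graph {1..n} \<sigma> B))}"
    by auto
  then show ?thesis
    unfolding conn_prob_eq
    using measure_pmf.prob_compl[of "{(\<sigma>, B). Digraph_Component.connected (with_proj (ring_edge_graph {1..n} \<sigma> B))}"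
        "joint_pmf {1..n} (ring_pmf \<mu> (K n) (P n)) (\<alpha> n)"]
    by simp
qed

lemma ratio_tendsto: "(\<lambda>n. \<Lambda> n * (real n / ln (real n))) \<longlonglongrightarrow> c"
proof -
  have ev: "eventually (\<lambda>n. \<Lambda> n \<noteq> 0 \<or> c * (ln (real n) / real n) \<noteq> 0) sequentially"
    using eventually_gt_at_top[of 1] by eventually_elim (use c in auto)
  have "(\<lambda>n. \<Lambda> n / (c * (ln (real n) / real n))) \<longlonglongrightarrow> 1"
    by (rule asymp_equivD_strong[OF asymp ev])
  then have "(\<lambda>n. c * (\<Lambda> n / (c * (ln (real n) / real n)))) \<longlonglongrightarrow> c * 1"
    by (intro tendsto_intros)
  then show ?thesis using c by simp
qed

lemma Lambda_tendsto_0: "\<Lambda> \<longlonglongrightarrow> 0"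
proof -
  have "(\<lambda>n. ln (real n) / real n) \<longlonglongrightarrow> 0" by real_asymp
  then have "(\<lambda>n. \<Lambda> n * (real n / ln (real n)) * (ln (real n) / real n)) \<longlonglongrightarrow> c * 0"
    by (intro tendsto_mult ratio_tendsto)
  moreover have "eventually (\<lambda>n. \<Lambda> n * (real n / ln (real n)) * (ln (real n) / real n) = \<Lambda> n) sequentially"
    using eventually_gt_at_top[of 1] by eventually_elim auto
  ultimately show ?thesis by (simp add: tendsto_cong)
qed

lemma zero_law:
  assumes "c < 1"
  shows "conn_prob \<longlonglongrightarrow> 0"
proof -
  \<comment> \<open>The room between c and c' absorbs the factor (1 - \<Lambda>)^2 demanded by
    \<open>isolated_moment_estimate\<close>.\<close>
  define c' where "c' = (c + 1) / 2"
  have c': "c < c'" "c' < 1" "0 < c'" using assms c by (auto simp: c'_def)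
  define m where "m = min_pmf"
  have m: "0 < m" "m \<le> 1" "\<And>j. j \<in> {1..r} \<Longrightarrow> m \<le> pmf \<mu> j" using min_pmf by (auto simp: m_def)
  define g where "g n = real n powr (c' - 1) / m
      + (exp ((c' * ln (real n))\<^sup>2 / (m * real n)) + c'\<^sup>2 * (ln (real n))\<^sup>2 * real n powr (c' - 1) / m)
        / (1 - \<Lambda> n)\<^sup>2 - 1" for n
  have lim1: "(\<lambda>n. 1 / (1 - \<Lambda> n)\<^sup>2) \<longlonglongrightarrow> 1 / (1 - 0)\<^sup>2"
    by (intro tendsto_intros Lambda_tendsto_0) auto
  have "g \<longlonglongrightarrow> 0 + (1 + 0) * (1 / (1 - 0)\<^sup>2) - 1"
  proof -
    have "(\<lambda>n. real n powr (c' - 1) / m) \<longlonglongrightarrow> 0" using c' m by real_asymp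
    moreover have "(\<lambda>n. exp ((c' * ln (real n))\<^sup>2 / (m * real n))) \<longlonglongrightarrow> 1" using c' m by real_asymp
    moreover have "(\<lambda>n. c'\<^sup>2 * (ln (real n))\<^sup>2 * real n powr (c' - 1) / m) \<longlonglongrightarrow> 0" using c' m by real_asymp
    ultimately have "(\<lambda>n. real n powr (c' - 1) / m
      + (exp ((c' * ln (real n))\<^sup>2 / (m * real n)) + c'\<^sup>2 * (ln (real n))\<^sup>2 * real n powr (c' - 1) / m)
        * (1 / (1 - \<Lambda> n)\<^sup>2) - 1) \<longlonglongrightarrow> 0 + (1 + 0) * (1 / (1 - 0)\<^sup>2) - 1"
      by (intro tendsto_intros lim1)
    moreover have "g = (\<lambda>n. real n powr (c' - 1) / m
      + (exp ((c' * ln (real n))\<^sup>2 / (m * real n)) + c'\<^sup>2 * (ln (real n))\<^sup>2 * real n powr (c' - 1) / m)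
        * (1 / (1 - \<Lambda> n)\<^sup>2) - 1)"
      by (simp add: g_def fun_eq_iff)
    ultimately show ?thesis by simp
  qed
  then have g: "g \<longlonglongrightarrow> 0" by simp
  have "(\<lambda>n. \<Lambda> n * (real n / ln (real n)) * (1 / (1 - \<Lambda> n)\<^sup>2)) \<longlonglongrightarrow> c * (1 / (1 - 0)\<^sup>2)"
    by (intro tendsto_mult ratio_tendsto lim1)
  then have ev1: "eventually (\<lambda>n. \<Lambda> n * (real n / ln (real n)) * (1 / (1 - \<Lambda> n)\<^sup>2) < c') sequentially"
    using c' by (intro order_tendstoD) auto
  have ev2: "eventually (\<lambda>n. \<Lambda> n < 1 / 2) sequentially"
    using Lambda_tendsto_0 by (intro order_tendstoD) auto
  have ev3: "eventually (\<lambda>n. 0 < \<Lambda> n * (real n / ln (real n))) sequentially"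
    using ratio_tendsto c by (intro order_tendstoD) auto
  have "eventually (\<lambda>n. conn_prob n \<le> g n) sequentially"
    using ev1 ev2 ev3 eventually_ge_at_top[of 2]
  proof eventually_elim
    case (elim n)
    interpret key_rings r \<mu> "K n" "P n" using key_rings[of n] elim by simp
    have ln: "0 < ln (real n)" using elim by simp
    have \<Lambda>0: "0 < \<Lambda> n" using elim ln by (simp add: zero_less_mult_iff zero_less_divide_iff)
    have "\<Lambda> n * (real n / ln (real n)) \<le> c' * (1 - \<Lambda> n)\<^sup>2"
      using elim by (simp add: field_simps)
    then have \<Lambda>: "real n * \<Lambda> n \<le> c' * (1 - \<Lambda> n)\<^sup>2 * ln (real n)"
      using ln by (simp add: field_simps)
    have pm: "m * (\<alpha> n * p11 n) \<le> \<Lambda> n"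
    proof -
      have "m * p11 n \<le> pmf \<mu> 1 * p11 n" using m(3)[of 1] r key_prob_bounds by (intro mult_right_mono) auto
      also have "\<dots> \<le> mean_key_prob r \<mu> (K n) (P n) 1" using r by (intro mean_key_prob_ge) auto
      finally have "\<alpha> n * (m * p11 n) \<le> \<alpha> n * mean_key_prob r \<mu> (K n) (P n) 1"
        using alpha[of n] by (intro mult_left_mono) auto
      then show ?thesis by (simp add: mean_edge_prob_def mult_ac)
    qed
    have "conn_prob n \<le> 1 / (real n * m * (1 - \<Lambda> n) ^ (n - 1))
      + ((1 - p11 n) * (1 - 2 * \<Lambda> n + (\<Lambda> n)\<^sup>2 / m) ^ (n - 2) + p11 n * (1 - 2 * \<Lambda> n + \<alpha> n * \<Lambda> n) ^ (n - 2))
        / (1 - \<Lambda> n) ^ (2 * (n - 1)) - 1"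
      using prob_connected_le[of "{1..n}" "\<alpha> n" m] elim alpha[of n] m unfolding conn_prob_eq by simp
    also have "\<dots> \<le> g n"
      unfolding g_def using elim \<Lambda>0 \<Lambda> m pm alpha[of n] c' key_prob_bounds
      by (intro isolated_moment_estimate) auto
    finally show ?case .
  qed
  then show ?thesis
    by (intro tendsto_sandwich[OF _ _ tendsto_const g]) auto
qed

lemma one_law:
  assumes "1 < c" and \<sigma>: "0 < \<sigma>" "\<And>n. 1 \<le> n \<Longrightarrow> \<sigma> * real n \<le> real (P n)"
    and p11: "p11 \<in> \<omega>(\<lambda>n. 1 / (real n * \<alpha> n))"
  shows "conn_prob \<longlonglongrightarrow> 1"
proof -
  \<comment> \<open>Three factors 1 - \<epsilon> are lost in the cut bound for small sets, the
    fourth in \<Lambda> n \<ge> (1 - \<epsilon>) c ln n.\<close>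
  have "((\<lambda>\<epsilon>. (1 - \<epsilon>) ^ 4 * c) \<longlongrightarrow> (1 - 0) ^ 4 * c) (at_right (0::real))"
    by (intro tendsto_intros)
  then have "eventually (\<lambda>\<epsilon>. 1 < (1 - \<epsilon>) ^ 4 * c) (at_right (0::real))"
    using assms(1) by (intro order_tendstoD) auto
  moreover have "eventually (\<lambda>\<epsilon>. \<epsilon> < 1 / 2) (at_right (0::real))"
    by (rule eventually_at_right_less[THEN eventually_rev_mp]) (auto simp: eventually_at_right_field intro!: exI[of _ "1/2"])
  moreover have "eventually (\<lambda>\<epsilon>. 0 < \<epsilon>) (at_right (0::real))" by (rule eventually_at_right_less)
  ultimately have "eventually (\<lambda>\<epsilon>. 1 < (1 - \<epsilon>) ^ 4 * c \<and> \<epsilon> < 1 / 2 \<and> 0 < \<epsilon>) (at_right (0::real))"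
    by eventually_elim auto
  then obtain \<epsilon> :: real where \<epsilon>: "1 < (1 - \<epsilon>) ^ 4 * c" "\<epsilon> < 1 / 2" "0 < \<epsilon>"
    using eventually_happens'[OF trivial_limit_at_right_real] by blast
  define m \<delta> \<kappa> where "m = min_pmf" and "\<delta> = (1 - \<epsilon>) ^ 4 * c - 1" and "\<kappa> = exp (- 1 - 1 / \<epsilon>)"
  have m: "0 < m" "m \<le> 1" "\<And>j. j \<in> {1..r} \<Longrightarrow> m \<le> pmf \<mu> j" using min_pmf by (auto simp: m_def)
  have \<kappa>: "0 < \<kappa>" by (simp add: \<kappa>_def)
  have \<delta>: "0 < \<delta>" using \<epsilon> by (simp add: \<delta>_def)
  define t where "t = 2 * \<epsilon> * m / (1 + 4 / \<kappa>)"
  have k1: "1 \<le> 1 + 4 / \<kappa>" "0 < 1 + 4 / \<kappa>" using \<kappa> by (auto simp: add_pos_nonneg)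
  have t: "0 < t" "t * (1 + 4 / \<kappa>) \<le> 2 * \<epsilon> * m" "t \<le> 1"
  proof -
    show "0 < t" unfolding t_def using \<epsilon> m k1 by (intro divide_pos_pos) auto
    show "t * (1 + 4 / \<kappa>) \<le> 2 * \<epsilon> * m" unfolding t_def using k1 by simp
    have "t \<le> 2 * \<epsilon> * m / 1" unfolding t_def using \<epsilon> m k1 by (intro divide_left_mono) auto
    also have "\<dots> \<le> 1 * 1" using \<epsilon> m by (simp only: div_by_1) (intro mult_mono, auto)
    finally show "t \<le> 1" by simp
  qed
  \<comment> \<open>Solves \<epsilon>2 (1 - ln (t / 64)) = t / 64; the added 1 keeps the denominator
    positive and only weakens the requirement to an inequality.\<close>
  define \<epsilon>2 where "\<epsilon>2 = t / 64 / (1 - ln (t / 64))"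
  have lnt: "ln (t / 64) \<le> 0" using t by simp
  then have lnt1: "0 < 1 - ln (t / 64)" by linarith
  have \<epsilon>2: "0 < \<epsilon>2" "- \<epsilon>2 * ln (t / 64) \<le> t / 64"
  proof -
    show e: "0 < \<epsilon>2" unfolding \<epsilon>2_def using t(1) lnt1 by (intro divide_pos_pos) auto
    have "- \<epsilon>2 * ln (t / 64) \<le> \<epsilon>2 * (1 - ln (t / 64))" using e by (simp add: algebra_simps)
    also have "\<dots> = t / 64" using lnt1 unfolding \<epsilon>2_def by (metis less_irrefl nonzero_eq_divide_eq)
    finally show "- \<epsilon>2 * ln (t / 64) \<le> t / 64" .
  qed
  have p_large: "eventually (\<lambda>n. W \<le> real n * \<alpha> n * p11 n) sequentially" if "0 < W" for W
    using landau_omega.smallD[OF p11 that] eventually_ge_at_top[of 2]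
  proof eventually_elim
    case (elim n)
    interpret key_rings r \<mu> "K n" "P n" using key_rings[of n] elim by simp
    have pos: "0 < real n * \<alpha> n" using elim alpha[of n] by simp
    have "W * (1 / (real n * \<alpha> n)) \<le> p11 n"
      using elim pos key_prob_bounds[of 1 1] by simp
    then show ?case using pos by (simp add: field_simps)
  qed
  \<comment> \<open>P times the key probability is at most 2 (K 1)^2 by \<open>key_prob_le\<close>,
    but at least \<sigma> n \<alpha> times it, which tends to infinity.\<close>
  have K_large: "filterlim (\<lambda>n. real (K n 1)) at_top sequentially"
    unfolding filterlim_at_top_gt[where c = 0]
  proof (intro allI impI)
    fix Z :: real assume Z: "0 < Z"
    have "0 < 2 * Z\<^sup>2 / \<sigma>" using Z \<sigma> by simp
    from p_large[OF this] show "eventually (\<lambda>n. Z \<le> real (K n 1)) sequentially"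
      using eventually_ge_at_top[of 2]
    proof eventually_elim
      case (elim n)
      interpret key_rings r \<mu> "K n" "P n" using key_rings[of n] elim by simp
      have "2 * Z\<^sup>2 / \<sigma> \<le> real n * \<alpha> n * p11 n" using elim by simp
      also have "\<dots> \<le> real n * 1 * p11 n"
        using alpha[of n] key_prob_bounds by (intro mult_right_mono mult_left_mono) auto
      finally have "2 * Z\<^sup>2 \<le> \<sigma> * real n * p11 n" using \<sigma> by (simp add: field_simps)
      also have "\<dots> \<le> real (P n) * p11 n"
        using \<sigma>(2)[of n] elim key_prob_bounds by (intro mult_right_mono) auto
      also have "\<dots> \<le> 2 * (real (K n 1))\<^sup>2" using key_prob_le by (simp add: mult.commute)
      finally have "Z\<^sup>2 \<le> (real (K n 1))\<^sup>2" by simp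
      then show ?case by (rule power2_le_imp_le) simp
    qed
  qed
  define \<eta> where "\<eta> n = exp 2 * (exp (1 / \<epsilon>) / \<sigma>) * real (K n 1) * exp (- \<epsilon> * real (K n 1))" for n
  have \<eta>: "\<eta> \<longlonglongrightarrow> 0"
  proof -
    have "((\<lambda>x. exp 2 * (exp (1 / \<epsilon>) / \<sigma>) * x * exp (- \<epsilon> * x)) \<longlongrightarrow> 0) at_top"
      using \<epsilon> \<sigma> by real_asymp
    from filterlim_compose[OF this K_large] show ?thesis by (simp add: \<eta>_def[abs_def])
  qed
  define g where "g n = 2 * \<eta> n + (2 * real n powr (- \<delta>) + real n * (exp (- (t * real n / 32)) + exp (- real n)))" for n
  have g: "g \<longlonglongrightarrow> 2 * 0 + 0"
  proof -
    have "(\<lambda>n. 2 * real n powr (- \<delta>) + real n * (exp (- (t * real n / 32)) + exp (- real n))) \<longlonglongrightarrow> 0"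
      using \<delta> t by real_asymp
    then show ?thesis unfolding g_def by (intro tendsto_intros \<eta>)
  qed
  have "filterlim (\<lambda>n. ln (real n)) at_top sequentially" by real_asymp
  then have ev_ln: "eventually (\<lambda>n. t / (\<epsilon> * ((1 - \<epsilon>) * c)) \<le> ln (real n)) sequentially"
    by (simp add: filterlim_at_top)
  have ev_ratio: "eventually (\<lambda>n. (1 - \<epsilon>) * c < \<Lambda> n * (real n / ln (real n))) sequentially"
    using ratio_tendsto \<epsilon> c by (intro order_tendstoD) auto
  have ev_\<Lambda>: "eventually (\<lambda>n. \<Lambda> n < t / 2) sequentially"
    using Lambda_tendsto_0 t by (intro order_tendstoD) auto
  have ev_\<eta>: "eventually (\<lambda>n. \<eta> n < 1 / 2) sequentially"
    using \<eta> by (intro order_tendstoD) auto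
  have "(\<lambda>n. real n powr (- \<delta>)) \<longlonglongrightarrow> 0" using \<delta> by real_asymp
  then have ev_\<delta>: "eventually (\<lambda>n. real n powr (- \<delta>) < 1 / 2) sequentially"
    by (intro order_tendstoD) auto
  \<comment> \<open>20 / \<kappa> here and 10 / \<epsilon>2 in \<open>ev_p\<close> bring both
    exponentials of \<open>H4\<close> below exp (-5), and 2 exp (-5) \<le> exp (-4). The bound 1 /
    \<epsilon> is what the expansion estimate asks for.\<close>
  have ev_K: "eventually (\<lambda>n. max (1 / \<epsilon>) (20 / \<kappa>) \<le> real (K n 1)) sequentially"
    using K_large unfolding filterlim_at_top by blast
  have ev_p: "eventually (\<lambda>n. 10 / \<epsilon>2 \<le> real n * \<alpha> n * p11 n) sequentially"
    using \<epsilon>2 by (intro p_large) simp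
  have g0: "g \<longlonglongrightarrow> 0" using g by simp
  have "eventually (\<lambda>n. 1 - conn_prob n \<le> g n) sequentially"
    using ev_ln ev_ratio ev_\<Lambda> ev_\<eta> ev_\<delta> ev_K ev_p eventually_ge_at_top[of 2]
  proof eventually_elim
    case (elim n)
    interpret key_rings r \<mu> "K n" "P n" using key_rings[of n] elim by simp
    have ln: "0 < ln (real n)" using elim by simp
    have ratio: "(1 - \<epsilon>) * c * ln (real n) \<le> \<Lambda> n * real n"
      using elim(2) ln by (simp add: field_simps)
    have ec: "0 < (1 - \<epsilon>) * c" using \<epsilon> c by simp
    then have "0 < \<Lambda> n * real n" using ratio ln by (smt (verit) mult_pos_pos)
    then have \<Lambda>0: "0 < \<Lambda> n" using elim by (simp add: zero_less_mult_iff)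
    have H1: "(1 + \<delta>) * ln (real n) \<le> (1 - \<epsilon>) ^ 3 * \<Lambda> n * real n"
    proof -
      have "(1 + \<delta>) * ln (real n) = (1 - \<epsilon>) ^ 3 * ((1 - \<epsilon>) * c * ln (real n))"
        by (simp add: \<delta>_def power_Suc2[symmetric] eval_nat_numeral mult_ac)
      also have "\<dots> \<le> (1 - \<epsilon>) ^ 3 * (\<Lambda> n * real n)"
        using \<epsilon> ratio by (intro mult_left_mono) auto
      finally show ?thesis by simp
    qed
    have H2: "t \<le> \<epsilon> * \<Lambda> n * real n"
    proof -
      have "t \<le> \<epsilon> * ((1 - \<epsilon>) * c * ln (real n))"
        using elim(1) ec \<epsilon> by (simp add: field_simps)
      also have "\<dots> \<le> \<epsilon> * (\<Lambda> n * real n)" using ratio \<epsilon> by (intro mult_left_mono) auto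
      finally show ?thesis by simp
    qed
    have H4: "exp (- (\<epsilon>2 * real n * \<alpha> n * p11 n / 2)) + exp (- (\<kappa> * real (K n 1) / 4)) \<le> exp (- 4)"
    proof -
      have "10 \<le> \<epsilon>2 * real n * \<alpha> n * p11 n" using elim(7) \<epsilon>2 by (simp add: field_simps)
      then have "exp (- (\<epsilon>2 * real n * \<alpha> n * p11 n / 2)) \<le> exp (- 5)" by simp
      moreover have "20 \<le> \<kappa> * real (K n 1)" using elim(6) \<kappa> by (simp add: field_simps)
      then have "exp (- (\<kappa> * real (K n 1) / 4)) \<le> exp (- 5)" by simp
      moreover have "2 * exp (- 5) \<le> exp 1 * exp (- 5 :: real)"
        using exp_ge_add_one_self[of 1] by (intro mult_right_mono) auto
      moreover have "exp 1 * exp (- 5) = exp (- 4 :: real)" by (simp flip: exp_add)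
      ultimately show ?thesis by linarith
    qed
    have K\<epsilon>: "1 \<le> \<epsilon> * real (K n 1)" using elim(6) \<epsilon> by (simp add: field_simps)
    have V: "finite {1..n}" "{1..n} \<noteq> {}" "card {1..n} = n" using elim by auto
    have \<sigma>n: "\<sigma> * real n \<le> real (P n)" using \<sigma>(2)[of n] elim by simp
    have \<eta>n: "exp 2 * (exp (1 / \<epsilon>) / \<sigma>) * real (K n 1) * exp (- \<epsilon> * real (K n 1)) \<le> 1 / 2"
      using elim(4) by (simp add: \<eta>_def)
    have \<epsilon>': "\<epsilon> \<le> 1 / 2" using \<epsilon> by simp
    have t64: "t \<le> 64" using t by simp
    have H3: "2 * \<Lambda> n \<le> t" using elim(3) by simp
    have \<delta>n: "real n powr (- \<delta>) \<le> 1 / 2" using elim(5) by simp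
    have "measure_pmf.prob (joint_pmf {1..n} (ring_pmf \<mu> (K n) (P n)) (\<alpha> n))
        {(\<sigma>, B). \<not> Digraph_Component.connected (with_proj (ring_edge_graph {1..n} \<sigma> B))} \<le> g n"
      unfolding g_def \<eta>_def
      by (rule prob_not_connected_le[where V = "{1..n}", unfolded V(3),
            OF V(1,2) alpha(3) \<epsilon>(3) \<epsilon>' m(1,3) \<sigma>(1) \<sigma>n K\<epsilon> \<eta>n t(1) t(2)[unfolded \<kappa>_def] \<epsilon>2(2) t64
              H1 H2 H3 \<Lambda>0 H4[unfolded \<kappa>_def] \<delta>n])
    then show ?case unfolding not_conn_prob_eq .
  qed
  then have "(\<lambda>n. 1 - conn_prob n) \<longlonglongrightarrow> 0"
    by (intro tendsto_sandwich[OF _ _ tendsto_const g0]) auto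
  from tendsto_diff[OF tendsto_const[of 1] this] show ?thesis by simp
qed

end

theorem theorem3p2:
  fixes r :: nat and \<mu> :: "nat pmf"
    and K :: "nat \<Rightarrow> nat \<Rightarrow> nat" and P :: "nat \<Rightarrow> nat" and \<alpha> :: "nat \<Rightarrow> real"
    and c \<sigma> :: real
  assumes "r \<ge> 1"
    and "set_pmf \<mu> = {1..r}"
    and "scaling r K P \<alpha>"
    and "c > 0"
    and "(\<lambda>n. mean_edge_prob r \<mu> (K n) (P n) (\<alpha> n) 1) \<sim>[sequentially] (\<lambda>n. c * (ln (real n) / real n))"
    and "\<sigma> > 0"
    and "\<And>n. n \<ge> 1 \<Longrightarrow> real (P n) \<ge> \<sigma> * real n"
    and "(\<lambda>n. key_prob (K n) (P n) 1 1) \<in> \<omega>[sequentially](\<lambda>n. 1 / (real n * \<alpha> n))"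
  shows "(c < 1 \<longrightarrow>
            (\<lambda>n. measure_pmf.prob (random_graph n \<mu> (K n) (P n) (\<alpha> n))
                   {G. Digraph_Component.connected (with_proj G)}) \<longlonglongrightarrow> 0) \<and>
         (c > 1 \<longrightarrow>
            (\<lambda>n. measure_pmf.prob (random_graph n \<mu> (K n) (P n) (\<alpha> n))
                   {G. Digraph_Component.connected (with_proj G)}) \<longlonglongrightarrow> 1)"
proof -
  interpret critical_scaling r \<mu> K P \<alpha> c
    using assms by unfold_locales auto
  show ?thesis
    using zero_law one_law[OF _ assms(6,7,8)] by blast
qed

end
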